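(* Let $X$ be a ball quasi-Banach function space on $\mathbb R^n$ satisfying condition (FS) below for some $p_-\in(0,\infty)$; put $\underline p:=\min\{p_-,1\}$. Assume that for any $r\in(0,\underline p)$, $X^{1/r}$ is a ball Banach function space, and that there exist $r_0\in(0,\underline p)$, $p_0\in(r_0,\infty)$ and $C>0$ such that $\|\mathcal M^{((p_0/r_0)')}(f)\|_{(X^{1/r_0})'}\le C\|f\|_{(X^{1/r_0})'}$ for all $f\in(X^{1/r_0})'$. Let $f:\mathbb R^{n+1}_+\to\mathbb C$ be measurable. Then $f\in WT^1_X(\mathbb R^{n+1}_+)$ if and only if there exists a sequence $\{a_{i,j}\}_{i\in\mathbb Z,j\in\mathbb N}$ of $(T_X,\infty)$-atoms associated, respectively, with balls $\{B_{i,j}\}_{i\in\mathbb Z,j\in\mathbb N}$ such that: (i) $f=\sum_{i\in\mathbb Z}\sum_{j\in\mathbb N}\lambda_{i,j}a_{i,j}$ almost everywhere on $\mathbb R^{n+1}_+$, where $\lambda_{i,j}:=2^i\|\mathbf 1_{B_{i,j}}\|_X$; (ii) $\sup_{i\in\mathbb Z}2^i\|\sum_{j\in\mathbb N}\mathbf 1_{B_{i,j}}\|_X<\infty$; (iii) there exist $c\in(0,1]$ and $M_0\in\mathbb N$, independent of $i,j,f$, such that $\sum_{j\in\mathbb N}\mathbf 1_{cB_{i,j}}\le M_0$ for every $i\in\mathbb Z$. Moreover, $\|f\|_{WT^1_X(\mathbb R^{n+1}_+)}\sim\inf[\sup_{i\in\mathbb Z}2^i\|\sum_{j\in\mathbb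 N}\mathbf 1_{B_{i,j}}\|_X]$, where the infimum is taken over all such decompositions of $f$ and the positive equivalence constants are independent of $f$.
   Context: A ball quasi-Banach function space is a quasi-Banach space $X$ of measurable functions on $\mathbb R^n$ such that: $\|f\|_X=0$ implies $f=0$ a.e.; $|g|\le|f|$ a.e. implies $\|g\|_X\le\|f\|_X$; $0\le f_m\uparrow f$ a.e. implies $\|f_m\|_X\uparrow\|f\|_X$; and $\mathbf 1_B\in X$ for every ball $B$. It is a ball Banach function space if moreover $\|\cdot\|_X$ satisfies the triangle inequality and for every ball $B$ there is $C_B$ with $\int_B|f|\le C_B\|f\|_X$. For a ball Banach function space $Y$, $Y'$ is its associate space: measurable $f$ with $\|f\|_{Y'}:=\sup\{\|fg\|_{L^1}:\|g\|_Y=1\}<\infty$. $X^p:=\{f:|f|^p\in X\}$, $\|f\|_{X^p}:=\||f|^p\|_X^{1/p}$. $WX$: measurable $f$ with $\|f\|_{WX}:=\sup_{\alpha>0}\alpha\|\mathbf 1_{\{|f|>\alpha\}}\|_X<\infty$. $\mathcal M$ is the Hardy--Littlewood maximal operator over balls, $\mathcal M^{(\theta)}(f):=[\mathcal M(|f|^\theta)]^{1/\theta}$, $(p_0/r_0)'$ the conjugate exponent. Condition (FS) for $p_-$: for all $p\in(0,p_-)$, $s\in(1,\infty)$, $\|\{\sum_j[\mathcal M(f_j)]^s\}^{1/s}\|_{X^{1/p}}\le C\|\{\sum_j|f_j|^s\}^{1/s}\|_{X^{1/p}}$. $\mathbb R^{n+1}_+:=\mathbb R^n\times(0,\infty)$.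 For $\alpha>0$, $\Gamma_\alpha(x):=\{(y,t)\in\mathbb R^{n+1}_+:|x-y|<\alpha t\}$ and $\mathcal A^{(\alpha)}(F)(x):=[\int_{\Gamma_\alpha(x)}|F(y,t)|^2\frac{dy\,dt}{t^{n+1}}]^{1/2}$. $WT^1_X(\mathbb R^{n+1}_+)$ is the set of measurable $F$ on $\mathbb R^{n+1}_+$ with $\|F\|_{WT^1_X}:=\|\mathcal A^{(1)}(F)\|_{WX}<\infty$. For $p\in(0,\infty)$, $T_2^p(\mathbb R^{n+1}_+)$ is the set of $F$ with $\|F\|_{T_2^p}:=\|\mathcal A^{(1)}(F)\|_{L^p(\mathbb R^n)}<\infty$. For a ball $B=B(x,r)$, $T(B):=\{(y,t):0<t<r,\ |y-x|<r-t\}$. For $p\in(1,\infty)$, a $(T_X,p)$-atom is a measurable $a$ on $\mathbb R^{n+1}_+$ for which there is a ball $B$ with $\mathrm{supp}\,a\subset T(B)$ and $\|a\|_{T_2^p}\le|B|^{1/p}/\|\mathbf 1_B\|_X$; a $(T_X,\infty)$-atom (associated with $B$) is a function that is a $(T_X,p)$-atom associated with $B$ for every $p\in(1,\infty)$. *)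

theory Defs
  imports "HOL-Analysis.Analysis"
begin

text \<open>Power of an extended nonnegative real (for p > 0): top stays top.\<close>
definition epowr :: "ennreal \<Rightarrow> real \<Rightarrow> ennreal" where
  "epowr x p = (if x = top then top else ennreal (enn2real x powr p))"

text \<open>A (quasi-)norm on measurable real functions on R^n is modelled as a map
  X :: (real^'n => real) => ennreal; the space is {f measurable. X f < top}.\<close>

definition ball_qBfs :: "((real^'n \<Rightarrow> real) \<Rightarrow> ennreal) \<Rightarrow> bool" where
  "ball_qBfs X \<longleftrightarrow>
     (\<forall>f\<in>borel_measurable lebesgue. X f = 0 \<longrightarrow> (AE x in lebesgue. f x = 0)) \<and>
     (\<forall>f\<in>borel_measurable lebesgue. \<forall>c::real. X (\<lambda>x. c * f x) = ennreal \<bar>c\<bar> * X f) \<and>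
     (\<exists>K\<ge>1. \<forall>f\<in>borel_measurable lebesgue. \<forall>g\<in>borel_measurable lebesgue.
         X (\<lambda>x. f x + g x) \<le> ennreal K * (X f + X g)) \<and>
     (\<forall>f\<in>borel_measurable lebesgue. \<forall>g\<in>borel_measurable lebesgue.
         (AE x in lebesgue. \<bar>g x\<bar> \<le> \<bar>f x\<bar>) \<longrightarrow> X g \<le> X f) \<and>
     (\<forall>F f. (\<forall>m. F m \<in> borel_measurable lebesgue) \<and> f \<in> borel_measurable lebesgue \<and>
         (AE x in lebesgue. \<forall>m. 0 \<le> F m x \<and> F m x \<le> F (Suc m) x) \<and>
         (AE x in lebesgue. (\<lambda>m. F m x) \<longlonglongrightarrow> f x)
         \<longrightarrow> (\<lambda>m. X (F m)) \<longlonglongrightarrow> X f) \<and>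
     (\<forall>c r. 0 < r \<longrightarrow> X (indicator (ball c r)) < top) \<and>
     (\<forall>F. (\<forall>m. F m \<in> borel_measurable lebesgue \<and> X (F m) < top) \<and>
         (\<forall>e>0. \<exists>N. \<forall>m\<ge>N. \<forall>k\<ge>N. X (\<lambda>x. F m x - F k x) < ennreal e)
         \<longrightarrow> (\<exists>g\<in>borel_measurable lebesgue. X g < top \<and>
                (\<lambda>m. X (\<lambda>x. F m x - g x)) \<longlonglongrightarrow> 0))"

definition ball_Bfs :: "((real^'n \<Rightarrow> real) \<Rightarrow> ennreal) \<Rightarrow> bool" where
  "ball_Bfs Y \<longleftrightarrow> ball_qBfs Y \<and>
     (\<forall>f\<in>borel_measurable lebesgue. \<forall>g\<in>borel_measurable lebesgue.
         Y (\<lambda>x. f x + g x) \<le> Y f + Y g) \<and>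
     (\<forall>c r. 0 < r \<longrightarrow> (\<exists>C>0. \<forall>f\<in>borel_measurable lebesgue.
         (\<integral>\<^sup>+x\<in>ball c r. ennreal \<bar>f x\<bar> \<partial>lebesgue) \<le> ennreal C * Y f))"

definition Xe :: "((real^'n \<Rightarrow> real) \<Rightarrow> ennreal) \<Rightarrow> (real^'n \<Rightarrow> ennreal) \<Rightarrow> ennreal" where
  "Xe X g = (if AE x in lebesgue. g x < top then X (\<lambda>x. enn2real (g x)) else top)"

definition Xpow :: "((real^'n \<Rightarrow> real) \<Rightarrow> ennreal) \<Rightarrow> real \<Rightarrow> (real^'n \<Rightarrow> real) \<Rightarrow> ennreal" where
  "Xpow X p f = epowr (X (\<lambda>x. \<bar>f x\<bar> powr p)) (1 / p)"

definition Xepow :: "((real^'n \<Rightarrow> real) \<Rightarrow> ennreal) \<Rightarrow> real \<Rightarrow> (real^'n \<Rightarrow> ennreal) \<Rightarrow> ennreal" where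
  "Xepow X p g = epowr (Xe X (\<lambda>x. epowr (g x) p)) (1 / p)"

definition WX :: "((real^'n \<Rightarrow> real) \<Rightarrow> ennreal) \<Rightarrow> (real^'n \<Rightarrow> ennreal) \<Rightarrow> ennreal" where
  "WX X g = (SUP \<alpha>\<in>{0<..}. ennreal \<alpha> * X (indicator {x. ennreal \<alpha> < g x}))"

text \<open>Associate space norm of Y, applied to |f| (nonnegative extended-valued).\<close>
definition assoc :: "((real^'n \<Rightarrow> real) \<Rightarrow> ennreal) \<Rightarrow> (real^'n \<Rightarrow> ennreal) \<Rightarrow> ennreal" where
  "assoc Y h = (SUP g\<in>{g\<in>borel_measurable lebesgue. Y g = 1}.
                  \<integral>\<^sup>+x. h x * ennreal \<bar>g x\<bar> \<partial>lebesgue)"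

definition HLmax :: "(real^'n \<Rightarrow> real) \<Rightarrow> real^'n \<Rightarrow> ennreal" where
  "HLmax f x = (SUP B\<in>{ball c r | c r. 0 < r \<and> x \<in> ball c r}.
                  (\<integral>\<^sup>+y\<in>B. ennreal \<bar>f y\<bar> \<partial>lebesgue) / emeasure lebesgue B)"

definition Mtheta :: "real \<Rightarrow> (real^'n \<Rightarrow> real) \<Rightarrow> real^'n \<Rightarrow> ennreal" where
  "Mtheta \<theta> f x = epowr (HLmax (\<lambda>y. \<bar>f y\<bar> powr \<theta>) x) (1 / \<theta>)"

definition conj_exp :: "real \<Rightarrow> real" where
  "conj_exp q = q / (q - 1)"

definition FS :: "((real^'n \<Rightarrow> real) \<Rightarrow> ennreal) \<Rightarrow> real \<Rightarrow> bool" where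
  "FS X pm \<longleftrightarrow> (\<forall>p s. 0 < p \<and> p < pm \<and> 1 < s \<longrightarrow>
     (\<exists>C>0. \<forall>fs::nat \<Rightarrow> real^'n \<Rightarrow> real. (\<forall>j. fs j \<in> borel_measurable lebesgue) \<longrightarrow>
        Xepow X (1 / p) (\<lambda>x. epowr (\<Sum>j. epowr (HLmax (fs j) x) s) (1 / s))
        \<le> ennreal C * Xepow X (1 / p) (\<lambda>x. epowr (\<Sum>j. ennreal (\<bar>fs j x\<bar> powr s)) (1 / s))))"

text \<open>Upper half-space R^{n+1}_+ inside (real^'n) \<times> real; cone and area function.\<close>
definition cone :: "real^'n \<Rightarrow> ((real^'n) \<times> real) set" where
  "cone x = {z. 0 < snd z \<and> dist x (fst z) < snd z}"

definition area :: "((real^'n) \<times> real \<Rightarrow> complex) \<Rightarrow> real^'n \<Rightarrow> ennreal" where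
  "area F x = epowr (\<integral>\<^sup>+z. indicator (cone x) z *
       ennreal ((cmod (F z))\<^sup>2 / (snd z) ^ (CARD('n) + 1)) \<partial>lebesgue) (1 / 2)"

definition WTnorm :: "((real^'n \<Rightarrow> real) \<Rightarrow> ennreal) \<Rightarrow> ((real^'n) \<times> real \<Rightarrow> complex) \<Rightarrow> ennreal" where
  "WTnorm X F = WX X (area F)"

definition T2norm :: "real \<Rightarrow> ((real^'n) \<times> real \<Rightarrow> complex) \<Rightarrow> ennreal" where
  "T2norm p F = epowr (\<integral>\<^sup>+x. epowr (area F x) p \<partial>lebesgue) (1 / p)"

definition tent :: "real^'n \<Rightarrow> real \<Rightarrow> ((real^'n) \<times> real) set" where
  "tent c r = {z. 0 < snd z \<and> snd z < r \<and> dist (fst z) c < r - snd z}"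

definition TX_atom :: "((real^'n \<Rightarrow> real) \<Rightarrow> ennreal) \<Rightarrow> real \<Rightarrow>
     ((real^'n) \<times> real \<Rightarrow> complex) \<Rightarrow> real^'n \<Rightarrow> real \<Rightarrow> bool" where
  "TX_atom X p a c r \<longleftrightarrow> 0 < r \<and> a \<in> borel_measurable lebesgue \<and>
     (\<forall>z. z \<notin> tent c r \<longrightarrow> a z = 0) \<and>
     T2norm p a \<le> ennreal (measure lebesgue (ball c r) powr (1 / p)) / X (indicator (ball c r))"

definition TX_inf_atom :: "((real^'n \<Rightarrow> real) \<Rightarrow> ennreal) \<Rightarrow>
     ((real^'n) \<times> real \<Rightarrow> complex) \<Rightarrow> real^'n \<Rightarrow> real \<Rightarrow> bool" where
  "TX_inf_atom X a c r \<longleftrightarrow> (\<forall>p. 1 < p \<longrightarrow> TX_atom X p a c r)"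

definition zsums :: "(int \<Rightarrow> complex) \<Rightarrow> complex \<Rightarrow> bool" where
  "zsums g s \<longleftrightarrow> (\<exists>u v. (\<lambda>k. g (int k)) sums u \<and> (\<lambda>k. g (- int k - 1)) sums v \<and> s = u + v)"

definition lam :: "((real^'n \<Rightarrow> real) \<Rightarrow> ennreal) \<Rightarrow> (int \<Rightarrow> nat \<Rightarrow> real^'n) \<Rightarrow>
     (int \<Rightarrow> nat \<Rightarrow> real) \<Rightarrow> int \<Rightarrow> nat \<Rightarrow> real" where
  "lam X cen rad i j = 2 powr (real_of_int i) * enn2real (X (indicator (ball (cen i j) (rad i j))))"

definition dval :: "((real^'n \<Rightarrow> real) \<Rightarrow> ennreal) \<Rightarrow> (int \<Rightarrow> nat \<Rightarrow> real^'n) \<Rightarrow>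
     (int \<Rightarrow> nat \<Rightarrow> real) \<Rightarrow> ennreal" where
  "dval X cen rad = (SUP i. ennreal (2 powr (real_of_int i)) *
       Xe X (\<lambda>x. \<Sum>j. indicator (ball (cen i j) (rad i j)) x))"

definition decomp :: "((real^'n \<Rightarrow> real) \<Rightarrow> ennreal) \<Rightarrow> real \<Rightarrow> nat \<Rightarrow>
     ((real^'n) \<times> real \<Rightarrow> complex) \<Rightarrow> (int \<Rightarrow> nat \<Rightarrow> (real^'n) \<times> real \<Rightarrow> complex) \<Rightarrow>
     (int \<Rightarrow> nat \<Rightarrow> real^'n) \<Rightarrow> (int \<Rightarrow> nat \<Rightarrow> real) \<Rightarrow> bool" where
  "decomp X c M0 f a cen rad \<longleftrightarrow>
     (\<forall>i j. TX_inf_atom X (a i j) (cen i j) (rad i j)) \<and>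
     (AE z in lebesgue. 0 < snd z \<longrightarrow>
        (\<exists>s. (\<forall>i. (\<lambda>j. complex_of_real (lam X cen rad i j) * a i j z) sums s i) \<and> zsums s (f z))) \<and>
     dval X cen rad < top \<and>
     (\<forall>i x. (\<Sum>j. indicator (ball (cen i j) (c * rad i j)) x :: ennreal) \<le> of_nat M0)"

end

theory Submission
  imports Defs "HOL-Library.Nat_Bijection"
begin

text \<open>
  A \<open>(T_X, \<infinity>)\<close>-atom satisfies its size condition for all finite exponents with the same constant, so
  its area function is bounded by \<open>1 / \<parallel>1_B\<parallel>\<close> on its ball \<open>B\<close> and vanishes outside. Hence the area
  function of a decomposed \<open>f\<close> is at most \<open>\<Sum>\<^sub>i 2\<^sup>i S\<^sub>i\<close> with \<open>S\<^sub>i = \<Sum>\<^sub>j 1_{B\<^sub>i\<^sub>j}\<close>, and the indicator of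
  \<open>{area f > \<alpha>}\<close> is at most \<open>\<Sum>\<^sub>i min(1, 2\<^sup>i / \<alpha>) S\<^sub>i\<close>. The triangle inequality in \<open>X\<close> raised to the power
  \<open>1/r\<close>, together with the Fefferman--Stein inequality for the indicators of \<open>c B\<^sub>i\<^sub>j\<close>, sums this up.

  Conversely, cut \<open>f\<close> along the tents over the sets where balls meet \<open>{area f > 2\<^sup>i \<tau>}\<close> in more than
  a small fixed proportion, and distribute each piece over the tents of a Whitney-type family of balls.
  For the atoms one needs a pointwise bound on the area function of a piece at every \<open>x\<close>. The cone at \<open>x\<close>
  splits into finitely many narrow sectors, and the part of the piece in one sector lies
  in the cone of a single nearby point at which the area function of \<open>f\<close> is small.
  The Fefferman--Stein inequality applied to dyadic annuli shows that \<open>1\<close> is not in \<open>X\<close> and that small balls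
  have small norm; the latter allows each level to be padded to an infinite family of balls.
\<close>

section \<open>Powers of extended nonnegative reals\<close>

text \<open>The size condition must hold with constant one for all exponents at once, so a bound on
  the p-norm whose constant depends on p, such as one from duality, cannot produce the atoms; a
  pointwise bound of the area function can. This is why a cone is looked at from other vertices
  instead of being averaged. The number of sectors depends on the dimension only and enters through
  its square root; the level scale \<open>\<tau>\<close> absorbs it, so that a piece of level i has
  area function at most 2^i exactly.

  In the other direction the obstacle is that X is only quasi-normed, while the normed space X^(1/r)
  measures S_i by S_i^(1/r), which (ii) does not control when r < 1. The bounded overlap (iii) does,
  after the balls have been exchanged for their shrunken copies.

  Each level needs infinitely many balls of positive radius, even for f = 0, so a decomposition
  always has a positive cost. The padding is made to cost at most a prescribed \<epsilon>, which is
  harmless for an infimum.\<close>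

lemma epowr_top [simp]: "epowr top p = top"
  by (simp add: epowr_def)

lemma epowr_0 [simp]: "epowr 0 p = 0"
  by (simp add: epowr_def)

lemma epowr_1 [simp]: "epowr 1 p = 1"
  by (simp add: epowr_def)

lemma epowr_ennreal: "0 \<le> x \<Longrightarrow> epowr (ennreal x) p = ennreal (x powr p)"
  by (simp add: epowr_def)

lemma epowr_eq_top_iff [simp]: "epowr x p = top \<longleftrightarrow> x = top"
  by (simp add: epowr_def)

lemma epowr_mono:
  assumes "0 \<le> p" "a \<le> b"
  shows "epowr a p \<le> epowr b p"
proof (cases "b = top")
  case False
  then obtain y where y: "0 \<le> y" "b = ennreal y" by (cases b) auto
  moreover from this assms(2) obtain x where "0 \<le> x" "a = ennreal x" by (cases a) (auto simp: top_unique)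
  ultimately show ?thesis using assms by (simp add: epowr_ennreal powr_mono2 ennreal_leI)
qed simp

lemma epowr_exponent_1 [simp]: "epowr x 1 = x"
  by (cases x) (simp_all add: epowr_ennreal)

lemma epowr_epowr: "epowr (epowr x p) q = epowr x (p * q)"
  by (cases x) (simp_all add: epowr_ennreal powr_powr)

lemma epowr_mult:
  assumes "0 < p"
  shows "epowr (a * b) p = epowr a p * epowr b p"
proof -
  have *: "epowr x p \<noteq> 0" if "x \<noteq> 0" for x
    using that by (cases x) (auto simp: epowr_ennreal)
  show ?thesis
  proof (cases "a = top \<or> b = top")
    case True
    then show ?thesis using *[of a] *[of b]
      by (cases "a = 0"; cases "b = 0") (auto simp: ennreal_mult_top ennreal_top_mult)
  next
    case False
    then obtain x y where "0 \<le> x" "a = ennreal x" "0 \<le> y" "b = ennreal y"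
      by (cases a; cases b) auto
    then show ?thesis
      by (simp add: epowr_ennreal ennreal_mult[symmetric] powr_mult)
  qed
qed

lemma epowr_2: "epowr x 2 = x ^ 2"
proof (cases x)
  case (real y)
  then show ?thesis by (simp add: epowr_ennreal ennreal_power)
qed (simp add: power2_eq_square)

lemma epowr_half_le_iff: "epowr x (1 / 2) \<le> y \<longleftrightarrow> x \<le> y ^ 2"
proof
  assume "epowr x (1 / 2) \<le> y"
  from epowr_mono[OF _ this, of 2] show "x \<le> y ^ 2"
    unfolding epowr_epowr by (simp flip: epowr_2)
next
  assume "x \<le> y ^ 2"
  from epowr_mono[OF _ this, of "1/2"] show "epowr x (1 / 2) \<le> y"
    by (simp add: epowr_epowr flip: epowr_2)
qed

text \<open>Meant for counting functions of families of balls: they take no value strictly between 0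
  and 1, so a power with exponent at least 1 can only increase them.\<close>

lemma epowr_ge_self:
  assumes "1 \<le> p" "x = 0 \<or> 1 \<le> x"
  shows "x \<le> epowr x p"
proof (cases x)
  case (real y)
  with assms have "y = 0 \<or> 1 \<le> y" by (auto simp: ennreal_le_1)
  then have "y \<le> y powr p" using powr_mono[of 1 p y] assms by auto
  with real show ?thesis by (simp add: epowr_ennreal ennreal_leI)
qed simp

lemma borel_measurable_epowr [measurable]:
  assumes [measurable]: "g \<in> borel_measurable M"
  shows "(\<lambda>x. epowr (g x) p) \<in> borel_measurable M"
  unfolding epowr_def by measurable

section \<open>Function norms on extended-valued functions\<close>

lemma qBfs_zero_AE:
  "ball_qBfs X \<Longrightarrow> f \<in> borel_measurable lebesgue \<Longrightarrow> X f = 0 \<Longrightarrow> AE x in lebesgue. f x = 0"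
  unfolding ball_qBfs_def by blast

lemma qBfs_scale:
  "ball_qBfs X \<Longrightarrow> f \<in> borel_measurable lebesgue \<Longrightarrow> X (\<lambda>x. c * f x) = ennreal \<bar>c\<bar> * X f"
  unfolding ball_qBfs_def by blast

lemma qBfs_mono:
  "ball_qBfs X \<Longrightarrow> f \<in> borel_measurable lebesgue \<Longrightarrow> g \<in> borel_measurable lebesgue \<Longrightarrow>
   AE x in lebesgue. \<bar>g x\<bar> \<le> \<bar>f x\<bar> \<Longrightarrow> X g \<le> X f"
  unfolding ball_qBfs_def by blast

lemma qBfs_Fatou:
  assumes "ball_qBfs X" "\<And>m. F m \<in> borel_measurable lebesgue" "f \<in> borel_measurable lebesgue"
    "AE x in lebesgue. \<forall>m. 0 \<le> F m x \<and> F m x \<le> F (Suc m) x"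
    "AE x in lebesgue. (\<lambda>m. F m x) \<longlonglongrightarrow> f x"
  shows "(\<lambda>m. X (F m)) \<longlonglongrightarrow> X f"
  using assms unfolding ball_qBfs_def by blast

lemma qBfs_ball_finite: "ball_qBfs X \<Longrightarrow> 0 < r \<Longrightarrow> X (indicator (ball c r)) < top"
  unfolding ball_qBfs_def by blast

lemma qBfs_quasi_triangle:
  assumes "ball_qBfs X"
  obtains K where "1 \<le> K" "\<And>f g. f \<in> borel_measurable lebesgue \<Longrightarrow> g \<in> borel_measurable lebesgue \<Longrightarrow>
     X (\<lambda>x. f x + g x) \<le> ennreal K * (X f + X g)"
proof -
  have "\<exists>K\<ge>1. \<forall>f\<in>borel_measurable lebesgue. \<forall>g\<in>borel_measurable lebesgue.
         X (\<lambda>x. f x + g x) \<le> ennreal K * (X f + X g)"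
    using assms unfolding ball_qBfs_def by blast
  then show ?thesis using that by auto
qed

lemma qBfs_ball_pos:
  fixes X :: "(real^'n \<Rightarrow> real) \<Rightarrow> ennreal"
  assumes "ball_qBfs X" "0 < r"
  shows "0 < X (indicator (ball c r))"
proof (rule ccontr)
  assume "\<not> ?thesis"
  then have "AE x in lebesgue. (indicator (ball c r) x :: real) = 0"
    using qBfs_zero_AE[OF assms(1), of "indicator (ball c r)"] by (simp add: borel_measurable_indicator)
  then have "AE x in lebesgue. x \<notin> ball c r" by (auto simp: indicator_def)
  then have "ball c r \<in> null_sets lebesgue"
    by (subst (asm) AE_iff_null_sets[symmetric]) auto
  then have "emeasure lborel (ball c r) = 0" by (auto dest: null_setsD1)
  then show False using assms(2) unit_ball_vol_pos[of "real CARD('n)"]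
    by (simp add: emeasure_ball)
qed

lemma Xe_mono:
  assumes "ball_qBfs X" and [measurable]: "f \<in> borel_measurable lebesgue" "g \<in> borel_measurable lebesgue"
    and le: "AE x in lebesgue. g x \<le> f x"
  shows "Xe X g \<le> Xe X f"
proof (cases "AE x in lebesgue. f x < top")
  case True
  with le have fin: "AE x in lebesgue. g x < top"
    by (auto elim!: eventually_elim2 intro: le_less_trans)
  have "X (\<lambda>x. enn2real (g x)) \<le> X (\<lambda>x. enn2real (f x))"
    by (rule qBfs_mono[OF assms(1)]) (use True le in \<open>auto elim!: eventually_elim2 intro: enn2real_mono\<close>)
  with True fin show ?thesis by (simp add: Xe_def)
qed (simp add: Xe_def)

lemma Xe_indicator: "Xe X (indicator A) = X (indicator A)"
proof -
  have "(\<lambda>x. enn2real (indicator A x)) = (indicator A :: _ \<Rightarrow> real)"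
    by (auto simp: indicator_def)
  then show ?thesis by (simp add: Xe_def indicator_def less_top[symmetric])
qed

lemma qBfs_indicator_mono:
  assumes "ball_qBfs X" "A \<in> sets lebesgue" "B \<in> sets lebesgue" "A \<subseteq> B"
  shows "X (indicator A) \<le> X (indicator B)"
  by (rule qBfs_mono) (use assms in \<open>auto simp: indicator_def\<close>)

lemma Xe_cmult:
  assumes "ball_qBfs X" and [measurable]: "g \<in> borel_measurable lebesgue" and "0 < c"
  shows "Xe X (\<lambda>x. ennreal c * g x) = ennreal c * Xe X g"
proof -
  have "(AE x in lebesgue. ennreal c * g x < top) \<longleftrightarrow> (AE x in lebesgue. g x < top)"
    using assms(3) by (intro AE_cong) (auto simp: ennreal_mult_less_top)
  moreover have "X (\<lambda>x. enn2real (ennreal c * g x)) = ennreal c * X (\<lambda>x. enn2real (g x))"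
    using qBfs_scale[OF assms(1), of "\<lambda>x. enn2real (g x)" c] assms(3)
    by (simp add: enn2real_mult)
  ultimately show ?thesis using assms(3) by (simp add: Xe_def ennreal_mult_top)
qed

lemma Xe_add_le:
  assumes "\<And>f g. f \<in> borel_measurable lebesgue \<Longrightarrow> g \<in> borel_measurable lebesgue \<Longrightarrow>
     X (\<lambda>x. f x + g x) \<le> ennreal K * (X f + X g)" and "0 < K"
    and [measurable]: "f \<in> borel_measurable lebesgue" "g \<in> borel_measurable lebesgue"
    and "ball_qBfs X"
  shows "Xe X (\<lambda>x. f x + g x) \<le> ennreal K * (Xe X f + Xe X g)"
proof (cases "(AE x in lebesgue. f x < top) \<and> (AE x in lebesgue. g x < top)")
  case True
  then have fin: "AE x in lebesgue. f x + g x < top"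
    by (auto elim!: eventually_elim2)
  have "X (\<lambda>x. enn2real (f x + g x)) \<le> X (\<lambda>x. enn2real (f x) + enn2real (g x))"
    by (rule qBfs_mono[OF assms(5)])
      (use True in \<open>auto elim!: eventually_elim2 simp: enn2real_plus\<close>)
  also have "\<dots> \<le> ennreal K * (X (\<lambda>x. enn2real (f x)) + X (\<lambda>x. enn2real (g x)))"
    by (rule assms(1)) auto
  finally show ?thesis using True fin by (simp add: Xe_def)
next
  case False
  then have "Xe X f + Xe X g = top" by (auto simp: Xe_def)
  then show ?thesis using assms(2) by (simp only: ennreal_mult_top) simp
qed

text \<open>The Fatou axiom speaks of real-valued limits only, whereas the supremum may be infinite
  on a set of positive measure. Its truncation at height k has norm at most \<open>T\<close> and
  dominates k times the indicator of the set where it is infinite. Letting k grow shows that this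
  indicator has norm 0, so the set is null and Fatou applies without truncation.\<close>

lemma Xe_SUP_le:
  fixes X :: "(real^'n \<Rightarrow> real) \<Rightarrow> ennreal"
  assumes qB: "ball_qBfs X" and [measurable]: "\<And>m. G m \<in> borel_measurable lebesgue"
    and inc: "incseq G" and bd: "\<And>m. Xe X (G m) \<le> T"
  shows "Xe X (\<lambda>x. SUP m. G m x) \<le> T"
proof (cases "T = top")
  case False
  define H where "H x = (SUP m. G m x)" for x
  have [measurable]: "H \<in> borel_measurable lebesgue" unfolding H_def by measurable
  have incx: "incseq (\<lambda>m. G m x)" for x using inc by (auto simp: incseq_def le_fun_def)
  have fin: "AE x in lebesgue. G m x < top" for m
    using bd[of m] False by (auto simp: Xe_def top_unique split: if_splits)
  then have fin': "AE x in lebesgue. \<forall>m. G m x < top" by (simp add: AE_all_countable)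
  have bd': "X (\<lambda>x. enn2real (G m x)) \<le> T" for m using bd[of m] fin[of m] by (simp add: Xe_def)
  have lim: "(\<lambda>m. G m x) \<longlonglongrightarrow> H x" for x
    unfolding H_def by (rule LIMSEQ_SUP[OF incx])
  have trunc: "X (\<lambda>x. enn2real (min (H x) (ennreal c))) \<le> T" if "0 \<le> c" for c
  proof -
    have "(\<lambda>m. X (\<lambda>x. enn2real (min (G m x) (ennreal c)))) \<longlonglongrightarrow> X (\<lambda>x. enn2real (min (H x) (ennreal c)))"
    proof (rule qBfs_Fatou[OF qB])
      show "AE x in lebesgue. \<forall>m. 0 \<le> enn2real (min (G m x) (ennreal c)) \<and>
          enn2real (min (G m x) (ennreal c)) \<le> enn2real (min (G (Suc m) x) (ennreal c))"
        using incx by (auto intro!: AE_I2 enn2real_mono min.mono simp: incseq_Suc_iff min_less_iff_disj)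
      show "AE x in lebesgue. (\<lambda>m. enn2real (min (G m x) (ennreal c))) \<longlonglongrightarrow> enn2real (min (H x) (ennreal c))"
      proof (intro AE_I2)
        fix x
        have "(\<lambda>m. min (G m x) (ennreal c)) \<longlonglongrightarrow> min (H x) (ennreal c)"
          by (intro tendsto_min lim tendsto_const)
        then show "(\<lambda>m. enn2real (min (G m x) (ennreal c))) \<longlonglongrightarrow> enn2real (min (H x) (ennreal c))"
          by (intro tendsto_enn2real) (simp_all add: min_less_iff_disj)
      qed
    qed auto
    moreover have "X (\<lambda>x. enn2real (min (G m x) (ennreal c))) \<le> T" for m
      by (rule order_trans[OF qBfs_mono[OF qB, where f = "\<lambda>x. enn2real (G m x)"] bd'])
        (use fin[of m] in \<open>auto intro!: enn2real_mono\<close>)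
    ultimately show ?thesis using Lim_bounded[where M = 0] by blast
  qed
  have "X (indicator {x. H x = top}) = 0"
  proof -
    have "ennreal (real k) * X (indicator {x. H x = top}) \<le> T" for k :: nat
    proof -
      have "ennreal (real k) * X (indicator {x. H x = top}) = X (\<lambda>x. real k * indicator {x. H x = top} x)"
        by (subst qBfs_scale[OF qB]) auto
      also have "\<dots> \<le> X (\<lambda>x. enn2real (min (H x) (ennreal (real k))))"
        by (rule qBfs_mono[OF qB]) (auto simp: indicator_def)
      finally show ?thesis using trunc[of "real k"] by simp
    qed
    then have le: "of_nat k * X (indicator {x. H x = top}) \<le> T" for k
      by (simp add: ennreal_of_nat_eq_real_of_nat)
    show ?thesis
    proof (rule ccontr)
      assume "\<not> ?thesis"
      then have "(SUP k. of_nat k * X (indicator {x. H x = top})) = top"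
        by (simp add: SUP_mult_right_ennreal[symmetric] ennreal_SUP_of_nat_eq_top ennreal_top_mult)
      then have "top \<le> T" by (metis SUP_least le)
      with False show False by (simp add: top_unique)
    qed
  qed
  from qBfs_zero_AE[OF qB _ this]
  have finH: "AE x in lebesgue. H x < top"
    by (auto simp: indicator_def less_top split: if_splits elim!: eventually_mono)
  have "(\<lambda>m. X (\<lambda>x. enn2real (G m x))) \<longlonglongrightarrow> X (\<lambda>x. enn2real (H x))"
  proof (rule qBfs_Fatou[OF qB])
    show "AE x in lebesgue. \<forall>m. 0 \<le> enn2real (G m x) \<and> enn2real (G m x) \<le> enn2real (G (Suc m) x)"
      using fin' incx by (auto elim!: eventually_mono intro!: enn2real_mono simp: incseq_Suc_iff)
    show "AE x in lebesgue. (\<lambda>m. enn2real (G m x)) \<longlonglongrightarrow> enn2real (H x)"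
      using finH by (auto elim!: eventually_mono intro!: tendsto_enn2real lim)
  qed auto
  then have "X (\<lambda>x. enn2real (H x)) \<le> T"
    by (rule LIMSEQ_le_const2) (use bd' in blast)
  with finH show ?thesis by (simp add: Xe_def H_def)
qed simp

text \<open>Monotone limits carry the triangle inequality from two summands to series. This needs a
  norm: with a quasi-norm the constants of the successive additions would multiply.\<close>

lemma Xe_suminf_le:
  assumes "ball_Bfs X" and [measurable]: "\<And>m. G m \<in> borel_measurable lebesgue"
  shows "Xe X (\<lambda>x. \<Sum>m. G m x) \<le> (\<Sum>m. Xe X (G m))"
proof -
  have qB: "ball_qBfs X" using assms(1) by (simp add: ball_Bfs_def)
  have tri: "Xe X (\<lambda>x. f x + g x) \<le> Xe X f + Xe X g"
    if "f \<in> borel_measurable lebesgue" "g \<in> borel_measurable lebesgue" for f g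
    using Xe_add_le[of X 1 f g] assms(1) that by (simp add: ball_Bfs_def)
  have "X (\<lambda>x. 0) = 0" using qBfs_scale[OF qB, of "\<lambda>x. 0" 0] by simp
  then have zero: "Xe X (\<lambda>x. 0) = 0" by (simp add: Xe_def)
  have "Xe X (\<lambda>x. \<Sum>m<k. G m x) \<le> (\<Sum>m<k. Xe X (G m))" for k
  proof (induction k)
    case (Suc k)
    have "Xe X (\<lambda>x. \<Sum>m<Suc k. G m x) \<le> Xe X (\<lambda>x. \<Sum>m<k. G m x) + Xe X (G k)"
      using tri[of "\<lambda>x. \<Sum>m<k. G m x" "G k"] by simp
    also have "\<dots> \<le> (\<Sum>m<Suc k. Xe X (G m))" using Suc by (simp add: add_right_mono)
    finally show ?case .
  qed (simp add: zero)
  then have "Xe X (\<lambda>x. \<Sum>m<k. G m x) \<le> (\<Sum>m. Xe X (G m))" for k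
    by (rule order_trans) (simp add: sum_le_suminf)
  then have "Xe X (\<lambda>x. SUP k. \<Sum>m<k. G m x) \<le> (\<Sum>m. Xe X (G m))"
    by (intro Xe_SUP_le[OF qB]) (auto simp: incseq_def le_fun_def intro!: sum_mono2)
  then show ?thesis by (simp add: suminf_eq_SUP)
qed

text \<open>The bridge from the powers in the Fefferman-Stein inequality to the power space: once
  \<open>Xpow X p\<close> is a ball Banach function space, the triangle inequality for series
  applies to extended-valued counting functions.\<close>

lemma Xepow_eq_Xe_Xpow: "0 < p \<Longrightarrow> Xepow X p g = Xe (Xpow X p) g"
proof -
  assume "0 < p"
  have "(\<lambda>x. enn2real (epowr (g x) p)) = (\<lambda>x. \<bar>enn2real (g x)\<bar> powr p)"
    by (auto simp: epowr_def)
  then show ?thesis by (simp add: Xepow_def Xe_def Xpow_def less_top[symmetric])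
qed
   

section \<open>Consequences of the Fefferman--Stein inequality for indicators\<close>

lemma open_HLmax_superlevel: "open {x. a < HLmax f x}"
proof -
  have "{x. a < HLmax f x} = \<Union>{ball c r | c r. 0 < r \<and>
     a < (\<integral>\<^sup>+y\<in>ball c r. ennreal \<bar>f y\<bar> \<partial>lebesgue) / emeasure lebesgue (ball c r)}"
    unfolding HLmax_def less_SUP_iff by blast
  then show ?thesis by (auto intro!: open_Union)
qed

lemma borel_measurable_lebesgueI_open:
  fixes g :: "'a::euclidean_space \<Rightarrow> ennreal"
  assumes "\<And>a. open {x. a < g x}"
  shows "g \<in> borel_measurable lebesgue"
proof -
  have "g \<in> borel_measurable borel"
    by (rule borel_measurableI_greater) (use assms in auto)
  then show ?thesis by (simp add: measurable_completion)
qed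

lemma borel_measurable_HLmax [measurable]: "HLmax f \<in> borel_measurable lebesgue"
  by (rule borel_measurable_lebesgueI_open) (rule open_HLmax_superlevel)

lemma HLmax_indicator_ge:
  fixes A :: "(real^'n) set"
  assumes "0 < r" "x \<in> ball c r" "A \<in> sets lebesgue"
    and "ennreal \<gamma> * emeasure lebesgue (ball c r) \<le> emeasure lebesgue (A \<inter> ball c r)"
  shows "ennreal \<gamma> \<le> HLmax (indicator A) x"
proof -
  have v: "unit_ball_vol (real CARD('n)) \<noteq> 0"
    using unit_ball_vol_pos[of "real CARD('n)"] by (metis less_irrefl of_nat_0_le_iff)
  have pos: "emeasure lebesgue (ball c r) \<noteq> 0" "emeasure lebesgue (ball c r) \<noteq> top"
    using assms(1) v by (simp_all add: emeasure_ball)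
  have "(\<integral>\<^sup>+y\<in>ball c r. ennreal \<bar>indicator A y\<bar> \<partial>lebesgue) = (\<integral>\<^sup>+y. indicator (A \<inter> ball c r) y \<partial>lebesgue)"
    by (intro nn_integral_cong) (auto simp: indicator_def)
  also have "\<dots> = emeasure lebesgue (A \<inter> ball c r)"
    using assms(3) by (intro nn_integral_indicator) auto
  finally have eq: "(\<integral>\<^sup>+y\<in>ball c r. ennreal \<bar>indicator A y\<bar> \<partial>lebesgue) = emeasure lebesgue (A \<inter> ball c r)" .
  have "ennreal \<gamma> \<le> emeasure lebesgue (A \<inter> ball c r) / emeasure lebesgue (ball c r)"
  proof -
    have "ennreal \<gamma> = ennreal \<gamma> * emeasure lebesgue (ball c r) / emeasure lebesgue (ball c r)"
      using pos by (simp add: ennreal_mult_divide_eq)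
    also have "\<dots> \<le> emeasure lebesgue (A \<inter> ball c r) / emeasure lebesgue (ball c r)"
      by (intro divide_right_mono_ennreal assms(4))
    finally show ?thesis .
  qed
  also have "\<dots> \<le> HLmax (indicator A) x"
    unfolding HLmax_def eq[symmetric] using assms(1,2) by (intro SUP_upper) blast
  finally show ?thesis .
qed

text \<open>The vector-valued inequality reduced to sets: no maximal function and no inner exponent
  remain in its conclusion. The uses differ only in the pairs \<open>A j\<close>, \<open>B j\<close>
  and in the density \<gamma>: shrunken and full balls, annuli and balls, a level set and its
  thickening.\<close>

definition maximal_bound :: "((real^'n \<Rightarrow> real) \<Rightarrow> ennreal) \<Rightarrow> real \<Rightarrow> real \<Rightarrow> real \<Rightarrow> bool" where
  "maximal_bound X r \<gamma> K \<longleftrightarrow> (\<forall>A B :: nat \<Rightarrow> (real^'n) set.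
     (\<forall>j. A j \<in> sets lebesgue) \<and> (\<forall>j. B j \<in> sets lebesgue) \<and>
     (\<forall>j. \<forall>x\<in>B j. ennreal \<gamma> \<le> HLmax (indicator (A j)) x) \<longrightarrow>
     Xe X (\<lambda>x. epowr (\<Sum>j. indicator (B j) x) (1 / r))
       \<le> ennreal K * Xe X (\<lambda>x. epowr (\<Sum>j. indicator (A j) x) (1 / r)))"

lemma maximal_boundD:
  assumes "maximal_bound X r \<gamma> K" "\<And>j. A j \<in> sets lebesgue" "\<And>j. B j \<in> sets lebesgue"
    "\<And>j x. x \<in> B j \<Longrightarrow> ennreal \<gamma> \<le> HLmax (indicator (A j)) x"
  shows "Xe X (\<lambda>x. epowr (\<Sum>j. indicator (B j) x) (1 / r))
       \<le> ennreal K * Xe X (\<lambda>x. epowr (\<Sum>j. indicator (A j) x) (1 / r))"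
  using assms unfolding maximal_bound_def by blast

lemma FS_maximal_bound:
  fixes X :: "(real^'n \<Rightarrow> real) \<Rightarrow> ennreal"
  assumes qB: "ball_qBfs X" and FS: "FS X pm" and r: "0 < r" "r < pm" and \<gamma>: "0 < \<gamma>"
  obtains K where "0 < K" "maximal_bound X r \<gamma> K"
proof -
  \<comment> \<open>Fefferman-Stein with s = 2 in X^(1/p) produces the outer power 1 / (2 p); this p
    makes it 1 / r.\<close>
  define p where "p = r / 2"
  have p: "0 < p" "p < pm" using r unfolding p_def by linarith+
  have "\<exists>C>0. \<forall>fs::nat \<Rightarrow> real^'n \<Rightarrow> real. (\<forall>j. fs j \<in> borel_measurable lebesgue) \<longrightarrow>
        Xepow X (1 / p) (\<lambda>x. epowr (\<Sum>j. epowr (HLmax (fs j) x) 2) (1 / 2))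
        \<le> ennreal C * Xepow X (1 / p) (\<lambda>x. epowr (\<Sum>j. ennreal (\<bar>fs j x\<bar> powr 2)) (1 / 2))"
    by (rule FS[unfolded FS_def, THEN spec[of _ p], THEN spec[of _ 2], THEN mp]) (use p in simp)
  then obtain C where C: "0 < C" "\<And>fs::nat \<Rightarrow> real^'n \<Rightarrow> real. (\<And>j. fs j \<in> borel_measurable lebesgue) \<Longrightarrow>
        Xepow X (1 / p) (\<lambda>x. epowr (\<Sum>j. epowr (HLmax (fs j) x) 2) (1 / 2))
        \<le> ennreal C * Xepow X (1 / p) (\<lambda>x. epowr (\<Sum>j. ennreal (\<bar>fs j x\<bar> powr 2)) (1 / 2))"
    by blast
  define \<eta> where "\<eta> = (\<gamma>\<^sup>2) powr (1 / r)"
  have \<eta>: "0 < \<eta>" using \<gamma> by (simp add: \<eta>_def)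
  have exps: "1 / 2 * (1 / p) = 1 / r" "1 / (1 / p) = p" "p * (1 / p) = 1" "2 * p = r" using p by (auto simp: p_def)
  show thesis
  proof (rule that)
    show "0 < (C powr (1 / p)) / \<eta>" using C(1) \<eta> by simp
    show "maximal_bound X r \<gamma> (C powr (1 / p) / \<eta>)"
      unfolding maximal_bound_def
    proof (intro allI impI, elim conjE)
      fix A B :: "nat \<Rightarrow> (real^'n) set"
      assume "\<forall>j. A j \<in> sets lebesgue" "\<forall>j. B j \<in> sets lebesgue"
        and "\<forall>j. \<forall>x\<in>B j. ennreal \<gamma> \<le> HLmax (indicator (A j)) x"
      then have [measurable]: "\<And>j. A j \<in> sets lebesgue" "\<And>j. B j \<in> sets lebesgue"
        and ge: "\<And>j x. x \<in> B j \<Longrightarrow> ennreal \<gamma> \<le> HLmax (indicator (A j)) x" by auto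
      let ?SA = "\<lambda>x. epowr (\<Sum>j. indicator (A j) x) (1 / r)"
      let ?SB = "\<lambda>x. epowr (\<Sum>j. indicator (B j) x) (1 / r)"
      let ?SM = "\<lambda>x. epowr (\<Sum>j. epowr (HLmax (indicator (A j)) x) 2) (1 / r)"
      have "epowr (Xe X ?SM) p \<le> ennreal C * epowr (Xe X ?SA) p"
      proof -
        have "(\<Sum>j. ennreal (\<bar>indicator (A j) x\<bar> powr 2)) = (\<Sum>j. indicator (A j) x)" for x
          by (intro suminf_cong) (auto simp: indicator_def)
        then show ?thesis
          using C(2)[of "\<lambda>j. indicator (A j)"]
          by (simp add: Xepow_def epowr_epowr exps borel_measurable_indicator)
      qed
      from epowr_mono[OF _ this, of "1 / p"]
      have *: "Xe X ?SM \<le> ennreal (C powr (1 / p)) * Xe X ?SA"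
        using p C(1) by (simp add: epowr_mult epowr_epowr epowr_ennreal)
      have "ennreal \<eta> * Xe X ?SB = Xe X (\<lambda>x. ennreal \<eta> * ?SB x)"
        by (rule Xe_cmult[OF qB _ \<eta>, symmetric]) measurable
      also have "\<dots> \<le> Xe X ?SM"
      proof (rule Xe_mono[OF qB])
        show "AE x in lebesgue. ennreal \<eta> * ?SB x \<le> ?SM x"
        proof (rule AE_I2)
          fix x
          have "ennreal (\<gamma>\<^sup>2) * indicator (B j) x \<le> epowr (HLmax (indicator (A j)) x) 2" for j
            using epowr_mono[OF _ ge[of x j], of 2] \<gamma> by (auto simp: indicator_def epowr_ennreal)
          then have "(\<Sum>j. ennreal (\<gamma>\<^sup>2) * indicator (B j) x) \<le> (\<Sum>j. epowr (HLmax (indicator (A j)) x) 2)"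
            by (intro suminf_le) auto
          then have "ennreal (\<gamma>\<^sup>2) * (\<Sum>j. indicator (B j) x) \<le> (\<Sum>j. epowr (HLmax (indicator (A j)) x) 2)"
            by simp
          from epowr_mono[OF _ this, of "1 / r"] show "ennreal \<eta> * ?SB x \<le> ?SM x"
            using r by (simp add: epowr_mult epowr_ennreal \<eta>_def)
        qed
      qed measurable
      also note *
      finally have "ennreal (1 / \<eta>) * (ennreal \<eta> * Xe X ?SB) \<le> ennreal (1 / \<eta>) * (ennreal (C powr (1 / p)) * Xe X ?SA)"
        by (rule mult_left_mono) simp
      then show "Xe X ?SB \<le> ennreal (C powr (1 / p) / \<eta>) * Xe X ?SA"
        using \<eta> C(1) by (simp add: mult.assoc[symmetric] ennreal_mult[symmetric])
    qed
  qed
qed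

lemma suminf_indicator_single: "(\<Sum>j. indicator (if j = 0 then A else {}) x) = (indicator A x :: ennreal)"
proof -
  have "(\<Sum>j. indicator (if j = 0 then A else {}) x :: ennreal) = (\<Sum>j\<in>{0}. indicator (if j = (0::nat) then A else {}) x)"
    by (intro suminf_finite) auto
  then show ?thesis by simp
qed

lemma epowr_indicator: "0 < p \<Longrightarrow> epowr (indicator A x) p = indicator A x"
  by (auto simp: indicator_def)

lemma maximal_bound_single:
  fixes A B :: "(real^'n) set"
  assumes "maximal_bound X r \<gamma> K" "0 < r" "A \<in> sets lebesgue" "B \<in> sets lebesgue"
    "\<And>x. x \<in> B \<Longrightarrow> ennreal \<gamma> \<le> HLmax (indicator A) x"
  shows "X (indicator B) \<le> ennreal K * X (indicator A)"
proof -
  have "Xe X (\<lambda>x. epowr (\<Sum>j. indicator (if j = (0::nat) then B else {}) x) (1 / r))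
     \<le> ennreal K * Xe X (\<lambda>x. epowr (\<Sum>j. indicator (if j = (0::nat) then A else {}) x) (1 / r))"
    by (rule maximal_boundD[OF assms(1)]) (use assms in \<open>auto split: if_splits\<close>)
  then show ?thesis
    using assms(2) by (simp add: suminf_indicator_single epowr_indicator Xe_indicator)
qed

text \<open>The inner ball has at most half of the volume, since 2^(-n) \<le> 1/2 for n \<ge> 1.
  Annuli of dyadic radii are disjoint while the balls are nested; the next two consequences live on
  this contrast.\<close>

lemma HLmax_annulus_ge:
  fixes x :: "real^'n"
  assumes "0 < R" "x \<in> ball 0 R"
  shows "ennreal (1 / 2) \<le> HLmax (indicator (ball 0 R - ball 0 (R / 2))) x"
proof (rule HLmax_indicator_ge[OF assms])
  let ?v = "unit_ball_vol (real CARD('n))"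
  have v: "0 < ?v" by (rule unit_ball_vol_pos) simp
  have "(1/2::real) ^ CARD('n) \<le> (1/2) ^ 1" by (rule power_decreasing) (auto simp: Suc_le_eq)
  then have half: "?v * (R / 2) ^ CARD('n) \<le> 1 / 2 * (?v * R ^ CARD('n))"
    using v assms(1) by (simp add: power_divide power_one_over field_simps)
  have "emeasure lebesgue ((ball 0 R - ball 0 (R / 2)) \<inter> ball 0 R :: (real^'n) set)
      = emeasure lborel (ball 0 R - ball 0 (R / 2) :: (real^'n) set)"
    by (simp add: Int_absorb2 Diff_subset)
  also have "\<dots> = emeasure lborel (ball 0 R :: (real^'n) set) - emeasure lborel (ball 0 (R / 2) :: (real^'n) set)"
    using assms(1) by (intro emeasure_Diff) (auto simp: emeasure_ball)
  also have "\<dots> = ennreal (?v * R ^ CARD('n) - ?v * (R / 2) ^ CARD('n))"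
    using assms(1) v by (simp add: emeasure_ball ennreal_minus)
  also have "\<dots> \<ge> ennreal (1 / 2 * (?v * R ^ CARD('n)))"
    using half by (intro ennreal_leI) simp
  also have "ennreal (1 / 2 * (?v * R ^ CARD('n))) = ennreal (1 / 2) * emeasure lebesgue (ball 0 R :: (real^'n) set)"
    using assms(1) v by (subst ennreal_mult) (simp_all add: emeasure_ball)
  finally show "ennreal (1 / 2) * emeasure lebesgue (ball 0 R :: (real^'n) set)
      \<le> emeasure lebesgue ((ball 0 R - ball 0 (R / 2)) \<inter> ball 0 R :: (real^'n) set)" .
qed auto

lemma suminf_indicator_disjoint:
  fixes A :: "nat \<Rightarrow> 'a set"
  assumes "disjoint_family A"
  shows "(\<Sum>j. indicator (A j) x) = (indicator (\<Union>j. A j) x :: ennreal)"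
  using suminf_indicator[OF assms, of x] by simp

lemma disjoint_family_annuli:
  fixes R :: "nat \<Rightarrow> real"
  assumes "\<And>i j. i \<noteq> j \<Longrightarrow> R i \<le> R j / 2 \<or> R j \<le> R i / 2"
  shows "disjoint_family (\<lambda>j. ball 0 (R j) - ball 0 (R j / 2) :: (real^'n) set)"
  unfolding disjoint_family_on_def
proof (intro ballI impI)
  fix i j :: nat assume "i \<noteq> j"
  from assms[OF this] show "(ball 0 (R i) - ball 0 (R i / 2)) \<inter> (ball 0 (R j) - ball 0 (R j / 2)) = ({} :: (real^'n) set)"
    by auto
qed

lemma pow2_dichotomy:
  fixes i j :: nat
  assumes "i \<noteq> j"
  shows "2 ^ i \<le> 2 ^ j / (2::real) \<or> 2 ^ j \<le> 2 ^ i / (2::real)"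
proof -
  have "2 ^ Suc a \<le> (2::real) ^ b" if "a < b" for a b :: nat
    by (rule power_increasing) (use that in auto)
  then show ?thesis using assms by (cases i j rule: linorder_cases) (auto simp: field_simps)
qed

text \<open>The annuli of outer radius 2^j are disjoint, so their indicators add up to at most 1,
  but every point lies in infinitely many of the balls, and the left side of the maximal bound is
  infinite. The result keeps the open set of each level proper, so that a distance to its complement
  exists.\<close>

lemma FS_UNIV_infinite:
  fixes X :: "(real^'n \<Rightarrow> real) \<Rightarrow> ennreal"
  assumes qB: "ball_qBfs X" and FS: "FS X pm" and r: "0 < r" "r < pm"
  shows "X (indicator UNIV) = top"
proof -
  obtain K where K: "0 < K" "maximal_bound X r (1 / 2) K"
    using FS_maximal_bound[OF qB FS r, of "1 / 2"] by auto
  define A B :: "nat \<Rightarrow> (real^'n) set"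
    where "A j = ball 0 (2 ^ j) - ball 0 (2 ^ j / 2)" and "B j = ball 0 (2 ^ j)" for j
  have ge: "ennreal (1 / 2) \<le> HLmax (indicator (A j)) x" if "x \<in> B j" for j x
    unfolding A_def by (rule HLmax_annulus_ge) (use that in \<open>simp_all add: B_def\<close>)
  have "disjoint_family A"
    unfolding A_def by (rule disjoint_family_annuli) (rule pow2_dichotomy)
  note disj = suminf_indicator_disjoint[OF this]
  have top: "(\<Sum>j. indicator (B j) x :: ennreal) = top" for x
  proof -
    obtain m where m: "norm x < 2 ^ m" using real_arch_pow[of 2 "norm x"] by auto
    have "of_nat k \<le> (\<Sum>j. indicator (B j) x :: ennreal)" for k
    proof -
      have "of_nat k = (\<Sum>j\<in>{m..<m+k}. indicator (B j) x :: ennreal)"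
      proof -
        have "x \<in> B j" if "m \<le> j" for j
          using less_le_trans[OF m power_increasing[OF that, of "2::real"]] by (simp add: B_def)
        then show ?thesis by simp
      qed
      also have "\<dots> \<le> (\<Sum>j. indicator (B j) x)" by (intro sum_le_suminf) auto
      finally show ?thesis .
    qed
    then show ?thesis
      by (metis ennreal_SUP_of_nat_eq_top SUP_least top_unique)
  qed
  have "Xe X (\<lambda>x. epowr (\<Sum>j. indicator (B j) x) (1 / r))
       \<le> ennreal K * Xe X (\<lambda>x. epowr (\<Sum>j. indicator (A j) x) (1 / r))"
    by (rule maximal_boundD[OF K(2) _ _ ge]) (auto simp: A_def B_def)
  moreover have "\<not> (AE x in (lebesgue :: (real^'n) measure). False)"
    using AE_iff_null[of "lebesgue :: (real^'n) measure" "\<lambda>x. False"] by (auto dest: null_setsD1)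
  ultimately have "Xe X (\<lambda>x. epowr (\<Sum>j. indicator (A j) x) (1 / r)) = top"
    by (simp add: top Xe_def ennreal_mult_eq_top_iff top_unique split: if_splits)
  then have "X (indicator (\<Union>j. A j)) = top"
    using r by (simp add: disj epowr_indicator Xe_indicator)
  moreover have "X (indicator (\<Union>j. A j)) \<le> X (indicator UNIV)"
    by (rule qBfs_indicator_mono[OF qB]) (auto simp: A_def)
  ultimately show ?thesis by (simp add: top_unique)
qed

text \<open>The lattice axioms alone do not give this: in L^\<infinity> every ball has norm 1. Here
  the disjoint annuli of outer radius 2^(-j) fit into the unit ball, whereas the ball of radius
  2^(-J) lies in J larger balls of the family; hence its norm is O(J^(-1/r)).\<close>

lemma FS_small_balls:
  fixes X :: "(real^'n \<Rightarrow> real) \<Rightarrow> ennreal"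
  assumes qB: "ball_qBfs X" and FS: "FS X pm" and r: "0 < r" "r < pm" and e: "0 < e"
  obtains \<rho> where "0 < \<rho>" "X (indicator (ball 0 \<rho>)) \<le> ennreal e"
proof -
  obtain K where K: "0 < K" "maximal_bound X r (1 / 2) K"
    using FS_maximal_bound[OF qB FS r, of "1 / 2"] by auto
  define A B :: "nat \<Rightarrow> (real^'n) set"
    where "A j = ball 0 (1 / 2 ^ j) - ball 0 (1 / 2 ^ j / 2)" and "B j = ball 0 (1 / 2 ^ j)" for j
  have ge: "ennreal (1 / 2) \<le> HLmax (indicator (A j)) x" if "x \<in> B j" for j x
    unfolding A_def by (rule HLmax_annulus_ge) (use that in \<open>simp_all add: B_def\<close>)
  have "disjoint_family A"
    unfolding A_def
  proof (rule disjoint_family_annuli)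
    fix i j :: nat assume "i \<noteq> j"
    from pow2_dichotomy[OF this] show "1 / 2 ^ i \<le> 1 / 2 ^ j / (2::real) \<or> 1 / 2 ^ j \<le> 1 / 2 ^ i / (2::real)"
      by (auto simp: field_simps)
  qed
  note disj = suminf_indicator_disjoint[OF this]
  have [measurable]: "B j \<in> sets lebesgue" for j by (simp add: B_def)
  obtain b where b: "0 \<le> b" "X (indicator (ball 0 1 :: (real^'n) set)) = ennreal b"
    using qBfs_ball_finite[OF qB, of 1 0] by (cases "X (indicator (ball 0 1 :: (real^'n) set))") auto
  have "Xe X (\<lambda>x. epowr (\<Sum>j. indicator (B j) x) (1 / r))
       \<le> ennreal K * Xe X (\<lambda>x. epowr (\<Sum>j. indicator (A j) x) (1 / r))"
    by (rule maximal_boundD[OF K(2) _ _ ge]) (auto simp: A_def B_def)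
  also have "Xe X (\<lambda>x. epowr (\<Sum>j. indicator (A j) x) (1 / r)) = X (indicator (\<Union>j. A j))"
    using r by (simp add: disj epowr_indicator Xe_indicator)
  also have "\<dots> \<le> ennreal b"
    unfolding b(2)[symmetric]
  proof (rule qBfs_indicator_mono[OF qB])
    have "1 / 2 ^ j \<le> (1::real)" for j :: nat by simp
    then have "ball 0 (1 / 2 ^ j) \<subseteq> (ball 0 1 :: (real^'n) set)" for j :: nat by (rule subset_ball)
    then show "(\<Union>j. A j) \<subseteq> ball 0 1" unfolding A_def by blast
  qed (auto simp: A_def)
  finally have le: "Xe X (\<lambda>x. epowr (\<Sum>j. indicator (B j) x) (1 / r)) \<le> ennreal (K * b)"
    using K(1) b(1) by (simp add: ennreal_mult mult_left_mono)
  have key: "ennreal (real J powr (1 / r)) * X (indicator (B J)) \<le> ennreal (K * b)" if "0 < J" for J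
  proof -
    have "ennreal (real J powr (1 / r)) * X (indicator (B J))
        = Xe X (\<lambda>x. ennreal (real J powr (1 / r)) * indicator (B J) x)"
      using that by (subst Xe_cmult[OF qB]) (auto simp: B_def Xe_indicator borel_measurable_indicator)
    also have "\<dots> \<le> Xe X (\<lambda>x. epowr (\<Sum>j. indicator (B j) x) (1 / r))"
    proof (rule Xe_mono[OF qB])
      show "AE x in lebesgue. ennreal (real J powr (1 / r)) * indicator (B J) x
          \<le> epowr (\<Sum>j. indicator (B j) x) (1 / r)"
      proof (rule AE_I2)
        fix x
        show "ennreal (real J powr (1 / r)) * indicator (B J) x \<le> epowr (\<Sum>j. indicator (B j) x) (1 / r)"
        proof (cases "x \<in> B J")
          case True
          have "x \<in> B j" if "j < J" for j
          proof -
            have "1 / 2 ^ J \<le> (1::real) / 2 ^ j"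
              by (rule divide_left_mono) (use that in \<open>auto intro: power_increasing\<close>)
            with True show ?thesis by (auto simp: B_def)
          qed
          then have "of_nat J = (\<Sum>j<J. indicator (B j) x :: ennreal)" by simp
          also have "\<dots> \<le> (\<Sum>j. indicator (B j) x)" by (intro sum_le_suminf) auto
          finally have "ennreal (real J) \<le> (\<Sum>j. indicator (B j) x)"
            by (simp add: ennreal_of_nat_eq_real_of_nat)
          from epowr_mono[OF _ this, of "1 / r"] show ?thesis using r True by (simp add: epowr_ennreal)
        qed simp
      qed
    qed measurable
    also note le
    finally show ?thesis .
  qed
  obtain J :: nat where J: "(K * b / e) powr r < real J" using reals_Archimedean2 by blast
  then have J0: "0 < J" using powr_ge_zero[of "K * b / e" r] by (cases J) auto
  obtain y where y: "0 \<le> y" "X (indicator (B J)) = ennreal y"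
    using qBfs_ball_finite[OF qB, of "1 / 2 ^ J" 0] by (cases "X (indicator (B J))") (auto simp: B_def)
  have "K * b / e = ((K * b / e) powr r) powr (1 / r)"
    using K(1) b(1) e r by (simp add: powr_powr)
  also have "\<dots> \<le> real J powr (1 / r)" using J r by (intro powr_mono2) auto
  finally have "K * b \<le> real J powr (1 / r) * e" using e by (simp add: field_simps)
  moreover have "real J powr (1 / r) * y \<le> K * b"
    using key[OF J0] y K(1) b(1) by (simp add: ennreal_mult[symmetric])
  ultimately have "real J powr (1 / r) * y \<le> real J powr (1 / r) * e" by linarith
  then have "y \<le> e" using J0 by simp
  then show thesis using that[of "1 / 2 ^ J"] y by (simp add: B_def[symmetric] ennreal_leI)
qed

section \<open>The area function\<close>

definition L2n :: "'a measure \<Rightarrow> ('a \<Rightarrow> ennreal) \<Rightarrow> ennreal" where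
  "L2n M u = epowr (\<integral>\<^sup>+z. (u z)\<^sup>2 \<partial>M) (1 / 2)"

lemma L2n_mono_AE: "AE z in M. u z \<le> v z \<Longrightarrow> L2n M u \<le> L2n M v"
  unfolding L2n_def
  by (intro epowr_mono nn_integral_mono_AE) (auto elim!: eventually_mono intro!: power_mono)

lemma L2n_cmult:
  assumes "u \<in> borel_measurable M"
  shows "L2n M (\<lambda>z. c * u z) = c * L2n M u"
proof -
  have "(\<integral>\<^sup>+z. (c * u z)\<^sup>2 \<partial>M) = c\<^sup>2 * (\<integral>\<^sup>+z. (u z)\<^sup>2 \<partial>M)"
    using assms by (simp add: power_mult_distrib nn_integral_cmult)
  then show ?thesis
    by (simp add: L2n_def epowr_mult epowr_epowr flip: epowr_2)
qed

lemma nn_integral_eq_L2n_square: "(\<integral>\<^sup>+z. (u z)\<^sup>2 \<partial>M) = (L2n M u)\<^sup>2"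
  by (simp add: L2n_def epowr_epowr flip: epowr_2)

text \<open>Young's inequality 2ab \<le> t a^2 + b^2 / t. The free parameter yields Minkowski's
  inequality by integrating termwise and then choosing t.\<close>

lemma ennreal_square_add_le:
  assumes "0 < t"
  shows "(x + y)\<^sup>2 \<le> ennreal (1 + t) * x\<^sup>2 + ennreal (1 + 1 / t) * y\<^sup>2"
proof (cases "x = top \<or> y = top")
  case True
  then have "ennreal (1 + t) * x\<^sup>2 + ennreal (1 + 1 / t) * y\<^sup>2 = top"
    using assms by (auto simp: power2_eq_square ennreal_mult_top ennreal_mult_eq_top_iff)
  then show ?thesis by (simp only: top_greatest)
next
  case False
  then obtain a b where ab: "0 \<le> a" "x = ennreal a" "0 \<le> b" "y = ennreal b"
    by (cases x; cases y) auto
  have "0 \<le> (t * a - b)\<^sup>2 / t" using assms by simp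
  also have "\<dots> = t * a\<^sup>2 - 2 * a * b + b\<^sup>2 / t"
    using assms by (simp add: power2_eq_square field_simps)
  finally have "(a + b)\<^sup>2 \<le> (1 + t) * a\<^sup>2 + (1 + 1 / t) * b\<^sup>2"
    by (simp add: power2_eq_square algebra_simps)
  then show ?thesis using ab assms
    by (simp add: ennreal_power ennreal_mult[symmetric] ennreal_plus[symmetric] ennreal_leI del: ennreal_plus)
qed

lemma L2n_add_le:
  assumes [measurable]: "u \<in> borel_measurable M" "v \<in> borel_measurable M"
  shows "L2n M (\<lambda>z. u z + v z) \<le> L2n M u + L2n M v"
proof -
  have *: "L2n M (\<lambda>z. u z + v z) \<le> L2n M u + L2n M v"
    if [measurable]: "u \<in> borel_measurable M" "v \<in> borel_measurable M" and "L2n M u = 0" for u v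
  proof -
    have "(\<integral>\<^sup>+z. (u z)\<^sup>2 \<partial>M) = 0" using that(3) by (simp add: nn_integral_eq_L2n_square)
    then have "AE z in M. (u z)\<^sup>2 = 0" by (subst (asm) nn_integral_0_iff_AE) auto
    then have "L2n M (\<lambda>z. u z + v z) \<le> L2n M v"
      by (intro L2n_mono_AE) (auto elim!: eventually_mono)
    then show ?thesis by (simp add: add_increasing)
  qed
  consider "L2n M u = 0" | "L2n M v = 0" | "L2n M u = top \<or> L2n M v = top"
    | "L2n M u \<noteq> 0" "L2n M v \<noteq> 0" "L2n M u \<noteq> top" "L2n M v \<noteq> top" by blast
  then show ?thesis
  proof cases
    case 1 then show ?thesis using *[of u v] by simp
  next
    case 2 then show ?thesis using *[of v u] by (simp add: add.commute)
  next
    case 3 then show ?thesis by auto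
  next
    case 4
    then obtain a b where ab: "0 < a" "L2n M u = ennreal a" "0 < b" "L2n M v = ennreal b"
      by (cases "L2n M u"; cases "L2n M v") auto
    \<comment> \<open>The minimising parameter: it turns the bound into the exact square of the sum
      of the norms. The previous cases exclude a ratio involving 0 or infinity.\<close>
    define t where "t = b / a"
    have t: "0 < t" using ab by (simp add: t_def)
    have "(\<integral>\<^sup>+z. (u z + v z)\<^sup>2 \<partial>M)
        \<le> (\<integral>\<^sup>+z. ennreal (1 + t) * (u z)\<^sup>2 + ennreal (1 + 1 / t) * (v z)\<^sup>2 \<partial>M)"
      by (intro nn_integral_mono ennreal_square_add_le t)
    also have "\<dots> = ennreal (1 + t) * (L2n M u)\<^sup>2 + ennreal (1 + 1 / t) * (L2n M v)\<^sup>2"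
      by (simp add: nn_integral_add nn_integral_cmult nn_integral_eq_L2n_square)
    also have "\<dots> = ennreal ((1 + t) * a\<^sup>2 + (1 + 1 / t) * b\<^sup>2)"
      using ab t by (simp add: ennreal_power ennreal_mult[symmetric] ennreal_plus[symmetric] del: ennreal_plus)
    also have "(1 + t) * a\<^sup>2 + (1 + 1 / t) * b\<^sup>2 = (a + b)\<^sup>2"
      using ab by (simp add: t_def power2_eq_square field_simps)
    also have "ennreal ((a + b)\<^sup>2) = (L2n M u + L2n M v)\<^sup>2"
      using ab by (simp add: ennreal_power[symmetric])
    finally show ?thesis unfolding L2n_def[of M "\<lambda>z. u z + v z"] epowr_half_le_iff .
  qed
qed

lemma L2n_suminf_le:
  assumes [measurable]: "\<And>k. u k \<in> borel_measurable M"
  shows "L2n M (\<lambda>z. \<Sum>k. u k z) \<le> (\<Sum>k. L2n M (u k))"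
proof -
  have "L2n M (\<lambda>z. \<Sum>k<m. u k z) \<le> (\<Sum>k<m. L2n M (u k))" for m
  proof (induction m)
    case (Suc m)
    have "L2n M (\<lambda>z. \<Sum>k<Suc m. u k z) \<le> L2n M (\<lambda>z. \<Sum>k<m. u k z) + L2n M (u m)"
      using L2n_add_le[of "\<lambda>z. \<Sum>k<m. u k z" M "u m"] by simp
    also have "\<dots> \<le> (\<Sum>k<Suc m. L2n M (u k))" using Suc by (simp add: add_right_mono)
    finally show ?case .
  qed (simp add: L2n_def)
  then have "L2n M (\<lambda>z. \<Sum>k<m. u k z) \<le> (\<Sum>k. L2n M (u k))" for m
    by (rule order_trans) (simp add: sum_le_suminf)
  then have le: "(\<integral>\<^sup>+z. (\<Sum>k<m. u k z)\<^sup>2 \<partial>M) \<le> (\<Sum>k. L2n M (u k))\<^sup>2" for m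
    unfolding L2n_def[of M "\<lambda>z. \<Sum>k<m. u k z" for m] epowr_half_le_iff .
  have inc: "incseq (\<lambda>m z. (\<Sum>k<m. u k z)\<^sup>2)"
    by (auto simp: incseq_def le_fun_def intro!: power_mono sum_mono2)
  have "(\<Sum>k. u k z)\<^sup>2 = (SUP m. (\<Sum>k<m. u k z)\<^sup>2)" for z
  proof (rule LIMSEQ_unique)
    have "(\<lambda>m. \<Sum>k<m. u k z) \<longlonglongrightarrow> (\<Sum>k. u k z)" by (intro summable_LIMSEQ) auto
    then show "(\<lambda>m. (\<Sum>k<m. u k z)\<^sup>2) \<longlonglongrightarrow> (\<Sum>k. u k z)\<^sup>2"
      unfolding power2_eq_square by (intro tendsto_mult_ennreal) (auto simp: sum_nonneg)
    show "(\<lambda>m. (\<Sum>k<m. u k z)\<^sup>2) \<longlonglongrightarrow> (SUP m. (\<Sum>k<m. u k z)\<^sup>2)"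
      using inc by (intro LIMSEQ_SUP) (auto simp: incseq_def le_fun_def)
  qed
  then have "(\<integral>\<^sup>+z. (\<Sum>k. u k z)\<^sup>2 \<partial>M) = (\<integral>\<^sup>+z. (SUP m. (\<Sum>k<m. u k z)\<^sup>2) \<partial>M)" by simp
  also have "\<dots> = (SUP m. \<integral>\<^sup>+z. (\<Sum>k<m. u k z)\<^sup>2 \<partial>M)"
    using inc by (intro nn_integral_monotone_convergence_SUP) auto
  also have "\<dots> \<le> (\<Sum>k. L2n M (u k))\<^sup>2" by (intro SUP_least le)
  finally show ?thesis unfolding L2n_def[of M "\<lambda>z. \<Sum>k. u k z"] epowr_half_le_iff .
qed

text \<open>Cone and weight dy dt / t^(n+1) are absorbed into the measure, so for a fixed vertex the
  area function is an L^2 norm and a series of atoms is handled by Minkowski's inequality.\<close>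

definition cone_measure :: "real^'n \<Rightarrow> ((real^'n) \<times> real) measure" where
  "cone_measure x = density lebesgue (\<lambda>z. indicator (cone x) z * ennreal (1 / snd z ^ (CARD('n) + 1)))"

lemma open_cone: "open (cone x)"
  unfolding cone_def by (intro open_Collect_conj open_Collect_less continuous_intros)

lemma open_imp_lebesgue: "open S \<Longrightarrow> S \<in> sets lebesgue"
  by (metis borel_open sets_completionI_sets sets_lborel)

lemma cone_lebesgue [measurable]: "cone x \<in> sets lebesgue"
  by (rule open_imp_lebesgue[OF open_cone])

lemma borel_measurable_lebesgue_snd [measurable]: "(snd :: (real^'n) \<times> real \<Rightarrow> real) \<in> borel_measurable lebesgue"
  by (intro measurable_completion) (simp add: borel_measurable_continuous_onI continuous_on_snd)

lemma sets_cone_measure [measurable_cong, simp]: "sets (cone_measure x) = sets lebesgue"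
  by (simp add: cone_measure_def)

lemma nn_integral_cone_measure:
  fixes x :: "real^'n"
  assumes [measurable]: "u \<in> borel_measurable lebesgue"
  shows "(\<integral>\<^sup>+z. u z \<partial>cone_measure x)
    = (\<integral>\<^sup>+z. indicator (cone x) z * ennreal (1 / snd z ^ (CARD('n) + 1)) * u z \<partial>lebesgue)"
  unfolding cone_measure_def by (rule nn_integral_density) measurable

lemma AE_cone_measureI:
  fixes x :: "real^'n"
  assumes "AE z in lebesgue. 0 < snd z \<longrightarrow> P z"
  shows "AE z in cone_measure x. P z"
  unfolding cone_measure_def
proof (subst AE_density)
  show "AE z in lebesgue. 0 < indicator (cone x) z * ennreal (1 / snd z ^ (CARD('n) + 1)) \<longrightarrow> P z"
    using assms by (rule eventually_mono) (auto simp: cone_def indicator_def)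
qed measurable

lemma area_eq_L2n:
  fixes f :: "(real^'n) \<times> real \<Rightarrow> complex"
  assumes [measurable]: "f \<in> borel_measurable lebesgue"
  shows "area f x = L2n (cone_measure x) (\<lambda>z. ennreal (cmod (f z)))"
proof -
  have "indicator (cone x) z * ennreal ((cmod (f z))\<^sup>2 / snd z ^ (CARD('n) + 1))
      = indicator (cone x) z * ennreal (1 / snd z ^ (CARD('n) + 1)) * (ennreal (cmod (f z)))\<^sup>2" for z
  proof (cases "z \<in> cone x")
    case True
    then show ?thesis 
      by (simp add: cone_def ennreal_power ennreal_mult[symmetric] del: power_Suc)
  qed simp
  then show ?thesis
    unfolding area_def L2n_def by (subst nn_integral_cone_measure) (simp_all del: power_Suc)
qed

text \<open>Lower semicontinuity by Fatou's lemma: cones are open, so a point of the cone at the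
  limit vertex lies in the cones at all late vertices. The measurability of the area function in its
  vertex rests on this.\<close>

lemma open_area_superlevel:
  fixes f :: "(real^'n) \<times> real \<Rightarrow> complex"
  assumes [measurable]: "f \<in> borel_measurable lebesgue"
  shows "open {x. a < area f x}"
proof -
  define h where "h z = ennreal ((cmod (f z))\<^sup>2 / snd z ^ (CARD('n) + 1))" for z
  have [measurable]: "h \<in> borel_measurable lebesgue" unfolding h_def by measurable
  define I where "I x = (\<integral>\<^sup>+z. indicator (cone x) z * h z \<partial>lebesgue)" for x
  have "closed {x. I x \<le> a\<^sup>2}"
    unfolding closed_sequential_limits
  proof (intro allI impI, elim conjE)
    fix s l assume s: "\<forall>n. s n \<in> {x. I x \<le> a\<^sup>2}" and lim: "s \<longlonglongrightarrow> l"
    have "I l \<le> (\<integral>\<^sup>+z. liminf (\<lambda>n. indicator (cone (s n)) z * h z) \<partial>lebesgue)"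
      unfolding I_def
    proof (intro nn_integral_mono)
      fix z :: "(real^'n) \<times> real"
      show "indicator (cone l) z * h z \<le> liminf (\<lambda>n. indicator (cone (s n)) z * h z)"
      proof (cases "z \<in> cone l")
        case True
        have "(\<lambda>n. dist (s n) (fst z)) \<longlonglongrightarrow> dist l (fst z)" by (intro tendsto_intros lim)
        moreover have "dist l (fst z) < snd z" using True by (simp add: cone_def)
        ultimately have "\<forall>\<^sub>F n in sequentially. dist (s n) (fst z) < snd z" by (rule order_tendstoD)
        then have "\<forall>\<^sub>F n in sequentially. h z \<le> indicator (cone (s n)) z * h z"
          by (rule eventually_mono) (use True in \<open>simp add: cone_def\<close>)
        then show ?thesis using True by (simp add: Liminf_bounded)
      qed simp
    qed
    also have "\<dots> \<le> liminf (\<lambda>n. I (s n))"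
      unfolding I_def by (rule nn_integral_liminf) measurable
    also have "\<dots> \<le> a\<^sup>2"
    proof -
      have "liminf (\<lambda>n. I (s n)) \<le> liminf (\<lambda>n. a\<^sup>2)"
        using s by (intro Liminf_mono always_eventually) auto
      then show ?thesis by (simp add: Liminf_const)
    qed
    finally show "l \<in> {x. I x \<le> a\<^sup>2}" by simp
  qed
  moreover have "{x. a < area f x} = - {x. I x \<le> a\<^sup>2}"
    by (auto simp: not_le[symmetric] epowr_half_le_iff[symmetric] area_def I_def h_def)
  ultimately show ?thesis by (simp add: open_closed)
qed

lemma borel_measurable_area [measurable]:
  "f \<in> borel_measurable lebesgue \<Longrightarrow> area f \<in> borel_measurable lebesgue"
  by (rule borel_measurable_lebesgueI_open) (rule open_area_superlevel)

text \<open>A point (y, t) of the tent that is seen from x forces |x - c| < t + (r - t) = r.\<close>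

lemma area_outside_tent:
  assumes "\<And>z. z \<notin> tent c r \<Longrightarrow> a z = 0" "x \<notin> ball c r"
  shows "area a x = 0"
proof -
  have "z \<notin> tent c r" if "z \<in> cone x" for z
    using that assms(2) dist_triangle[of c x "fst z"] by (auto simp: tent_def cone_def dist_commute)
  then have "indicator (cone x) z * ennreal ((cmod (a z))\<^sup>2 / snd z ^ (CARD('a) + 1)) = 0" for z
    using assms(1)[of z] by (auto simp: indicator_def)
  then show ?thesis unfolding area_def by (simp only: nn_integral_const) simp
qed

text \<open>The atoms satisfy the size condition with the same constant for every exponent, so letting
  the exponent tend to infinity turns it into a pointwise bound.\<close>

lemma TX_inf_atom_area_le:
  fixes X :: "(real^'n \<Rightarrow> real) \<Rightarrow> ennreal"
  assumes qB: "ball_qBfs X" and atom: "TX_inf_atom X a c r"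
  shows "AE x in lebesgue. area a x \<le> indicator (ball c r) x / X (indicator (ball c r))"
proof -
  have at: "TX_atom X p a c r" if "1 < p" for p using atom that by (simp add: TX_inf_atom_def)
  from at[of 2] have r: "0 < r" and [measurable]: "a \<in> borel_measurable lebesgue"
    and supp: "\<And>z. z \<notin> tent c r \<Longrightarrow> a z = 0" by (auto simp: TX_atom_def)
  obtain q where q: "0 < q" "X (indicator (ball c r)) = ennreal q"
    using qBfs_ball_finite[OF qB r, of c] qBfs_ball_pos[OF qB r, of c]
    by (cases "X (indicator (ball c r))") auto
  define m where "m = measure lebesgue (ball c r)"
  have null: "emeasure lebesgue {x. ennreal b < area a x} = 0" if b: "1 / q < b" for b
  proof -
    define E where "E = {x. ennreal b < area a x}"
    have [measurable]: "E \<in> sets lebesgue" unfolding E_def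
      by (intro open_imp_lebesgue open_area_superlevel) measurable
    have b0: "0 < b" using b q(1) by (meson divide_pos_pos less_trans zero_less_one)
    have bq: "0 < b * q" "1 / (b * q) < 1" using b b0 q(1) by (auto simp: field_simps)
    have le: "emeasure lebesgue E \<le> ennreal (m * (1 / (b * q)) ^ (n + 2))" for n
    proof -
      \<comment> \<open>Chebyshev's inequality at the integer exponents n + 2, all above 1, bounds
        the measure by a geometric sequence of ratio 1 / (b q) < 1.\<close>
      define p where "p = real (n + 2)"
      have p: "1 < p" by (simp add: p_def)
      have "T2norm p a \<le> ennreal (m powr (1 / p) / q)"
        using at[OF p] q by (simp add: TX_atom_def m_def divide_ennreal)
      from epowr_mono[OF _ this, of p]
      have I: "(\<integral>\<^sup>+x. epowr (area a x) p \<partial>lebesgue) \<le> ennreal (m / q powr p)"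
        using p q by (simp add: T2norm_def epowr_epowr epowr_ennreal powr_divide powr_powr m_def)
      have "ennreal (b powr p) * emeasure lebesgue E = (\<integral>\<^sup>+x. ennreal (b powr p) * indicator E x \<partial>lebesgue)"
        by (simp add: nn_integral_cmult_indicator)
      also have "\<dots> \<le> (\<integral>\<^sup>+x. epowr (area a x) p \<partial>lebesgue)"
      proof (rule nn_integral_mono)
        fix x show "ennreal (b powr p) * indicator E x \<le> epowr (area a x) p"
          using epowr_mono[of p "ennreal b" "area a x"] p b0
          by (auto simp: indicator_def E_def epowr_ennreal)
      qed
      also note I
      finally have "ennreal (1 / b powr p) * (ennreal (b powr p) * emeasure lebesgue E) \<le> ennreal (1 / b powr p) * ennreal (m / q powr p)"
        by (rule mult_left_mono) simp
      then have "emeasure lebesgue E \<le> ennreal (1 / b powr p * (m / q powr p))"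
        using b0 by (simp add: mult.assoc[symmetric] ennreal_mult[symmetric] m_def)
      also have "1 / b powr p * (m / q powr p) = m * (1 / (b * q)) ^ (n + 2)"
        using b0 q(1) by (simp add: p_def powr_realpow[symmetric] powr_divide powr_mult del: of_nat_add power_Suc)
      finally show ?thesis .
    qed
    have "(\<lambda>n. m * (1 / (b * q)) ^ (n + 2)) \<longlonglongrightarrow> m * 0"
      using bq by (intro tendsto_mult tendsto_const LIMSEQ_ignore_initial_segment LIMSEQ_power_zero) auto
    then have "(\<lambda>n. ennreal (m * (1 / (b * q)) ^ (n + 2))) \<longlonglongrightarrow> ennreal (m * 0)"
      by (rule tendsto_ennrealI)
    from LIMSEQ_le_const[OF this] le have "emeasure lebesgue E \<le> ennreal (m * 0)" by blast
    then show ?thesis by (simp add: E_def)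
  qed
  have "AE x in lebesgue. area a x \<le> ennreal (1 / q + 1 / real (Suc n))" for n
  proof (rule AE_I)
    show "{x\<in>space lebesgue. \<not> area a x \<le> ennreal (1 / q + 1 / real (Suc n))} \<subseteq> {x. ennreal (1 / q + 1 / real (Suc n)) < area a x}"
      by auto
    show "emeasure lebesgue {x. ennreal (1 / q + 1 / real (Suc n)) < area a x} = 0"
      by (rule null) simp
    show "{x. ennreal (1 / q + 1 / real (Suc n)) < area a x} \<in> sets lebesgue"
      by (intro open_imp_lebesgue open_area_superlevel) measurable
  qed
  then have "AE x in lebesgue. \<forall>n. area a x \<le> ennreal (1 / q + 1 / real (Suc n))"
    by (simp add: AE_all_countable)
  then show ?thesis
  proof (rule eventually_mono)
    fix x assume le: "\<forall>n. area a x \<le> ennreal (1 / q + 1 / real (Suc n))"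
    have "(\<lambda>n. 1 / q + 1 / real (Suc n)) \<longlonglongrightarrow> 1 / q + 0"
      by (intro tendsto_add tendsto_const LIMSEQ_Suc lim_1_over_n)
    then have "(\<lambda>n. ennreal (1 / q + 1 / real (Suc n))) \<longlonglongrightarrow> ennreal (1 / q + 0)"
      by (rule tendsto_ennrealI)
    from LIMSEQ_le_const[OF this] le have "area a x \<le> ennreal (1 / q + 0)" by blast
    then show "area a x \<le> indicator (ball c r) x / X (indicator (ball c r))"
      using area_outside_tent[of c r a x] supp q divide_ennreal[of 1 q] by (cases "x \<in> ball c r") auto
  qed
qed

section \<open>From decompositions to the weak tent norm\<close>

lemma ball_lebesgue [measurable]: "ball c \<rho> \<in> sets lebesgue"
  by simp

text \<open>The split point is free because two are needed: 0 matches the two half-series of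
  \<open>zsums\<close>, and the level with 2^i near \<alpha> separates the two regimes of the
  weights min(1, 2^i / \<alpha>).\<close>

lemma suminf_int_decode:
  fixes g :: "int \<Rightarrow> ennreal"
  shows "(\<Sum>n. g (int_decode n)) = (\<Sum>k. g (i0 + int k)) + (\<Sum>k. g (i0 - int k - 1))"
proof -
  have "(\<Sum>n. g (int_decode n)) = (\<integral>\<^sup>+i. g i \<partial>count_space UNIV)"
    using nn_integral_bij_count_space[OF bij_int_decode, of g] by (simp add: nn_integral_count_space_nat)
  also have "\<dots> = (\<integral>\<^sup>+i. g i * indicator {i0..} i + g i * indicator {..<i0} i \<partial>count_space UNIV)"
    by (intro nn_integral_cong) (auto simp: indicator_def)
  also have "\<dots> = (\<integral>\<^sup>+i. g i \<partial>count_space {i0..}) + (\<integral>\<^sup>+i. g i \<partial>count_space {..<i0})"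
    by (simp add: nn_integral_add nn_integral_count_space_indicator)
  also have "(\<integral>\<^sup>+i. g i \<partial>count_space {i0..}) = (\<Sum>k. g (i0 + int k))"
  proof -
    have "bij_betw (\<lambda>k. i0 + int k) UNIV {i0..}"
      by (rule bij_betw_byWitness[where f' = "\<lambda>i. nat (i - i0)"]) auto
    from nn_integral_bij_count_space[OF this, of g] show ?thesis by (simp add: nn_integral_count_space_nat)
  qed
  also have "(\<integral>\<^sup>+i. g i \<partial>count_space {..<i0}) = (\<Sum>k. g (i0 - int k - 1))"
  proof -
    have "bij_betw (\<lambda>k. i0 - int k - 1) UNIV {..<i0}"
      by (rule bij_betw_byWitness[where f' = "\<lambda>i. nat (i0 - i - 1)"]) auto
    from nn_integral_bij_count_space[OF this, of g] show ?thesis by (simp add: nn_integral_count_space_nat)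
  qed
  finally show ?thesis .
qed

lemma norm_sums_le:
  fixes s :: "nat \<Rightarrow> complex"
  assumes "s sums u"
  shows "ennreal (cmod u) \<le> (\<Sum>k. ennreal (cmod (s k)))"
proof (cases "(\<Sum>k. ennreal (cmod (s k))) = top")
  case False
  then have sm: "summable (\<lambda>k. cmod (s k))" by (intro summable_suminf_not_top) auto
  have "cmod u \<le> (\<Sum>k. cmod (s k))"
    using summable_norm[OF sm] assms by (simp add: sums_iff)
  then show ?thesis using sm by (simp add: suminf_ennreal2 ennreal_leI)
qed simp

lemma norm_zsums_le:
  assumes "zsums s u"
  shows "ennreal (cmod u) \<le> (\<Sum>n. ennreal (cmod (s (int_decode n))))"
proof -
  obtain v w where vw: "(\<lambda>k. s (int k)) sums v" "(\<lambda>k. s (- int k - 1)) sums w" "u = v + w"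
    using assms by (auto simp: zsums_def)
  have "ennreal (cmod u) \<le> ennreal (cmod v) + ennreal (cmod w)"
    using norm_triangle_ineq[of v w] vw(3) by (simp add: ennreal_plus[symmetric] ennreal_leI del: ennreal_plus)
  also have "\<dots> \<le> (\<Sum>k. ennreal (cmod (s (int k)))) + (\<Sum>k. ennreal (cmod (s (- int k - 1))))"
    by (intro add_mono norm_sums_le vw)
  also have "\<dots> = (\<Sum>n. ennreal (cmod (s (int_decode n))))"
    using suminf_int_decode[of "\<lambda>i. ennreal (cmod (s i))" 0] by simp
  finally show ?thesis .
qed

lemma suminf_geometric_le:
  fixes q A :: real
  assumes "0 \<le> A" "0 < q" "q < 1" "\<And>k. g k \<le> A * q ^ k"
  shows "(\<Sum>k. ennreal (g k)) \<le> ennreal (A / (1 - q))"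
proof -
  have "(\<Sum>k. ennreal (g k)) \<le> (\<Sum>k. ennreal (A * q ^ k))"
    by (intro suminf_le ennreal_leI assms) auto
  also have "\<dots> = ennreal (\<Sum>k. A * q ^ k)"
    using assms by (intro suminf_ennreal2 summable_mult summable_geometric) auto
  also have "(\<Sum>k. A * q ^ k) = A / (1 - q)"
    using assms by (simp add: suminf_mult suminf_geometric summable_geometric)
  finally show ?thesis .
qed

text \<open>The summand is at most 2^(-r i) and at most 2^((1 - r) i) / \<alpha>. The first bound
  decays geometrically upwards and the second downwards, because 0 < r < 1, and near 2^i = \<alpha>
  both have size \<alpha>^(-r).\<close>

lemma dyadic_weight_sum:
  fixes r :: real
  assumes r: "0 < r" "r < 1"
  obtains G where "0 < G"
    "\<And>\<alpha>. 0 < \<alpha> \<Longrightarrow> (\<Sum>n. ennreal (min 1 (2 powr real_of_int (int_decode n) / \<alpha>)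
        * 2 powr (- (r * real_of_int (int_decode n))))) \<le> ennreal (G * \<alpha> powr (- r))"
proof -
  define q1 q2 where "q1 = (2::real) powr (- r)" and "q2 = (2::real) powr (- (1 - r))"
  have q1: "0 < q1" "q1 < 1" using r by (auto simp: q1_def powr_less_one)
  have q2: "0 < q2" "q2 < 1" using r by (auto simp: q2_def powr_less_one)
  define G where "G = 2 powr r / (1 - q1) + 1 / (1 - q2)"
  show thesis
  proof (rule that[of G])
    show "0 < G" using q1 q2 by (simp add: G_def add_pos_pos)
    fix \<alpha> :: real assume \<alpha>: "0 < \<alpha>"
    define i0 where "i0 = \<lfloor>log 2 \<alpha>\<rfloor>"
    have "real_of_int i0 \<le> log 2 \<alpha>" "log 2 \<alpha> < real_of_int i0 + 1" by (auto simp: i0_def)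
    then have lo: "2 powr real_of_int i0 \<le> \<alpha>" and hi: "\<alpha> < 2 powr (real_of_int i0 + 1)"
      using \<alpha> by (auto simp: le_log_iff log_less_iff)
    define g where "g i = min 1 (2 powr real_of_int i / \<alpha>) * 2 powr (- (r * real_of_int i))" for i
    have up: "g (i0 + int k) \<le> (2 powr r * \<alpha> powr (- r)) * q1 ^ k" for k
    proof -
      have "g (i0 + int k) \<le> 1 * 2 powr (- (r * real_of_int (i0 + int k)))"
        unfolding g_def by (intro mult_right_mono) auto
      also have "\<dots> = 2 powr r * (2 powr (real_of_int i0 + 1)) powr (- r) * q1 ^ k"
        by (simp add: q1_def powr_powr powr_realpow[symmetric] powr_add[symmetric] algebra_simps)
      also have "\<dots> \<le> (2 powr r * \<alpha> powr (- r)) * q1 ^ k"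
        using hi \<alpha> r q1 by (intro mult_right_mono mult_left_mono powr_mono2') auto
      finally show ?thesis .
    qed
    have dn: "g (i0 - int k - 1) \<le> \<alpha> powr (- r) * q2 ^ k" for k
    proof -
      have "g (i0 - int k - 1) \<le> 2 powr real_of_int (i0 - int k - 1) / \<alpha> * 2 powr (- (r * real_of_int (i0 - int k - 1)))"
        unfolding g_def by (intro mult_right_mono) auto
      also have "\<dots> = (2 powr real_of_int i0) powr (1 - r) * q2 ^ k * q2 / \<alpha>"
        by (simp add: q2_def powr_powr powr_realpow[symmetric] powr_add[symmetric] algebra_simps)
      also have "\<dots> \<le> \<alpha> powr (1 - r) * q2 ^ k * 1 / \<alpha>"
        using lo \<alpha> r q2 by (intro divide_right_mono mult_mono powr_mono2) auto
      also have "\<dots> = \<alpha> powr (- r) * q2 ^ k"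
        using \<alpha> by (simp add: powr_diff powr_minus_divide)
      finally show ?thesis .
    qed
    have "(\<Sum>n. ennreal (g (int_decode n))) = (\<Sum>k. ennreal (g (i0 + int k))) + (\<Sum>k. ennreal (g (i0 - int k - 1)))"
      by (rule suminf_int_decode)
    also have "\<dots> \<le> ennreal (2 powr r * \<alpha> powr (- r) / (1 - q1)) + ennreal (\<alpha> powr (- r) / (1 - q2))"
      by (intro add_mono suminf_geometric_le q1 q2 up dn) auto
    also have "\<dots> = ennreal (G * \<alpha> powr (- r))"
      using q1 q2 by (simp add: G_def ennreal_plus[symmetric] algebra_simps del: ennreal_plus)
    finally show "(\<Sum>n. ennreal (min 1 (2 powr real_of_int (int_decode n) / \<alpha>)
        * 2 powr (- (r * real_of_int (int_decode n))))) \<le> ennreal (G * \<alpha> powr (- r))"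
      by (simp add: g_def)
  qed
qed

text \<open>In \<open>lam\<close> the norm of the indicator of the ball cancels against the
  pointwise atom bound and leaves 2^i. The representation holds at almost every point of the
  half-space, hence almost everywhere for every cone measure; exceptional vertices come only from
  the countably many atoms.\<close>

lemma decomp_area_le:
  fixes X :: "(real^'n \<Rightarrow> real) \<Rightarrow> ennreal"
  assumes qB: "ball_qBfs X" and dec: "decomp X c M0 f a cen rad"
    and [measurable]: "f \<in> borel_measurable lebesgue"
  shows "AE x in lebesgue. area f x \<le> (\<Sum>n. ennreal (2 powr real_of_int (int_decode n)) *
     (\<Sum>j. indicator (ball (cen (int_decode n) j) (rad (int_decode n) j)) x))"
proof -
  have atom: "TX_inf_atom X (a i j) (cen i j) (rad i j)" for i j using dec by (simp add: decomp_def)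
  then have "TX_atom X 2 (a i j) (cen i j) (rad i j)" for i j by (simp add: TX_inf_atom_def)
  then have rad: "0 < rad i j" and [measurable]: "a i j \<in> borel_measurable lebesgue" for i j
    by (auto simp: TX_atom_def)
  let ?B = "\<lambda>i j. ball (cen i j) (rad i j)"
  define u where "u i j z = ennreal (cmod (complex_of_real (lam X cen rad i j) * a i j z))" for i j z
  have [measurable]: "u i j \<in> borel_measurable lebesgue" for i j unfolding u_def by measurable
  have fle: "AE z in lebesgue. 0 < snd z \<longrightarrow> ennreal (cmod (f z)) \<le> (\<Sum>n. \<Sum>j. u (int_decode n) j z)"
  proof -
    have "AE z in lebesgue. 0 < snd z \<longrightarrow>
        (\<exists>s. (\<forall>i. (\<lambda>j. complex_of_real (lam X cen rad i j) * a i j z) sums s i) \<and> zsums s (f z))"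
      using dec by (simp add: decomp_def)
    then show ?thesis
    proof (rule eventually_mono, intro impI)
      fix z :: "(real^'n) \<times> real"
      assume "0 < snd z \<longrightarrow> (\<exists>s. (\<forall>i. (\<lambda>j. complex_of_real (lam X cen rad i j) * a i j z) sums s i) \<and> zsums s (f z))"
        and "0 < snd z"
      then obtain s where s: "\<And>i. (\<lambda>j. complex_of_real (lam X cen rad i j) * a i j z) sums s i" "zsums s (f z)"
        by blast
      have "ennreal (cmod (f z)) \<le> (\<Sum>n. ennreal (cmod (s (int_decode n))))" by (rule norm_zsums_le[OF s(2)])
      also have "\<dots> \<le> (\<Sum>n. \<Sum>j. u (int_decode n) j z)"
        unfolding u_def by (intro suminf_le norm_sums_le s(1)) auto
      finally show "ennreal (cmod (f z)) \<le> (\<Sum>n. \<Sum>j. u (int_decode n) j z)" .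
    qed
  qed
  have sub: "area f x \<le> (\<Sum>n. \<Sum>j. L2n (cone_measure x) (u (int_decode n) j))" for x
  proof -
    have "area f x \<le> L2n (cone_measure x) (\<lambda>z. \<Sum>n. \<Sum>j. u (int_decode n) j z)"
      unfolding area_eq_L2n[OF \<open>f \<in> borel_measurable lebesgue\<close>]
      by (intro L2n_mono_AE AE_cone_measureI fle)
    also have "\<dots> \<le> (\<Sum>n. L2n (cone_measure x) (\<lambda>z. \<Sum>j. u (int_decode n) j z))"
      by (rule L2n_suminf_le) measurable
    also have "\<dots> \<le> (\<Sum>n. \<Sum>j. L2n (cone_measure x) (u (int_decode n) j))"
      by (intro suminf_le L2n_suminf_le summableI) measurable
    finally show ?thesis .
  qed
  have "AE x in lebesgue. L2n (cone_measure x) (u i j) \<le> ennreal (2 powr real_of_int i) * indicator (?B i j) x" for i j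
    using TX_inf_atom_area_le[OF qB atom[of i j]]
  proof (rule eventually_mono)
    fix x assume le: "area (a i j) x \<le> indicator (?B i j) x / X (indicator (?B i j))"
    obtain q where q: "0 < q" "X (indicator (?B i j)) = ennreal q"
      using qBfs_ball_finite[OF qB rad, of "cen i j" i j] qBfs_ball_pos[OF qB rad, of "cen i j" i j]
      by (cases "X (indicator (?B i j))") auto
    have lam: "lam X cen rad i j = 2 powr real_of_int i * q"
      using q by (simp add: lam_def)
    have "u i j = (\<lambda>z. ennreal (2 powr real_of_int i * q) * ennreal (cmod (a i j z)))"
      using q(1) by (auto simp: u_def lam norm_mult ennreal_mult)
    then have "L2n (cone_measure x) (u i j) = ennreal (2 powr real_of_int i * q) * L2n (cone_measure x) (\<lambda>z. ennreal (cmod (a i j z)))"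
      by (simp add: L2n_cmult)
    also have "\<dots> = ennreal (2 powr real_of_int i * q) * area (a i j) x"
      by (simp add: area_eq_L2n)
    also have "\<dots> \<le> ennreal (2 powr real_of_int i * q) * (indicator (?B i j) x / ennreal q)"
      using le q by (intro mult_left_mono) auto
    also have "\<dots> = ennreal (2 powr real_of_int i) * indicator (?B i j) x"
      using q(1) divide_ennreal[of 1 q] by (auto simp: indicator_def ennreal_mult[symmetric])
    finally show "L2n (cone_measure x) (u i j) \<le> ennreal (2 powr real_of_int i) * indicator (?B i j) x" .
  qed
  then have "AE x in lebesgue. \<forall>i j. L2n (cone_measure x) (u i j) \<le> ennreal (2 powr real_of_int i) * indicator (?B i j) x"
    by (simp add: AE_all_countable)
  then show ?thesis
  proof (rule eventually_mono)
    fix x assume *: "\<forall>i j. L2n (cone_measure x) (u i j) \<le> ennreal (2 powr real_of_int i) * indicator (?B i j) x"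
    have "area f x \<le> (\<Sum>n. \<Sum>j. L2n (cone_measure x) (u (int_decode n) j))" by (rule sub)
    also have "\<dots> \<le> (\<Sum>n. \<Sum>j. ennreal (2 powr real_of_int (int_decode n)) * indicator (?B (int_decode n) j) x)"
      using * by (intro suminf_le) auto
    finally show "area f x \<le> (\<Sum>n. ennreal (2 powr real_of_int (int_decode n)) *
       (\<Sum>j. indicator (ball (cen (int_decode n) j) (rad (int_decode n) j)) x))" by simp
  qed
qed

lemma HLmax_concentric_ball_ge:
  fixes x :: "real^'n"
  assumes "0 < \<rho>" "0 < c" "c \<le> 1" "x \<in> ball y \<rho>"
  shows "ennreal (c ^ CARD('n)) \<le> HLmax (indicator (ball y (c * \<rho>))) x"
proof (rule HLmax_indicator_ge[OF assms(1,4)])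
  have "c * \<rho> \<le> \<rho>" using assms by (simp add: mult_le_cancel_right1)
  then have "ball y (c * \<rho>) \<inter> ball y \<rho> = ball y (c * \<rho>)" by auto
  then show "ennreal (c ^ CARD('n)) * emeasure lebesgue (ball y \<rho>) \<le> emeasure lebesgue (ball y (c * \<rho>) \<inter> ball y \<rho>)"
    using assms by (simp add: emeasure_ball ennreal_mult[symmetric] power_mult_distrib mult_ac)
qed simp

text \<open>For r < 1 the norm of X^(1/r) involves the power 1/r of the counting function S of a
  level, which can exceed S by far, so \<open>dval\<close> does not control it directly. The maximal
  bound exchanges the balls for the shrunken ones, of which at most \<open>M0\<close> meet at a
  point; their counting function is therefore bounded by a multiple of the indicator of the union,
  and this indicator is at most S.\<close>

lemma decomp_level_le:
  fixes X :: "(real^'n \<Rightarrow> real) \<Rightarrow> ennreal"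
  assumes qB: "ball_qBfs X" and K: "maximal_bound X r (c ^ CARD('n)) K" "0 < K"
    and r: "0 < r" and c: "0 < c" "c \<le> 1" and dec: "decomp X c M0 f a cen rad"
  shows "Xepow X (1 / r) (\<lambda>x. \<Sum>j. indicator (ball (cen i j) (rad i j)) x)
    \<le> epowr (ennreal (K * (real M0 + 1) powr (1 / r) * 2 powr (- real_of_int i)) * dval X cen rad) r"
proof -
  have "TX_atom X 2 (a i j) (cen i j) (rad i j)" for j using dec by (simp add: decomp_def TX_inf_atom_def)
  then have rad: "0 < rad i j" for j by (auto simp: TX_atom_def)
  let ?B = "\<lambda>j. ball (cen i j) (rad i j)"
  let ?b = "\<lambda>j. ball (cen i j) (c * rad i j)"
  \<comment> \<open>The added 1 keeps the constant positive also for \<open>M0 = 0\<close>, as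
    \<open>Xe_cmult\<close> asks.\<close>
  define L where "L = (real M0 + 1) powr (1 / r)"
  have L: "0 < L" by (simp add: L_def)
  have "Xe X (\<lambda>x. epowr (\<Sum>j. indicator (?B j) x) (1 / r)) \<le> ennreal K * Xe X (\<lambda>x. epowr (\<Sum>j. indicator (?b j) x) (1 / r))"
    by (rule maximal_boundD[OF K(1)]) (auto intro!: HLmax_concentric_ball_ge rad c)
  also have "Xe X (\<lambda>x. epowr (\<Sum>j. indicator (?b j) x) (1 / r)) \<le> Xe X (\<lambda>x. ennreal L * indicator (\<Union>j. ?B j) x)"
  proof (rule Xe_mono[OF qB])
    show "AE x in lebesgue. epowr (\<Sum>j. indicator (?b j) x) (1 / r) \<le> ennreal L * indicator (\<Union>j. ?B j) x"
    proof (rule AE_I2)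
      fix x
      show "epowr (\<Sum>j. indicator (?b j) x) (1 / r) \<le> ennreal L * indicator (\<Union>j. ?B j) x"
      proof (cases "x \<in> (\<Union>j. ?B j)")
        case True
        have "(\<Sum>j. indicator (?b j) x :: ennreal) \<le> of_nat M0" using dec by (simp add: decomp_def)
        also have "\<dots> \<le> ennreal (real M0 + 1)" by (simp add: ennreal_of_nat_eq_real_of_nat ennreal_leI)
        finally have "(\<Sum>j. indicator (?b j) x :: ennreal) \<le> ennreal (real M0 + 1)" .
        from epowr_mono[OF _ this, of "1 / r"] show ?thesis
          using True r by (simp add: L_def epowr_ennreal del: ennreal_plus)
      next
        case False
        have "?b j \<subseteq> ?B j" for j
          using c rad[of j] by (intro subset_ball) (simp add: mult_le_cancel_right1)
        then have "x \<notin> ?b j" for j using False by blast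
        then show ?thesis by simp
      qed
    qed
  qed measurable
  also have "\<dots> = ennreal L * X (indicator (\<Union>j. ?B j))"
    using L by (subst Xe_cmult[OF qB]) (auto simp: Xe_indicator intro!: borel_measurable_indicator)
  also have "X (indicator (\<Union>j. ?B j)) \<le> Xe X (\<lambda>x. \<Sum>j. indicator (?B j) x)"
    unfolding Xe_indicator[symmetric]
  proof (rule Xe_mono[OF qB])
    show "AE x in lebesgue. indicator (\<Union>j. ?B j) x \<le> (\<Sum>j. indicator (?B j) x :: ennreal)"
    proof (rule AE_I2)
      fix x
      show "indicator (\<Union>j. ?B j) x \<le> (\<Sum>j. indicator (?B j) x :: ennreal)"
      proof (cases "x \<in> (\<Union>j. ?B j)")
        case True
        then obtain j where "x \<in> ?B j" by blast
        then have "1 = (\<Sum>j\<in>{j}. indicator (?B j) x :: ennreal)" by simp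
        also have "\<dots> \<le> (\<Sum>j. indicator (?B j) x)" by (intro sum_le_suminf) auto
        finally show ?thesis using True by simp
      qed simp
    qed
  qed measurable
  also have "\<dots> \<le> ennreal (2 powr (- real_of_int i)) * dval X cen rad"
  proof -
    have "Xe X (\<lambda>x. \<Sum>j. indicator (?B j) x) = ennreal (2 powr (- real_of_int i)) * (ennreal (2 powr real_of_int i) * Xe X (\<lambda>x. \<Sum>j. indicator (?B j) x))"
      by (simp add: mult.assoc[symmetric] ennreal_mult[symmetric] powr_add[symmetric])
    also have "\<dots> \<le> ennreal (2 powr (- real_of_int i)) * dval X cen rad"
      unfolding dval_def by (intro mult_left_mono SUP_upper) auto
    finally show ?thesis .
  qed
  finally have "Xe X (\<lambda>x. epowr (\<Sum>j. indicator (?B j) x) (1 / r))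
     \<le> ennreal K * (ennreal L * (ennreal (2 powr (- real_of_int i)) * dval X cen rad))"
    by (auto simp: mult_left_mono)
  also have "\<dots> = ennreal (K * L * 2 powr (- real_of_int i)) * dval X cen rad"
    using L K(2) by (simp add: ennreal_mult mult.assoc)
  finally show ?thesis
    unfolding Xepow_def L_def using r by (simp add: epowr_mono)
qed

text \<open>Instead of splitting f into high and low levels at height \<alpha>, one linear bound is
  used for the indicator of the level set, with weights min(1, 2^i / \<alpha>); it is summed in the
  normed space X^(1/r). The constant is fixed before f and its decomposition.\<close>

lemma decomp_imp_WTnorm_le:
  fixes X :: "(real^'n \<Rightarrow> real) \<Rightarrow> ennreal"
  assumes qB: "ball_qBfs X" and FS: "FS X pm" and r: "0 < r" "r < pm" "r < 1"
    and Bf: "ball_Bfs (Xpow X (1 / r))" and c: "0 < c" "c \<le> 1"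
  obtains C where "0 < C" "\<And>f a cen rad. f \<in> borel_measurable lebesgue \<Longrightarrow> decomp X c M0 f a cen rad \<Longrightarrow>
    WTnorm X f \<le> ennreal C * dval X cen rad"
proof -
  obtain K where K: "0 < K" "maximal_bound X r (c ^ CARD('n)) K"
    using FS_maximal_bound[OF qB FS r(1,2), of "c ^ CARD('n)"] c by auto
  obtain G where G: "0 < G" "\<And>\<alpha>. 0 < \<alpha> \<Longrightarrow> (\<Sum>n. ennreal (min 1 (2 powr real_of_int (int_decode n) / \<alpha>)
        * 2 powr (- (r * real_of_int (int_decode n))))) \<le> ennreal (G * \<alpha> powr (- r))"
    by (rule dyadic_weight_sum[OF r(1,3)]) blast
  define A where "A = K * (real M0 + 1) powr (1 / r)"
  have A: "0 < A" using K by (simp add: A_def)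
  show thesis
  proof (rule that)
    show "0 < A * G powr (1 / r)" using A G by simp
    fix f :: "(real^'n) \<times> real \<Rightarrow> complex" and a cen rad
    assume [measurable]: "f \<in> borel_measurable lebesgue" and dec: "decomp X c M0 f a cen rad"
    then obtain d where d: "0 \<le> d" "dval X cen rad = ennreal d"
      unfolding decomp_def by (cases "dval X cen rad") auto
    define S :: "int \<Rightarrow> real^'n \<Rightarrow> ennreal" where "S i x = (\<Sum>j. indicator (ball (cen i j) (rad i j)) x)" for i x
    have [measurable]: "S i \<in> borel_measurable lebesgue" for i unfolding S_def by measurable
    have S01: "S i x = 0 \<or> 1 \<le> S i x" for i x
    proof (cases "\<exists>j. x \<in> ball (cen i j) (rad i j)")
      case True
      then obtain j where "x \<in> ball (cen i j) (rad i j)" by blast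
      then have "1 = (\<Sum>j\<in>{j}. indicator (ball (cen i j) (rad i j)) x :: ennreal)" by simp
      also have "\<dots> \<le> S i x" unfolding S_def by (intro sum_le_suminf) auto
      finally show ?thesis by simp
    qed (auto simp: S_def)
    have Wqb: "ball_qBfs (Xpow X (1 / r))" using Bf by (simp add: ball_Bfs_def)
    have XS: "Xe (Xpow X (1 / r)) (S i) \<le> ennreal ((A * d) powr r * 2 powr (- (r * real_of_int i)))" for i
    proof -
      have "Xe (Xpow X (1 / r)) (S i) \<le> epowr (ennreal (A * 2 powr (- real_of_int i)) * ennreal d) r"
        using decomp_level_le[OF qB K(2,1) r(1) c dec, of i] r(1) d(2)
        by (simp add: Xepow_eq_Xe_Xpow S_def[abs_def] A_def)
      also have "\<dots> = ennreal ((A * d) powr r * 2 powr (- (r * real_of_int i)))"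
        using A d(1) by (simp add: ennreal_mult[symmetric] epowr_ennreal powr_mult powr_powr mult_ac)
      finally show ?thesis .
    qed
    show "WTnorm X f \<le> ennreal (A * G powr (1 / r)) * dval X cen rad"
      unfolding WTnorm_def WX_def
    proof (rule SUP_least)
      fix \<alpha> :: real assume "\<alpha> \<in> {0<..}"
      then have \<alpha>: "0 < \<alpha>" by simp
      define E where "E = {x. ennreal \<alpha> < area f x}"
      have [measurable]: "E \<in> sets lebesgue"
        unfolding E_def by (intro open_imp_lebesgue open_area_superlevel) measurable
      define w where "w i = min 1 (2 powr real_of_int i / \<alpha>)" for i
      have w: "0 < w i" for i using \<alpha> by (simp add: w_def)
      have ind: "AE x in lebesgue. indicator E x \<le> (\<Sum>n. ennreal (w (int_decode n)) * S (int_decode n) x)"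
        using decomp_area_le[OF qB dec] 
      proof (rule eventually_mono)
        fix x assume le: "area f x \<le> (\<Sum>n. ennreal (2 powr real_of_int (int_decode n)) *
           (\<Sum>j. indicator (ball (cen (int_decode n) j) (rad (int_decode n) j)) x))"
        show "indicator E x \<le> (\<Sum>n. ennreal (w (int_decode n)) * S (int_decode n) x)"
        proof (cases "x \<in> E")
          case True
          show ?thesis
          \<comment> \<open>Either a level of weight 1 has a ball containing \<open>x\<close>, and
            its term alone is at least 1; or every nonzero term equals 2^i S_i / \<alpha>, and these
            add up to at least 1 because the area function exceeds \<alpha>.\<close>
          proof (cases "\<exists>n. w (int_decode n) = 1 \<and> S (int_decode n) x \<noteq> 0")
            case True
            then obtain n where n: "w (int_decode n) = 1" "S (int_decode n) x \<noteq> 0" by blast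
            then have "1 \<le> (\<Sum>n\<in>{n}. ennreal (w (int_decode n)) * S (int_decode n) x)"
              using S01[of "int_decode n" x] by simp
            also have "\<dots> \<le> (\<Sum>n. ennreal (w (int_decode n)) * S (int_decode n) x)"
              by (intro sum_le_suminf) auto
            finally show ?thesis using \<open>x \<in> E\<close> by simp
          next
            case False
            then have eq: "ennreal (w (int_decode n)) * S (int_decode n) x
              = ennreal (1 / \<alpha>) * (ennreal (2 powr real_of_int (int_decode n)) * S (int_decode n) x)" for n
            proof (cases "S (int_decode n) x = 0")
              case ne: False
              then have "w (int_decode n) = 2 powr real_of_int (int_decode n) / \<alpha>"
                using False unfolding w_def by (metis min_def)
              then show ?thesis using \<alpha> by (simp add: mult.assoc[symmetric] ennreal_mult[symmetric])
            qed simp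
            have "ennreal \<alpha> \<le> (\<Sum>n. ennreal (2 powr real_of_int (int_decode n)) * S (int_decode n) x)"
              using le \<open>x \<in> E\<close> unfolding E_def S_def by (auto intro: less_imp_le less_le_trans)
            then have "ennreal (1 / \<alpha>) * ennreal \<alpha> \<le> ennreal (1 / \<alpha>) * (\<Sum>n. ennreal (2 powr real_of_int (int_decode n)) * S (int_decode n) x)"
              by (rule mult_left_mono) simp
            then show ?thesis using \<alpha> \<open>x \<in> E\<close> by (simp add: eq ennreal_mult[symmetric])
          qed
        qed simp
      qed measurable
      \<comment> \<open>The power r leads from X to the normed space X^(1/r), since powers do not
        change an indicator.\<close>
      have "epowr (X (indicator E)) r = Xe (Xpow X (1 / r)) (indicator E)"
        using Xepow_eq_Xe_Xpow[of "1 / r" X "indicator E"] r(1)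
        by (simp add: Xepow_def epowr_indicator Xe_indicator)
      also have "\<dots> \<le> Xe (Xpow X (1 / r)) (\<lambda>x. \<Sum>n. ennreal (w (int_decode n)) * S (int_decode n) x)"
        by (rule Xe_mono[OF Wqb _ _ ind]) measurable
      also have "\<dots> \<le> (\<Sum>n. Xe (Xpow X (1 / r)) (\<lambda>x. ennreal (w (int_decode n)) * S (int_decode n) x))"
        by (rule Xe_suminf_le[OF Bf]) measurable
      also have "\<dots> = (\<Sum>n. ennreal (w (int_decode n)) * Xe (Xpow X (1 / r)) (S (int_decode n)))"
        by (intro suminf_cong Xe_cmult[OF Wqb _ w]) measurable
      also have "\<dots> \<le> (\<Sum>n. ennreal ((A * d) powr r) * ennreal (w (int_decode n) * 2 powr (- (r * real_of_int (int_decode n)))))"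
      proof (intro suminf_le)
        fix n
        have "ennreal (w (int_decode n)) * Xe (Xpow X (1 / r)) (S (int_decode n))
           \<le> ennreal (w (int_decode n)) * ennreal ((A * d) powr r * 2 powr (- (r * real_of_int (int_decode n))))"
          by (intro mult_left_mono XS) simp
        then show "ennreal (w (int_decode n)) * Xe (Xpow X (1 / r)) (S (int_decode n))
          \<le> ennreal ((A * d) powr r) * ennreal (w (int_decode n) * 2 powr (- (r * real_of_int (int_decode n))))"
          using w[of "int_decode n"] by (simp add: ennreal_mult[symmetric] mult_ac)
      qed auto
      also have "\<dots> = ennreal ((A * d) powr r) * (\<Sum>n. ennreal (w (int_decode n) * 2 powr (- (r * real_of_int (int_decode n)))))"
        by simp
      also have "\<dots> \<le> ennreal ((A * d) powr r) * ennreal (G * \<alpha> powr (- r))"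
        unfolding w_def by (intro mult_left_mono G(2) \<alpha>) simp
      also have "\<dots> = ennreal ((A * d * G powr (1 / r) / \<alpha>) powr r)"
        using A d(1) G(1) \<alpha> r(1)
        by (simp add: ennreal_mult[symmetric] powr_mult powr_divide powr_powr powr_minus_divide)
      finally have "epowr (X (indicator E)) r \<le> ennreal ((A * d * G powr (1 / r) / \<alpha>) powr r)" .
      from epowr_mono[OF _ this, of "1 / r"]
      have "X (indicator E) \<le> ennreal (A * d * G powr (1 / r) / \<alpha>)"
        using r(1) A d(1) G(1) \<alpha> by (simp add: epowr_epowr epowr_ennreal powr_powr)
      then have "ennreal \<alpha> * X (indicator E) \<le> ennreal \<alpha> * ennreal (A * d * G powr (1 / r) / \<alpha>)"
        by (rule mult_left_mono) simp
      also have "\<dots> = ennreal (A * G powr (1 / r)) * dval X cen rad"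
        using A d G(1) \<alpha> by (simp add: ennreal_mult[symmetric] mult_ac)
      finally show "ennreal \<alpha> * X (indicator {x. ennreal \<alpha> < area f x}) \<le> ennreal (A * G powr (1 / r)) * dval X cen rad"
        by (simp add: E_def)
    qed
  qed
qed

section \<open>Tents over open sets\<close>

lemma closed_imp_lebesgue: "closed S \<Longrightarrow> S \<in> sets lebesgue"
  by (metis borel_closed sets_completionI_sets sets_lborel)

definition tent_over :: "(real^'n) set \<Rightarrow> ((real^'n) \<times> real) set" where
  "tent_over U = {z. 0 < snd z \<and> ball (fst z) (snd z) \<subseteq> U}"

text \<open>The density threshold is half the relative volume of a ball of radius \<open>t / 64\<close> in one of radius \<open>t\<close>;
  such balls appear in \<open>cone_view\<close>.\<close>

definition thick :: "(real^'n) set \<Rightarrow> (real^'n) set" where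
  "thick V = \<Union>{ball y t | y t. 0 < t \<and>
     ennreal (1 / (2 * 64 ^ CARD('n))) * emeasure lebesgue (ball y t) < emeasure lebesgue (V \<inter> ball y t)}"

lemma open_thick: "open (thick V)"
  unfolding thick_def by (rule open_Union) auto

lemma thick_mono:
  fixes V W :: "(real^'n) set"
  assumes "V \<subseteq> W" "W \<in> sets lebesgue"
  shows "thick V \<subseteq> thick W"
proof -
  have le: "emeasure lebesgue (V \<inter> ball y t) \<le> emeasure lebesgue (W \<inter> ball y t)" for y t
    using assms by (intro emeasure_mono) auto
  show ?thesis
  proof
    fix x assume "x \<in> thick V"
    then obtain y t where "x \<in> ball y t" "0 < t"
      "ennreal (1 / (2 * 64 ^ CARD('n))) * emeasure lebesgue (ball y t) < emeasure lebesgue (V \<inter> ball y t)"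
      unfolding thick_def by blast
    then show "x \<in> thick W" unfolding thick_def using less_le_trans[OF _ le] by blast
  qed
qed

lemma HLmax_thick_ge:
  fixes V :: "(real^'n) set"
  assumes "V \<in> sets lebesgue" "x \<in> thick V"
  shows "ennreal (1 / (2 * 64 ^ CARD('n))) \<le> HLmax (indicator V) x"
proof -
  obtain y t where "x \<in> ball y t" "0 < t"
    "ennreal (1 / (2 * 64 ^ CARD('n))) * emeasure lebesgue (ball y t) < emeasure lebesgue (V \<inter> ball y t)"
    using assms(2) unfolding thick_def by blast
  then show ?thesis by (intro HLmax_indicator_ge[OF _ _ assms(1)]) auto
qed

lemma tent_over_lebesgue [measurable]: "tent_over (U :: (real^'n) set) \<in> sets lebesgue"
proof -
  have "tent_over U = {z. 0 < snd z} - (\<Union>x\<in>-U. cone x)"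
    unfolding tent_over_def cone_def by (auto simp: dist_commute subset_iff)
  moreover have "open {z :: (real^'n) \<times> real. 0 < snd z}"
    by (intro open_Collect_less continuous_intros)
  moreover have "open (\<Union>x\<in>-U. cone x)" by (intro open_UN) (auto intro: open_cone)
  ultimately show ?thesis by (auto intro!: sets.Diff open_imp_lebesgue)
qed

lemma tent_over_mono: "U \<subseteq> V \<Longrightarrow> tent_over U \<subseteq> tent_over V"
  unfolding tent_over_def by auto

lemma open_tent: "open (tent c \<rho>)"
  unfolding tent_def by (intro open_Collect_conj open_Collect_less continuous_intros)

lemma tent_lebesgue [measurable]: "tent c \<rho> \<in> sets lebesgue"
  by (rule open_imp_lebesgue[OF open_tent])

text \<open>A finite net of the compact unit sphere. Its cardinality is the dimensional constant of
  the pointwise bound. The vector 0, which stands for the axis of the cone, fits every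
  direction.\<close>

lemma finite_directions:
  obtains E :: "(real^'n) set" where "finite E" "E \<noteq> {}"
    "\<And>u. \<exists>e\<in>E. norm e = 1 \<and> norm (u - norm u *\<^sub>R e) \<le> norm u / 4"
proof -
  let ?S = "sphere (0::real^'n) 1"
  have "?S \<subseteq> (\<Union>e\<in>?S. ball e (1 / 4))" by force
  then obtain E where E: "E \<subseteq> ?S" "finite E" "?S \<subseteq> (\<Union>e\<in>E. ball e (1 / 4))"
    using compactE_image[OF compact_sphere, of ?S "\<lambda>e. ball e (1 / 4)"] by (metis open_ball)
  obtain v :: "real^'n" where v: "norm v = 1" using vector_choose_size[of 1] by auto
  have dir: "\<exists>e\<in>E. norm e = 1 \<and> norm (u - e) \<le> 1 / 4" if "norm u = 1" for u
  proof -
    have "u \<in> (\<Union>e\<in>E. ball e (1 / 4))" by (rule subsetD[OF E(3)]) (simp add: that)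
    then show ?thesis using E(1) by (force simp: dist_norm norm_minus_commute)
  qed
  show thesis
  proof (rule that[OF E(2)])
    show "E \<noteq> {}" using dir[OF v] by auto
    fix u :: "real^'n"
    show "\<exists>e\<in>E. norm e = 1 \<and> norm (u - norm u *\<^sub>R e) \<le> norm u / 4"
    proof (cases "u = 0")
      case True
      then show ?thesis using dir[OF v] by auto
    next
      case False
      then obtain e where e: "e \<in> E" "norm e = 1" "norm ((1 / norm u) *\<^sub>R u - e) \<le> 1 / 4"
        using dir[of "(1 / norm u) *\<^sub>R u"] by auto
      have "u - norm u *\<^sub>R e = norm u *\<^sub>R ((1 / norm u) *\<^sub>R u - e)"
        using False by (simp add: scaleR_diff_right)
      then have "norm (u - norm u *\<^sub>R e) = norm u * norm ((1 / norm u) *\<^sub>R u - e)" by simp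
      also have "\<dots> \<le> norm u * (1 / 4)" using e(3) by (intro mult_left_mono) auto
      finally show ?thesis using e(1,2) by auto
    qed
  qed
qed

text \<open>Moving the vertex from x by about t0 / 8 in direction e keeps the sector visible. Put v
  = w - x and u = y - x. If |u| \<le> |v|, the triangle inequality and 2 |v| < t0 / 2 suffice;
  otherwise |v|^2 is at most twice the inner product of v and u, so y is no farther from w than from
  x.\<close>

lemma cone_view:
  fixes x y w e :: "real^'n"
  assumes e: "norm e = 1" and t0: "0 < t0" "t0 / 2 \<le> t"
    and w: "w \<in> ball (x + (t0 / 8) *\<^sub>R e) (t0 / 64)"
    and y: "dist x y < t" "norm ((y - x) - norm (y - x) *\<^sub>R e) \<le> norm (y - x) / 4"
  shows "dist w y < t"
proof -
  define u v h where "u = y - x" and "v = w - x" and "h = v - (t0 / 8) *\<^sub>R e"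
  have v: "v = (t0 / 8) *\<^sub>R e + h" by (simp add: h_def)
  have h: "norm h < t0 / 64"
    using w by (simp add: h_def v_def dist_norm norm_minus_commute algebra_simps)
  have nv: "norm v \<le> 9 / 64 * t0"
    using norm_triangle_ineq[of "(t0 / 8) *\<^sub>R e" h] h e t0 by (simp add: v)
  have ut: "norm u < t" using y(1) by (simp add: u_def dist_norm norm_minus_commute)
  have wy: "dist w y = norm (v - u)" by (simp add: u_def v_def dist_norm)
  show ?thesis
  proof (cases "norm u \<le> norm v")
    case True
    have "norm (v - u) \<le> norm v + norm u" by (rule norm_triangle_ineq4)
    then show ?thesis unfolding wy using True nv t0 by linarith
  next
    case False
    have "\<bar>e \<bullet> (u - norm u *\<^sub>R e)\<bar> \<le> norm u / 4"
      using Cauchy_Schwarz_ineq2[of e "u - norm u *\<^sub>R e"] y(2) e by (simp add: u_def)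
    moreover have "e \<bullet> (u - norm u *\<^sub>R e) = e \<bullet> u - norm u"
      using e by (simp add: inner_diff_right dot_square_norm)
    ultimately have eu: "3 / 4 * norm u \<le> e \<bullet> u" by linarith
    have "\<bar>h \<bullet> u\<bar> \<le> norm h * norm u" by (rule Cauchy_Schwarz_ineq2)
    also have "\<dots> \<le> t0 / 64 * norm u" using h by (intro mult_right_mono) auto
    finally have hu: "- (t0 / 64 * norm u) \<le> h \<bullet> u" by linarith
    have "t0 / 8 * (3 / 4 * norm u) \<le> t0 / 8 * (e \<bullet> u)" using eu t0 by (intro mult_left_mono) auto
    with hu have vu: "5 / 64 * t0 * norm u \<le> v \<bullet> u" unfolding v by (simp add: inner_add_left)
    have "norm v * norm v \<le> 9 / 64 * t0 * norm u"
      using nv False t0 by (intro mult_mono) auto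
    moreover have "0 \<le> t0 * norm u" using t0 by simp
    \<comment> \<open>The constants 1/4, 1/8 and 1/64 meet here: 9/64 on the left against 10/64 on
      the right.\<close>
    ultimately have "norm v * norm v \<le> 2 * (v \<bullet> u)" using vu by linarith
    moreover have "(norm (v - u))\<^sup>2 = norm v * norm v - 2 * (v \<bullet> u) + (norm u)\<^sup>2"
      by (simp add: power2_norm_eq_inner inner_diff_left inner_diff_right inner_commute flip: power2_eq_square)
    ultimately have "(norm (v - u))\<^sup>2 \<le> (norm u)\<^sup>2" by linarith
    then have "norm (v - u) \<le> norm u" by (rule power2_le_imp_le) simp
    then show ?thesis unfolding wy using ut by linarith
  qed
qed

text \<open>A point outside the tent over \<open>thick V\<close> sees mostly points outside \<open>V\<close>. Among the points of
  a narrow sector of the cone at \<open>x\<close>, the one of almost smallest height therefore provides a vertex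
  \<open>w \<notin> V\<close> near \<open>x\<close> whose cone contains the whole sector.\<close>

lemma sector_integral_le:
  fixes f :: "(real^'n) \<times> real \<Rightarrow> complex" and x e :: "real^'n"
  assumes [measurable]: "f \<in> borel_measurable lebesgue" and e: "norm e = 1"
    and V: "V = {x. \<alpha> < area f x}" and \<tau>: "0 < \<tau>"
    and D: "D = {z \<in> cone x - tent_over (thick V).
       norm ((fst z - x) - norm (fst z - x) *\<^sub>R e) \<le> norm (fst z - x) / 4 \<and> \<tau> \<le> snd z}"
  shows "(\<integral>\<^sup>+z. indicator D z * ennreal ((cmod (f z))\<^sup>2 / snd z ^ (CARD('n) + 1)) \<partial>lebesgue) \<le> \<alpha>\<^sup>2"
proof (cases "D = {}")
  case False
  \<comment> \<open>Heights in \<open>D\<close> are at least \<tau>, so the infimum is positive and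
    some z0 lies below twice the infimum. Every point of \<open>D\<close> is then at least half as
    high as z0, which is what \<open>cone_view\<close> requires.\<close>
  define s where "s = Inf (snd ` D)"
  have bdd: "bdd_below (snd ` D)" by (rule bdd_belowI[of _ \<tau>]) (auto simp: D)
  have "\<tau> \<le> s" unfolding s_def using False by (intro cInf_greatest) (auto simp: D)
  then have s: "0 < s" using \<tau> by simp
  then have "Inf (snd ` D) < 2 * s" by (simp add: s_def)
  then obtain z0 where z0: "z0 \<in> D" "snd z0 < 2 * s"
    using False cInf_lessD[of "snd ` D" "2 * s"] by auto
  define t0 where "t0 = snd z0"
  have t0: "0 < t0" using z0 by (simp add: D cone_def t0_def)
  have low: "t0 / 2 \<le> snd z" if "z \<in> D" for z
    using cInf_lower[OF imageI[OF that] bdd] z0(2) by (simp add: s_def t0_def)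
  let ?Y = "ball (fst z0) t0"
  let ?W = "ball (x + (t0 / 8) *\<^sub>R e) (t0 / 64)"
  have see: "dist w (fst z) < snd z" if "z \<in> D" "w \<in> ?W" for z w
    by (rule cone_view[OF e t0 low[OF that(1)] that(2)]) (use that(1) in \<open>auto simp: D cone_def\<close>)
  have WY: "?W \<subseteq> ?Y" using see[OF z0(1)] by (auto simp: t0_def dist_commute)
  have [measurable]: "V \<in> sets lebesgue"
    unfolding V by (intro open_imp_lebesgue open_area_superlevel) measurable
  \<comment> \<open>If V exceeded the threshold density in \<open>?Y\<close>, all of
    \<open>?Y\<close> would belong to \<open>thick V\<close>, and z0 to the tent over it.\<close>
  have "\<not> ?Y \<subseteq> thick V" using z0(1) t0 by (auto simp: D tent_over_def t0_def)
  then have small: "emeasure lebesgue (V \<inter> ?Y) \<le> ennreal (1 / (2 * 64 ^ CARD('n))) * emeasure lebesgue ?Y"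
    unfolding thick_def using t0 not_less by blast
  have "\<not> ?W \<subseteq> V"
  proof
    assume "?W \<subseteq> V"
    then have "emeasure lebesgue ?W \<le> emeasure lebesgue (V \<inter> ?Y)"
      using WY by (intro emeasure_mono) auto
    also note small
    finally have le: "emeasure lebesgue ?W \<le> ennreal (1 / (2 * 64 ^ CARD('n))) * emeasure lebesgue ?Y" .
    define \<nu> where "\<nu> = unit_ball_vol (real CARD('n)) * t0 ^ CARD('n)"
    have "0 < unit_ball_vol (real CARD('n))" by simp
    then have \<nu>: "0 < \<nu>" using t0 by (simp add: \<nu>_def)
    from le have "\<nu> / 64 ^ CARD('n) \<le> 1 / (2 * 64 ^ CARD('n)) * \<nu>"
      using t0 \<nu> by (simp add: emeasure_ball power_divide \<nu>_def[symmetric] ennreal_mult[symmetric])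
    with \<nu> show False by (simp add: field_simps)
  qed
  then obtain w where w: "w \<in> ?W" "w \<notin> V" by blast
  have "(\<integral>\<^sup>+z. indicator D z * ennreal ((cmod (f z))\<^sup>2 / snd z ^ (CARD('n) + 1)) \<partial>lebesgue)
     \<le> (\<integral>\<^sup>+z. indicator (cone w) z * ennreal ((cmod (f z))\<^sup>2 / snd z ^ (CARD('n) + 1)) \<partial>lebesgue)"
  proof (intro nn_integral_mono mult_right_mono)
    fix z
    have "D \<subseteq> cone w" using see[OF _ w(1)] by (auto simp: cone_def D)
    then show "indicator D z \<le> (indicator (cone w) z :: ennreal)" by (auto simp: indicator_def)
  qed simp
  also have "\<dots> \<le> \<alpha>\<^sup>2"
    using w(2) unfolding V by (simp add: not_less area_def epowr_half_le_iff)
  finally show ?thesis .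
qed simp

text \<open>The sectors cover the part of the cone outside the tent and each contributes at most
  \<alpha>^2, whence the square root of their number. The form with a function g that is dominated
  by f and vanishes on the tent serves both the remainder outside all tents and the single
  atoms.\<close>

lemma area_off_tent_le:
  fixes f :: "(real^'n) \<times> real \<Rightarrow> complex" and x :: "real^'n" and E :: "(real^'n) set"
  assumes [measurable]: "f \<in> borel_measurable lebesgue" and E: "finite E"
    "\<And>u. \<exists>e\<in>E. norm e = 1 \<and> norm (u - norm u *\<^sub>R e) \<le> norm u / 4"
    and g: "\<And>z. z \<in> tent_over (thick {x. \<alpha> < area f x}) \<Longrightarrow> g z = 0"
      "\<And>z. cmod (g z) \<le> cmod (f z)"
  shows "area g x \<le> ennreal (sqrt (real (card E))) * \<alpha>"
proof -
  define V where "V = {x. \<alpha> < area f x}"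
  define h where "h z = ennreal ((cmod (f z))\<^sup>2 / snd z ^ (CARD('n) + 1))" for z
  have [measurable]: "h \<in> borel_measurable lebesgue" unfolding h_def by measurable
  define Q where "Q e = {z \<in> cone x - tent_over (thick V).
       norm ((fst z - x) - norm (fst z - x) *\<^sub>R e) \<le> norm (fst z - x) / 4}" for e
  define Qm where "Qm e m = {z \<in> cone x - tent_over (thick V).
       norm ((fst z - x) - norm (fst z - x) *\<^sub>R e) \<le> norm (fst z - x) / 4 \<and> 1 / real (Suc m) \<le> snd z}" for e m
  have Qm_eq: "Qm e m = (cone x - tent_over (thick V)) \<inter>
     ({z. norm ((fst z - x) - norm (fst z - x) *\<^sub>R e) \<le> norm (fst z - x) / 4} \<inter> {z. 1 / real (Suc m) \<le> snd z})" for e m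
    unfolding Qm_def by blast
  have closed: "closed ({z :: (real^'n) \<times> real. norm ((fst z - x) - norm (fst z - x) *\<^sub>R e) \<le> norm (fst z - x) / 4} \<inter> {z. 1 / real (Suc m) \<le> snd z})" for e m
    by (intro closed_Int closed_Collect_le continuous_intros) auto
  have [measurable]: "Qm e m \<in> sets lebesgue" for e m
    unfolding Qm_eq by (intro sets.Int sets.Diff cone_lebesgue tent_over_lebesgue closed_imp_lebesgue closed)
  have Qe: "(\<integral>\<^sup>+z. indicator (Q e) z * h z \<partial>lebesgue) \<le> \<alpha>\<^sup>2" if "norm e = 1" for e
  proof -
    \<comment> \<open>The sector estimate asks for heights bounded below; monotone convergence
      removes the cut-off 1 / (m + 1).\<close>
    have "indicator (Q e) z * h z = (SUP m. indicator (Qm e m) z * h z)" for z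
    proof (cases "z \<in> Q e")
      case True
      then have "0 < snd z" by (simp add: Q_def cone_def)
      then obtain m where "1 / real (Suc m) < snd z" using nat_approx_posE by metis
      then have zm: "z \<in> Qm e m" using True by (simp add: Q_def Qm_def)
      show ?thesis
      proof (rule antisym)
        show "indicator (Q e) z * h z \<le> (SUP m. indicator (Qm e m) z * h z)"
          using True zm by (intro SUP_upper2[of m]) auto
        show "(SUP m. indicator (Qm e m) z * h z) \<le> indicator (Q e) z * h z"
          using True by (intro SUP_least) (auto simp: indicator_def)
      qed
    next
      case False
      then have "z \<notin> Qm e m" for m by (auto simp: Q_def Qm_def)
      with False show ?thesis by simp
    qed
    then have "(\<integral>\<^sup>+z. indicator (Q e) z * h z \<partial>lebesgue) = (\<integral>\<^sup>+z. (SUP m. indicator (Qm e m) z * h z) \<partial>lebesgue)"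
      by simp
    also have "\<dots> = (SUP m. \<integral>\<^sup>+z. indicator (Qm e m) z * h z \<partial>lebesgue)"
    proof (rule nn_integral_monotone_convergence_SUP)
      have "Qm e m \<subseteq> Qm e m'" if "m \<le> m'" for m m'
      proof -
        have "1 / real (Suc m') \<le> 1 / real (Suc m)" using that by (intro divide_left_mono) auto
        then show ?thesis unfolding Qm_def by auto
      qed
      then show "incseq (\<lambda>m z. indicator (Qm e m) z * h z)"
        by (auto simp: incseq_def le_fun_def indicator_def)
    qed measurable
    also have "\<dots> \<le> \<alpha>\<^sup>2"
    proof (rule SUP_least)
      fix m
      show "(\<integral>\<^sup>+z. indicator (Qm e m) z * h z \<partial>lebesgue) \<le> \<alpha>\<^sup>2"
        unfolding h_def
        by (rule sector_integral_le[OF assms(1) that V_def _ Qm_def]) simp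
    qed
    finally show ?thesis .
  qed
  define E1 where "E1 = {e\<in>E. norm e = 1}"
  have E1: "finite E1" "card E1 \<le> card E" using E(1) by (auto simp: E1_def intro: card_mono)
  have [measurable]: "Q e \<in> sets lebesgue" for e
  proof -
    have "Q e = (\<Union>m. Qm e m)"
    proof (intro equalityI subsetI)
      fix z assume z: "z \<in> Q e"
      then have "0 < snd z" by (simp add: Q_def cone_def)
      then obtain m where "1 / real (Suc m) < snd z" using nat_approx_posE by metis
      with z show "z \<in> (\<Union>m. Qm e m)" by (auto simp: Q_def Qm_def intro: less_imp_le)
    qed (auto simp: Q_def Qm_def)
    then show ?thesis by simp
  qed
  have "(\<integral>\<^sup>+z. indicator (cone x) z * ennreal ((cmod (g z))\<^sup>2 / snd z ^ (CARD('n) + 1)) \<partial>lebesgue)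
     \<le> (\<integral>\<^sup>+z. (\<Sum>e\<in>E1. indicator (Q e) z * h z) \<partial>lebesgue)"
  proof (rule nn_integral_mono)
    fix z :: "(real^'n) \<times> real"
    show "indicator (cone x) z * ennreal ((cmod (g z))\<^sup>2 / snd z ^ (CARD('n) + 1)) \<le> (\<Sum>e\<in>E1. indicator (Q e) z * h z)"
    proof (cases "z \<in> cone x \<and> z \<notin> tent_over (thick V)")
      case True
      obtain e where e: "e \<in> E1" "norm ((fst z - x) - norm (fst z - x) *\<^sub>R e) \<le> norm (fst z - x) / 4"
        using E(2)[of "fst z - x"] by (auto simp: E1_def)
      have "0 < snd z" using True by (simp add: cone_def)
      then have "ennreal ((cmod (g z))\<^sup>2 / snd z ^ (CARD('n) + 1)) \<le> h z"
        unfolding h_def by (intro ennreal_leI divide_right_mono power_mono g(2)) auto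
      also have "\<dots> = indicator (Q e) z * h z" using True e by (simp add: Q_def)
      also have "\<dots> \<le> (\<Sum>e\<in>E1. indicator (Q e) z * h z)" using e(1) E1 by (intro member_le_sum) auto
      finally show ?thesis using True by simp
    next
      case False
      then have "z \<notin> cone x \<or> g z = 0" using g(1)[of z] by (auto simp: V_def)
      then show ?thesis by auto
    qed
  qed
  also have "\<dots> = (\<Sum>e\<in>E1. \<integral>\<^sup>+z. indicator (Q e) z * h z \<partial>lebesgue)"
    by (rule nn_integral_sum) measurable
  also have "\<dots> \<le> (\<Sum>e\<in>E1. \<alpha>\<^sup>2)" by (intro sum_mono Qe) (auto simp: E1_def)
  also have "\<dots> = of_nat (card E1) * \<alpha>\<^sup>2" by simp
  also have "\<dots> \<le> of_nat (card E) * \<alpha>\<^sup>2" using E1(2) by (intro mult_right_mono) auto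
  also have "\<dots> = (ennreal (sqrt (real (card E))) * \<alpha>)\<^sup>2"
    by (simp add: power_mult_distrib ennreal_power ennreal_of_nat_eq_real_of_nat)
  finally show ?thesis unfolding area_def epowr_half_le_iff .
qed

section \<open>A Whitney-type covering\<close>

text \<open>The radius is a function of the centre, so no greedy choice by size is made: a disjoint
  family that is maximal for inclusion, given by Zorn's lemma, already meets every other ball. It is
  countable as a family of disjoint open sets.\<close>

lemma maximal_disjoint_balls:
  fixes d :: "real^'n \<Rightarrow> real"
  assumes d: "\<And>x. x \<in> U \<Longrightarrow> 0 < d x"
  obtains A where "A \<subseteq> U" "countable A"
    "\<And>x y. x \<in> A \<Longrightarrow> y \<in> A \<Longrightarrow> x \<noteq> y \<Longrightarrow> ball x (d x) \<inter> ball y (d y) = {}"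
    "\<And>y. y \<in> U \<Longrightarrow> \<exists>x\<in>A. ball x (d x) \<inter> ball y (d y) \<noteq> {}"
proof -
  define R where "R x y \<longleftrightarrow> ball x (d x) \<inter> ball y (d y) = {}" for x y
  have sym: "R x y \<longleftrightarrow> R y x" for x y by (auto simp: R_def)
  let ?P = "\<lambda>A. A \<subseteq> U \<and> (\<forall>x\<in>A. \<forall>y\<in>A. x \<noteq> y \<longrightarrow> R x y)"
  have "\<exists>M\<in>Collect ?P. \<forall>Y\<in>Collect ?P. M \<subseteq> Y \<longrightarrow> Y = M"
  proof (rule subset_Zorn')
    fix C assume C: "subset.chain (Collect ?P) C"
    then have sub: "C \<subseteq> Collect ?P" by (simp add: subset_chain_def)
    have "R x y" if "x \<in> \<Union>C" "y \<in> \<Union>C" "x \<noteq> y" for x y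
    proof -
      from that obtain A B where AB: "A \<in> C" "B \<in> C" "x \<in> A" "y \<in> B" by blast
      moreover have "A \<subseteq> B \<or> B \<subseteq> A" using C AB by (simp add: subset_chain_def)
      ultimately obtain D where D: "D \<in> C" "x \<in> D" "y \<in> D" by blast
      then have "?P D" using sub by blast
      with D that(3) show ?thesis by blast
    qed
    moreover have "\<Union>C \<subseteq> U" using sub by blast
    ultimately show "\<Union>C \<in> Collect ?P" by simp
  qed
  then obtain A where "A \<in> Collect ?P" and "\<forall>Y\<in>Collect ?P. A \<subseteq> Y \<longrightarrow> Y = A" by (rule bexE)
  then have A: "?P A" and max: "\<And>Y. ?P Y \<Longrightarrow> A \<subseteq> Y \<Longrightarrow> Y = A" by simp_all
  have irrefl: "\<not> R x x" if "x \<in> U" for x using d[OF that] by (simp add: R_def)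
  have "countable ((\<lambda>x. ball x (d x)) ` A)"
  proof (rule countable_disjoint_open_subsets)
    show "pairwise disjnt ((\<lambda>x. ball x (d x)) ` A)"
    proof (rule pairwiseI)
      fix S T assume "S \<in> (\<lambda>x. ball x (d x)) ` A" "T \<in> (\<lambda>x. ball x (d x)) ` A" and ne: "S \<noteq> T"
      then obtain x y where xy: "x \<in> A" "y \<in> A" "S = ball x (d x)" "T = ball y (d y)" by blast
      with ne have "x \<noteq> y" by blast
      with A xy have "R x y" by blast
      then show "disjnt S T" by (simp only: R_def disjnt_def xy)
    qed
  qed auto
  moreover have "inj_on (\<lambda>x. ball x (d x)) A"
  proof (rule inj_onI, rule ccontr)
    fix x y assume xy: "x \<in> A" "y \<in> A" "ball x (d x) = ball y (d y)" "x \<noteq> y"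
    then have "R x y" using A by blast
    then have "R x x" by (simp only: R_def xy(3))
    then show False using irrefl xy(1) A by blast
  qed
  ultimately have cA: "countable A" by (rule countable_image_inj_on)
  have ex: "\<exists>x\<in>A. \<not> R x y" if "y \<in> U" for y
  proof (rule ccontr)
    assume no: "\<not> ?thesis"
    then have "?P (insert y A)" using A that sym by blast
    from max[OF this] have "y \<in> A" by blast
    then show False using no irrefl[OF that] by blast
  qed
  show thesis
    by (rule that[of A]) (use A cA ex in \<open>simp_all add: R_def\<close>)
qed

text \<open>The centres lie on a ray, each half as far from the origin as the one before, and the
  radii are 1/20 of that distance; two centres are apart by at least half of the larger distance.
  These balls complete a possibly finite Whitney family to a sequence.\<close>

lemma disjoint_small_balls:
  assumes "0 < \<rho>"
  obtains p :: "nat \<Rightarrow> real^'n" and q :: "nat \<Rightarrow> real" where "\<And>j. 0 < q j"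
    "disjoint_family (\<lambda>j. ball (p j) (q j))" "\<And>j. ball (p j) (q j) \<subseteq> ball 0 \<rho>"
proof -
  obtain v :: "real^'n" where v: "norm v = 1" using vector_choose_size[of 1] by auto
  define s where "s j = \<rho> / 2 ^ Suc j" for j
  have s: "0 < s j" "s j \<le> \<rho> / 2" for j
  proof -
    show "0 < s j" using assms by (simp add: s_def)
    have "(1::real) \<le> 2 ^ j" by simp
    then show "s j \<le> \<rho> / 2" using assms by (simp add: s_def field_simps)
  qed
  have half: "s j \<le> s i / 2" if "i < j" for i j
  proof -
    have "(2::real) ^ Suc (Suc i) \<le> 2 ^ Suc j" using that by (intro power_increasing) auto
    then have "\<rho> / 2 ^ Suc j \<le> \<rho> / 2 ^ Suc (Suc i)" using assms by (intro divide_left_mono) auto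
    then show ?thesis by (simp add: s_def)
  qed
  have dis: "ball (s i *\<^sub>R v) (s i / 20) \<inter> ball (s j *\<^sub>R v) (s j / 20) = {}" if "i < j" for i j
  proof -
    have "dist (s i *\<^sub>R v) (s j *\<^sub>R v) = \<bar>s i - s j\<bar>"
      using v by (simp add: dist_norm scaleR_diff_left[symmetric])
    then have "s i / 20 + s j / 20 \<le> dist (s i *\<^sub>R v) (s j *\<^sub>R v)"
      using half[OF that] s(1)[of i] s(1)[of j] by linarith
    then show ?thesis by (rule disjoint_ballI)
  qed
  show thesis
  proof (rule that[of "\<lambda>j. s j / 20" "\<lambda>j. s j *\<^sub>R v"])
    show "disjoint_family (\<lambda>j. ball (s j *\<^sub>R v) (s j / 20))"
      unfolding disjoint_family_on_def
    proof (intro ballI impI)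
      fix m n :: nat assume "m \<noteq> n"
      then show "ball (s m *\<^sub>R v) (s m / 20) \<inter> ball (s n *\<^sub>R v) (s n / 20) = {}"
        using dis[of m n] dis[of n m] by (cases m n rule: linorder_cases) auto
    qed
    fix j
    show "0 < s j / 20" using s by simp
    show "ball (s j *\<^sub>R v) (s j / 20) \<subseteq> ball 0 \<rho>"
    proof
      fix y assume "y \<in> ball (s j *\<^sub>R v) (s j / 20)"
      then have "norm (y - s j *\<^sub>R v) < s j / 20" by (simp add: dist_norm norm_minus_commute)
      moreover have "norm y \<le> norm (y - s j *\<^sub>R v) + norm (s j *\<^sub>R v)"
        using norm_triangle_ineq[of "y - s j *\<^sub>R v" "s j *\<^sub>R v"] by simp
      ultimately have "norm y < s j / 20 + s j" using v s(1)[of j] by simp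
      then show "y \<in> ball 0 \<rho>" using s(2)[of j] s(1)[of j] by simp
    qed
  qed
qed

text \<open>Let d be the distance to the complement of U. The selected balls have radius d / 10 and
  are disjoint, the tents have radius 2 d. If (y, t) is in the tent over U, then t \<le> d(y). A
  selected ball about x' that meets the ball about y gives 9 d(y) < 11 d(x') by the Lipschitz
  property of d, whence |y - x'| + t < 2 d(x'). Shrinking by 1/20 leads from 2 d back to d /
  10.\<close>

lemma whitney_tents:
  fixes U :: "(real^'n) set"
  assumes U: "open U" "U \<noteq> UNIV" and \<rho>: "0 < \<rho>"
  obtains cen :: "nat \<Rightarrow> real^'n" and rad :: "nat \<Rightarrow> real" where "\<And>j. 0 < rad j"
    "\<And>z. z \<in> tent_over U \<Longrightarrow> \<exists>j. z \<in> tent (cen j) (rad j)"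
    "\<And>x. (\<Sum>j. indicator (ball (cen j) (1 / 20 * rad j)) x :: ennreal) \<le> indicator U x + indicator (ball 0 \<rho>) x"
proof -
  define d where "d x = infdist x (- U)" for x
  have ne: "- U \<noteq> {}" and cl: "closed (- U)" using U by (auto simp: closed_Compl)
  have dpos: "0 < d x" if "x \<in> U" for x
    unfolding d_def using infdist_pos_not_in_closed[OF cl ne] that by auto
  have dball: "ball x (d x) \<subseteq> U" for x
    using infdist_le[of _ "- U" x] unfolding d_def by (force simp: subset_iff not_less)
  have dlip: "d x \<le> d y + dist x y" for x y unfolding d_def by (rule infdist_triangle)
  obtain A where A: "A \<subseteq> U" "countable A"
    "\<And>x y. x \<in> A \<Longrightarrow> y \<in> A \<Longrightarrow> x \<noteq> y \<Longrightarrow> ball x (d x / 10) \<inter> ball y (d y / 10) = {}"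
    "\<And>y. y \<in> U \<Longrightarrow> \<exists>x\<in>A. ball x (d x / 10) \<inter> ball y (d y / 10) \<noteq> {}"
    using maximal_disjoint_balls[of U "\<lambda>x. d x / 10"] dpos by auto
  obtain p q where pq: "\<And>j. 0 < q j" "disjoint_family (\<lambda>j::nat. ball (p j :: real^'n) (q j))"
    "\<And>j. ball (p j) (q j) \<subseteq> ball 0 \<rho>"
    using disjoint_small_balls[OF \<rho>] by metis
  define N where "N = to_nat_on A ` A"
  define x where "x j = from_nat_into A j" for j
  have xA: "x j \<in> A" if "j \<in> N" for j
    using that A(2) by (auto simp: N_def x_def)
  have xinj: "x i \<noteq> x j" if "i \<in> N" "j \<in> N" "i \<noteq> j" for i j
    using that A(2) by (auto simp: N_def x_def)
  \<comment> \<open>Indices outside \<open>N\<close> receive padding; the factor 20 makes the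
    shrunken padding balls the disjoint ones inside the ball of radius \<rho>.\<close>
  define cen rad where "cen j = (if j \<in> N then x j else p j)"
    and "rad j = (if j \<in> N then 2 * d (x j) else 20 * q j)" for j
  show thesis
  proof (rule that[of rad cen])
    show "0 < rad j" for j
      using pq(1)[of j] dpos[of "x j"] xA[of j] A(1) by (auto simp: rad_def)
    show "\<exists>j. z \<in> tent (cen j) (rad j)" if z: "z \<in> tent_over U" for z
    proof -
      define y t where "y = fst z" and "t = snd z"
      have t: "0 < t" "ball y t \<subseteq> U" using z by (auto simp: tent_over_def y_def t_def)
      then have yU: "y \<in> U" by auto
      have td: "t \<le> d y"
        unfolding d_def infdist_notempty[OF ne]
      proof (rule cINF_greatest[OF ne])
        fix a assume "a \<in> - U"
        then show "t \<le> dist y a" using t(2) by (force simp: not_less)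
      qed
      obtain x' where x': "x' \<in> A" "ball x' (d x' / 10) \<inter> ball y (d y / 10) \<noteq> {}" using A(4)[OF yU] by blast
      then obtain b where "dist x' b < d x' / 10" "dist y b < d y / 10" by auto
      then have xy: "dist y x' < (d x' + d y) / 10"
        using dist_triangle2[of y x' b] by (simp add: dist_commute)
      have dx: "0 < d x'" using x'(1) A(1) dpos by auto
      have j: "to_nat_on A x' \<in> N" "x (to_nat_on A x') = x'"
        using x'(1) A(2) by (auto simp: N_def x_def)
      have "z \<in> tent x' (2 * d x')"
        unfolding tent_def mem_Collect_eq y_def[symmetric] t_def[symmetric]
      proof (intro conjI)
        show "0 < t" by (rule t(1))
        have xy': "10 * dist y x' < d x' + d y" using xy by simp
        then have "9 * d y < 11 * d x'" using dlip[of y x'] by simp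
        then show "t < 2 * d x'" "dist y x' < 2 * d x' - t" using xy' td dx by simp_all
      qed
      then show ?thesis using j by (intro exI[of _ "to_nat_on A x'"]) (simp add: cen_def rad_def)
    qed
    fix w
    define F where "F j = (if j \<in> N then ball (x j) (d (x j) / 10) else {})" for j
    define H where "H j = (if j \<in> N then {} else ball (p j) (q j))" for j
    have dF: "disjoint_family F"
      unfolding disjoint_family_on_def F_def using A(3) xA xinj by auto
    have dH: "disjoint_family H"
      using pq(2) unfolding disjoint_family_on_def H_def by auto
    have "(\<Sum>j. indicator (ball (cen j) (1 / 20 * rad j)) w :: ennreal) = (\<Sum>j. indicator (F j) w + indicator (H j) w)"
      by (intro suminf_cong) (auto simp: cen_def rad_def F_def H_def)
    also have "\<dots> = (\<Sum>j. indicator (F j) w) + (\<Sum>j. indicator (H j) w)"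
      by (intro suminf_add[symmetric]) auto
    also have "\<dots> = indicator (\<Union>j. F j) w + indicator (\<Union>j. H j) w"
      by (simp only: suminf_indicator_disjoint[OF dF] suminf_indicator_disjoint[OF dH])
    \<comment> \<open>After shrinking, at most one Whitney ball and one padding ball contain a
      point, which is the origin of the overlap number 2. Keeping the two indicators apart lets the
      padding enter with its own small norm.\<close>
    also have "\<dots> \<le> indicator U w + indicator (ball 0 \<rho>) w"
    proof (intro add_mono)
      have "F j \<subseteq> U" for j
      proof (cases "j \<in> N")
        case True
        then have "0 < d (x j)" using xA A(1) dpos by blast
        then have "ball (x j) (d (x j) / 10) \<subseteq> ball (x j) (d (x j))" by (intro subset_ball) simp
        with dball[of "x j"] show ?thesis unfolding F_def by auto
      qed (simp add: F_def)
      then show "indicator (\<Union>j. F j) w \<le> (indicator U w :: ennreal)" by (auto simp: indicator_def)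
      have "H j \<subseteq> ball 0 \<rho>" for j using pq(3)[of j] by (auto simp: H_def)
      then have "(\<Union>j. H j) \<subseteq> ball 0 \<rho>" by (rule UN_least)
      then have "w \<in> ball 0 \<rho>" if "w \<in> (\<Union>j. H j)" using that by (rule subsetD)
      then show "indicator (\<Union>j. H j) w \<le> (indicator (ball 0 \<rho>) w :: ennreal)"
        by (cases "w \<in> (\<Union>j. H j)") simp_all
    qed
    finally show "(\<Sum>j. indicator (ball (cen j) (1 / 20 * rad j)) w :: ennreal) \<le> indicator U w + indicator (ball 0 \<rho>) w" .
  qed
qed

section \<open>From the weak tent norm to decompositions\<close>

text \<open>The area function vanishes off the ball, so its p-th power integrates to at most |B| /
  q^p, and the p-th root is the size condition with constant one, for every p.\<close>

lemma TX_inf_atomI: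
  fixes X :: "(real^'n \<Rightarrow> real) \<Rightarrow> ennreal"
  assumes \<rho>: "0 < \<rho>" and [measurable]: "a \<in> borel_measurable lebesgue"
    and supp: "\<And>z. z \<notin> tent c \<rho> \<Longrightarrow> a z = 0"
    and q: "0 < q" "X (indicator (ball c \<rho>)) = ennreal q"
    and le: "\<And>x. area a x \<le> ennreal (1 / q)"
  shows "TX_inf_atom X a c \<rho>"
  unfolding TX_inf_atom_def TX_atom_def
proof (intro allI impI conjI)
  fix p :: real assume p: "1 < p"
  define m where "m = measure lebesgue (ball c \<rho>)"
  have m: "emeasure lebesgue (ball c \<rho>) = ennreal m" "0 \<le> m"
    using \<rho> by (auto simp: m_def emeasure_eq_ennreal_measure emeasure_ball)
  have "(\<integral>\<^sup>+x. epowr (area a x) p \<partial>lebesgue) \<le> (\<integral>\<^sup>+x. ennreal ((1 / q) powr p) * indicator (ball c \<rho>) x \<partial>lebesgue)"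
  proof (rule nn_integral_mono)
    fix x
    show "epowr (area a x) p \<le> ennreal ((1 / q) powr p) * indicator (ball c \<rho>) x"
    proof (cases "x \<in> ball c \<rho>")
      case True
      then show ?thesis using epowr_mono[OF _ le[of x], of p] p q(1) by (simp add: epowr_ennreal)
    next
      case False
      then show ?thesis using area_outside_tent[of c \<rho> a x] supp by simp
    qed
  qed
  also have "\<dots> = ennreal ((1 / q) powr p * m)"
    using m q(1) by (subst nn_integral_cmult_indicator) (auto simp: ennreal_mult)
  finally have "T2norm p a \<le> epowr (ennreal ((1 / q) powr p * m)) (1 / p)"
    unfolding T2norm_def using p by (intro epowr_mono) auto
  also have "\<dots> = ennreal (m powr (1 / p) / q)"
    using m q(1) p by (simp add: epowr_ennreal powr_mult powr_powr)
  finally show "T2norm p a \<le> ennreal (measure lebesgue (ball c \<rho>) powr (1 / p)) / X (indicator (ball c \<rho>))"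
    using q by (simp add: divide_ennreal m_def)
qed (use assms in auto)

lemma zsums_single: "zsums (\<lambda>i. if i = i0 then c else 0) c"
proof (cases "0 \<le> i0")
  case True
  then have "(\<lambda>k. if int k = i0 then c else 0) = (\<lambda>k. if k = nat i0 then c else 0)" by (intro ext) auto
  then have "(\<lambda>k. if int k = i0 then c else 0) sums c" using sums_single[of "nat i0" "\<lambda>_. c"] by simp
  moreover have "(\<lambda>k. if - int k - 1 = i0 then c else 0) = (\<lambda>k. 0)" using True by (intro ext) auto
  then have "(\<lambda>k. if - int k - 1 = i0 then c else 0) sums 0" by simp
  ultimately show ?thesis unfolding zsums_def by force
next
  case False
  then have "(\<lambda>k. if - int k - 1 = i0 then c else 0) = (\<lambda>k. if k = nat (- i0 - 1) then c else 0)" by (intro ext) auto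
  then have "(\<lambda>k. if - int k - 1 = i0 then c else 0) sums c" using sums_single[of "nat (- i0 - 1)" "\<lambda>_. c"] by simp
  moreover have "(\<lambda>k. if int k = i0 then c else 0) = (\<lambda>k. 0)" using False by (intro ext) auto
  then have "(\<lambda>k. if int k = i0 then c else 0) sums 0" by simp
  ultimately show ?thesis unfolding zsums_def by force
qed

text \<open>Cones with vertices in a countable dense set already cover the half-space, so only
  countably many null sets arise.\<close>

lemma area_eq_0_imp_AE:
  fixes g :: "(real^'n) \<times> real \<Rightarrow> complex"
  assumes [measurable]: "g \<in> borel_measurable lebesgue" and zero: "\<And>x. area g x = 0"
  shows "AE z in lebesgue. 0 < snd z \<longrightarrow> g z = 0"
proof -
  obtain D :: "(real^'n) set" where D: "countable D" "\<And>S. open S \<Longrightarrow> S \<noteq> {} \<Longrightarrow> \<exists>d\<in>D. d \<in> S"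
    using countable_dense_exists by auto
  have "AE z in lebesgue. z \<in> cone x \<longrightarrow> g z = 0" for x
  proof -
    have "(\<integral>\<^sup>+z. indicator (cone x) z * ennreal ((cmod (g z))\<^sup>2 / snd z ^ (CARD('n) + 1)) \<partial>lebesgue) \<le> 0\<^sup>2"
      using zero[of x] unfolding area_def epowr_half_le_iff[symmetric] by simp
    then have "(\<integral>\<^sup>+z. indicator (cone x) z * ennreal ((cmod (g z))\<^sup>2 / snd z ^ (CARD('n) + 1)) \<partial>lebesgue) = 0"
      by simp
    then have "AE z in lebesgue. indicator (cone x) z * ennreal ((cmod (g z))\<^sup>2 / snd z ^ (CARD('n) + 1)) = 0"
      by (subst (asm) nn_integral_0_iff_AE) measurable
    then show ?thesis
    proof (rule eventually_mono, intro impI)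
      fix z assume "indicator (cone x) z * ennreal ((cmod (g z))\<^sup>2 / snd z ^ (CARD('n) + 1)) = 0" and z: "z \<in> cone x"
      then have "(cmod (g z))\<^sup>2 / snd z ^ (CARD('n) + 1) \<le> 0" by (simp add: ennreal_eq_0_iff)
      moreover have "0 < snd z ^ (CARD('n) + 1)" using z by (simp add: cone_def)
      ultimately show "g z = 0" by (simp add: divide_le_0_iff)
    qed
  qed
  then have "AE z in lebesgue. \<forall>x\<in>D. z \<in> cone x \<longrightarrow> g z = 0"
    by (subst AE_ball_countable[OF D(1)]) blast
  then show ?thesis
  proof (rule eventually_mono, intro impI)
    fix z assume *: "\<forall>x\<in>D. z \<in> cone x \<longrightarrow> g z = 0" and "0 < snd z"
    then obtain x where "x \<in> D" "x \<in> ball (fst z) (snd z)" using D(2)[of "ball (fst z) (snd z)"] by auto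
    then have "z \<in> cone x" using \<open>0 < snd z\<close> by (simp add: cone_def dist_commute)
    with * \<open>x \<in> D\<close> show "g z = 0" by blast
  qed
qed

text \<open>The part of f outside all tents vanishes on the tent of each level, so its area function
  is at most a constant times 2^i for every i; letting i tend to minus infinity leaves 0.\<close>

lemma tents_exhaust:
  fixes f :: "(real^'n) \<times> real \<Rightarrow> complex"
  assumes [measurable]: "f \<in> borel_measurable lebesgue" and \<tau>: "0 < \<tau>"
  shows "AE z in lebesgue. 0 < snd z \<longrightarrow>
    (\<forall>i::int. z \<notin> tent_over (thick {x. ennreal (2 powr real_of_int i * \<tau>) < area f x})) \<longrightarrow> f z = 0"
proof -
  obtain E :: "(real^'n) set" where E: "finite E" "E \<noteq> {}"
    "\<And>u. \<exists>e\<in>E. norm e = 1 \<and> norm (u - norm u *\<^sub>R e) \<le> norm u / 4"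
    using finite_directions by metis
  define T where "T i = tent_over (thick {x. ennreal (2 powr real_of_int i * \<tau>) < area f x})" for i :: int
  have [measurable]: "T i \<in> sets lebesgue" for i by (simp add: T_def)
  define g where "g z = (if \<exists>i. z \<in> T i then 0 else f z)" for z
  have [measurable]: "g \<in> borel_measurable lebesgue" unfolding g_def by measurable
  have "area g x = 0" for x
  proof -
    have le: "area g x \<le> ennreal (sqrt (real (card E)) * (2 powr real_of_int i * \<tau>))" for i
    proof -
      have "area g x \<le> ennreal (sqrt (real (card E))) * ennreal (2 powr real_of_int i * \<tau>)"
      proof (rule area_off_tent_le[OF assms(1) E(1,3)])
        show "g z = 0" if "z \<in> tent_over (thick {x. ennreal (2 powr real_of_int i * \<tau>) < area f x})" for z
        proof -
          have "z \<in> T i" using that unfolding T_def .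
          then show ?thesis unfolding g_def by auto
        qed
      qed (simp add: g_def)
      then show ?thesis using \<tau> by (simp add: ennreal_mult)
    qed
    have "(\<lambda>n. (1/2::real) ^ n) \<longlonglongrightarrow> 0" by (intro LIMSEQ_power_zero) auto
    then have "(\<lambda>n. sqrt (real (card E)) * ((1/2) ^ n * \<tau>)) \<longlonglongrightarrow> sqrt (real (card E)) * (0 * \<tau>)"
      by (intro tendsto_mult tendsto_const)
    then have "(\<lambda>n. ennreal (sqrt (real (card E)) * ((1/2) ^ n * \<tau>))) \<longlonglongrightarrow> ennreal 0"
      by (intro tendsto_ennrealI) simp
    moreover have "area g x \<le> ennreal (sqrt (real (card E)) * ((1/2) ^ n * \<tau>))" for n
      using le[of "- int n"] by (simp add: powr_minus powr_realpow power_one_over inverse_eq_divide)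
    ultimately have "area g x \<le> ennreal 0" by (intro LIMSEQ_le_const) auto
    then show ?thesis by simp
  qed
  from area_eq_0_imp_AE[OF _ this] show ?thesis
    by (auto elim!: eventually_mono simp: g_def T_def split: if_splits)
qed

text \<open>The counting function is at most its power 1/r, to which the maximal bound applies. For
  the shrunken balls the overlap is at most 2, so the power costs only the factor 2^(1/r). The
  quasi-triangle inequality then separates the Whitney part from the padding.\<close>

lemma whitney_level_le:
  fixes X :: "(real^'n \<Rightarrow> real) \<Rightarrow> ennreal"
  assumes qB: "ball_qBfs X" and K: "maximal_bound X r ((1 / 20) ^ CARD('n)) K" and r: "0 < r" "r < 1"
    and Kq: "\<And>f g. f \<in> borel_measurable lebesgue \<Longrightarrow> g \<in> borel_measurable lebesgue \<Longrightarrow>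
     X (\<lambda>x. f x + g x) \<le> ennreal Kq * (X f + X g)" "0 < Kq"
    and rad: "\<And>j. 0 < rad j" and U [measurable]: "U \<in> sets lebesgue" "P \<in> sets lebesgue"
    and ov: "\<And>x. (\<Sum>j. indicator (ball (cen j) (1 / 20 * rad j)) x :: ennreal) \<le> indicator U x + indicator P x"
  shows "Xe X (\<lambda>x. \<Sum>j. indicator (ball (cen j) (rad j)) x)
    \<le> ennreal K * (ennreal (2 powr (1 / r)) * (ennreal Kq * (X (indicator U) + X (indicator P))))"
proof -
  let ?SB = "\<lambda>x. \<Sum>j. indicator (ball (cen j) (rad j)) x :: ennreal"
  let ?Sb = "\<lambda>x. \<Sum>j. indicator (ball (cen j) (1 / 20 * rad j)) x :: ennreal"
  have "Xe X ?SB \<le> Xe X (\<lambda>x. epowr (?SB x) (1 / r))"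
  proof (rule Xe_mono[OF qB])
    show "AE x in lebesgue. ?SB x \<le> epowr (?SB x) (1 / r)"
    proof (rule AE_I2, rule epowr_ge_self)
      fix x
      show "?SB x = 0 \<or> 1 \<le> ?SB x"
      proof (cases "\<exists>j. x \<in> ball (cen j) (rad j)")
        case True
        then obtain j where "x \<in> ball (cen j) (rad j)" by blast
        then have "1 = (\<Sum>j\<in>{j}. indicator (ball (cen j) (rad j)) x :: ennreal)" by simp
        also have "\<dots> \<le> ?SB x" by (intro sum_le_suminf) auto
        finally show ?thesis by simp
      qed auto
    qed (use r in simp)
  qed measurable
  also have "\<dots> \<le> ennreal K * Xe X (\<lambda>x. epowr (?Sb x) (1 / r))"
  proof (rule maximal_boundD[OF K])
    show "ennreal ((1 / 20) ^ CARD('n)) \<le> HLmax (indicator (ball (cen j) (1 / 20 * rad j))) x"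
      if "x \<in> ball (cen j) (rad j)" for j x
      by (rule HLmax_concentric_ball_ge[OF rad _ _ that]) auto
  qed auto
  also have "Xe X (\<lambda>x. epowr (?Sb x) (1 / r)) \<le> Xe X (\<lambda>x. ennreal (2 powr (1 / r)) * (indicator U x + indicator P x))"
  proof (rule Xe_mono[OF qB])
    show "AE x in lebesgue. epowr (?Sb x) (1 / r) \<le> ennreal (2 powr (1 / r)) * (indicator U x + indicator P x)"
    proof (rule AE_I2)
      fix x
      have "epowr (?Sb x) (1 / r) \<le> epowr (indicator U x + indicator P x) (1 / r)"
        using r by (intro epowr_mono ov) auto
      also have "\<dots> \<le> ennreal (2 powr (1 / r)) * (indicator U x + indicator P x)"
      proof -
        have "ennreal (1 powr (1 / r)) \<le> ennreal (2 powr (1 / r))"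
          using r by (intro ennreal_leI powr_mono2) auto
        then have one: "1 \<le> ennreal (2 powr (1 / r))" by simp
        have "epowr 2 (1 / r) = ennreal (2 powr (1 / r))" using epowr_ennreal[of 2 "1 / r"] by simp
        then show ?thesis using one by (auto simp: indicator_def mult_left_mono one_add_one intro: order_trans[OF _ mult_left_mono[of 1 2]])
      qed
      finally show "epowr (?Sb x) (1 / r) \<le> ennreal (2 powr (1 / r)) * (indicator U x + indicator P x)" .
    qed
  qed measurable
  also have "\<dots> = ennreal (2 powr (1 / r)) * Xe X (\<lambda>x. indicator U x + indicator P x)"
    by (rule Xe_cmult[OF qB]) auto
  also have "Xe X (\<lambda>x. indicator U x + indicator P x) \<le> ennreal Kq * (Xe X (indicator U) + Xe X (indicator P))"
    by (rule Xe_add_le[OF Kq _ _ qB]) (use U in \<open>auto intro: borel_measurable_indicator\<close>)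
  finally show ?thesis by (simp add: Xe_indicator mult_left_mono)
qed

text \<open>The summand \<epsilon> pays for the padding balls, which have positive norm even when f
  vanishes. The constant does not depend on it.\<close>

lemma WTnorm_imp_decomp:
  fixes X :: "(real^'n \<Rightarrow> real) \<Rightarrow> ennreal"
  assumes qB: "ball_qBfs X" and FS: "FS X pm" and r: "0 < r" "r < pm" "r < 1"
  obtains C where "0 < C" "\<And>f \<epsilon>. f \<in> borel_measurable lebesgue \<Longrightarrow> WTnorm X f < top \<Longrightarrow> 0 < \<epsilon> \<Longrightarrow>
    \<exists>a cen rad. decomp X (1 / 20) 2 f a cen rad \<and> dval X cen rad \<le> ennreal C * (WTnorm X f + ennreal \<epsilon>)"
proof -
  obtain E :: "(real^'n) set" where E: "finite E" "E \<noteq> {}"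
    "\<And>u. \<exists>e\<in>E. norm e = 1 \<and> norm (u - norm u *\<^sub>R e) \<le> norm u / 4"
    using finite_directions by metis
  define \<sigma> where "\<sigma> = sqrt (real (card E))"
  have \<sigma>: "0 < \<sigma>" using E by (simp add: \<sigma>_def card_gt_0_iff)
  \<comment> \<open>A piece of level i vanishes on the tent of level i + 1, so its area function is
    at most \<sigma> 2^(i+1) \<tau>; this \<tau> makes that number 2^i.\<close>
  define \<tau> where "\<tau> = 1 / (2 * \<sigma>)"
  have \<tau>: "0 < \<tau>" using \<sigma> by (simp add: \<tau>_def)
  obtain K1 where K1: "0 < K1" "maximal_bound X r (1 / (2 * 64 ^ CARD('n))) K1"
    using FS_maximal_bound[OF qB FS r(1,2), of "1 / (2 * 64 ^ CARD('n))"] by auto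
  obtain K2 where K2: "0 < K2" "maximal_bound X r ((1 / 20) ^ CARD('n)) K2"
    using FS_maximal_bound[OF qB FS r(1,2), of "(1 / 20) ^ CARD('n)"] by auto
  obtain Kq where Kq: "1 \<le> Kq" "\<And>f g. f \<in> borel_measurable lebesgue \<Longrightarrow> g \<in> borel_measurable lebesgue \<Longrightarrow>
     X (\<lambda>x. f x + g x) \<le> ennreal Kq * (X f + X g)"
    using qBfs_quasi_triangle[OF qB] by metis
  define L where "L = K2 * 2 powr (1 / r) * Kq"
  have L: "0 < L" using K2 Kq by (simp add: L_def)
  show thesis
  proof (rule that)
    show "0 < L * (K1 / \<tau> + 1)" using L K1 \<tau> by (simp add: add_pos_pos)
    fix f :: "(real^'n) \<times> real \<Rightarrow> complex" and \<epsilon> :: real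
    assume [measurable]: "f \<in> borel_measurable lebesgue" and fin: "WTnorm X f < top" and \<epsilon>: "0 < \<epsilon>"
    then obtain N where N: "0 \<le> N" "WTnorm X f = ennreal N" by (cases "WTnorm X f") auto
    define V where "V i = {x. ennreal (2 powr real_of_int i * \<tau>) < area f x}" for i :: int
    have [measurable]: "V i \<in> sets lebesgue" for i
      unfolding V_def by (intro open_imp_lebesgue open_area_superlevel) measurable
    define U where "U i = thick (V i)" for i
    have oU: "open (U i)" for i by (simp add: U_def open_thick)
    have [measurable]: "U i \<in> sets lebesgue" for i by (rule open_imp_lebesgue[OF oU])
    \<comment> \<open>On \<open>U i\<close> the maximal function of the indicator of
      \<open>V i\<close> is at least the density threshold, so passing from \<open>V i\<close> to
      \<open>U i\<close> costs only \<open>K1\<close>; the norm for \<open>V i\<close> is read off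
      from the weak norm.\<close>
    have XU: "X (indicator (U i)) \<le> ennreal (K1 * N / \<tau> * 2 powr (- real_of_int i))" for i
    proof -
      define \<alpha> where "\<alpha> = 2 powr real_of_int i * \<tau>"
      have \<alpha>: "0 < \<alpha>" using \<tau> by (simp add: \<alpha>_def)
      have "X (indicator (V i)) = ennreal (1 / \<alpha>) * (ennreal \<alpha> * X (indicator (V i)))"
        using \<alpha> by (simp add: mult.assoc[symmetric] ennreal_mult[symmetric])
      also have "\<dots> \<le> ennreal (1 / \<alpha>) * WTnorm X f"
        unfolding WTnorm_def WX_def V_def \<alpha>_def[symmetric] using \<alpha> by (intro mult_left_mono SUP_upper) auto
      finally have XV: "X (indicator (V i)) \<le> ennreal (1 / \<alpha>) * ennreal N" by (simp only: N(2))
      have "X (indicator (U i)) \<le> ennreal K1 * X (indicator (V i))"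
        by (rule maximal_bound_single[OF K1(2) r(1)]) (auto simp: U_def HLmax_thick_ge open_thick open_imp_lebesgue)
      also have "\<dots> \<le> ennreal K1 * (ennreal (1 / \<alpha>) * ennreal N)" by (intro mult_left_mono XV) simp
      also have "\<dots> = ennreal (K1 * N / \<tau> * 2 powr (- real_of_int i))"
        using K1(1) N(1) \<alpha> by (simp add: ennreal_mult[symmetric] \<alpha>_def powr_minus_divide mult_ac)
      finally show ?thesis .
    qed
    have "U i \<noteq> UNIV" for i
    proof
      assume "U i = UNIV"
      then have "top \<le> ennreal (K1 * N / \<tau> * 2 powr (- real_of_int i))"
        using XU[of i] FS_UNIV_infinite[OF qB FS r(1,2)] by simp
      then show False by (simp add: top_unique)
    qed
    \<comment> \<open>Padding of norm 2^(-i) \<epsilon> at level i becomes \<epsilon> after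
      multiplication by the factor 2^i in \<open>dval\<close>, uniformly in i.\<close>
    have "\<exists>\<rho>>0. X (indicator (ball 0 \<rho>)) \<le> ennreal (2 powr (- real_of_int i) * \<epsilon>)" for i
      using FS_small_balls[OF qB FS r(1,2), of "2 powr (- real_of_int i) * \<epsilon>"] \<epsilon> by (metis mult_pos_pos powr_gt_zero zero_neq_numeral)
    then obtain \<rho> where \<rho>: "\<And>i. 0 < \<rho> i" "\<And>i. X (indicator (ball 0 (\<rho> i))) \<le> ennreal (2 powr (- real_of_int i) * \<epsilon>)"
      by metis
    define Q where "Q i cen rad \<longleftrightarrow> (\<forall>j. 0 < rad j) \<and> (\<forall>z\<in>tent_over (U i). \<exists>j. z \<in> tent (cen j) (rad j)) \<and>
      (\<forall>x. (\<Sum>j. indicator (ball (cen j) (1 / 20 * rad j)) x :: ennreal) \<le> indicator (U i) x + indicator (ball 0 (\<rho> i)) x)"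
      for i and cen :: "nat \<Rightarrow> real^'n" and rad
    have "\<exists>cen rad. Q i cen rad" for i
      unfolding Q_def by (rule whitney_tents[OF oU \<open>U i \<noteq> UNIV\<close> \<rho>(1)]) blast
    then obtain cen rad where "\<And>i. Q i (cen i) (rad i)" by metis
    then have rad: "\<And>i j. 0 < rad i j"
      and cover: "\<And>i z. z \<in> tent_over (U i) \<Longrightarrow> \<exists>j. z \<in> tent (cen i j) (rad i j)"
      and ov: "\<And>i x. (\<Sum>j. indicator (ball (cen i j) (1 / 20 * rad i j)) x :: ennreal) \<le> indicator (U i) x + indicator (ball 0 (\<rho> i)) x"
      unfolding Q_def by blast+
    define T where "T i = tent_over (U i)" for i
    have Tmono: "T k \<subseteq> T i" if "i \<le> k" for i k
    proof -
      have "ennreal (2 powr real_of_int i * \<tau>) \<le> ennreal (2 powr real_of_int k * \<tau>)"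
        using that \<tau> by (intro ennreal_leI mult_right_mono powr_mono) auto
      then have "V k \<subseteq> V i" unfolding V_def by (auto intro: le_less_trans)
      then show ?thesis unfolding T_def U_def by (intro tent_over_mono thick_mono) auto
    qed
    \<comment> \<open>Otherwise one fixed ball would lie in all \<open>U i\<close>, whose norms tend
      to 0 as i grows, while balls have positive norm.\<close>
    have Tbound: "\<exists>i. z \<notin> T i" if "0 < snd z" for z
    proof (rule ccontr)
      assume "\<not> ?thesis"
      then have sub: "ball (fst z) (snd z) \<subseteq> U i" for i by (auto simp: T_def tent_over_def)
      have le: "X (indicator (ball (fst z) (snd z))) \<le> ennreal (K1 * N / \<tau> * (1 / 2) ^ n)" for n
      proof -
        have "X (indicator (ball (fst z) (snd z))) \<le> X (indicator (U (int n)))"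
          by (rule qBfs_indicator_mono[OF qB _ _ sub]) auto
        also note XU[of "int n"]
        finally show ?thesis by (simp add: powr_minus powr_realpow power_one_over inverse_eq_divide)
      qed
      have "(\<lambda>n. K1 * N / \<tau> * (1 / 2) ^ n) \<longlonglongrightarrow> K1 * N / \<tau> * 0"
        by (intro tendsto_mult tendsto_const LIMSEQ_power_zero) auto
      then have "(\<lambda>n. ennreal (K1 * N / \<tau> * (1 / 2) ^ n)) \<longlonglongrightarrow> ennreal (K1 * N / \<tau> * 0)"
        by (rule tendsto_ennrealI)
      from LIMSEQ_le_const[OF this] le have "X (indicator (ball (fst z) (snd z))) \<le> ennreal (K1 * N / \<tau> * 0)" by blast
      then show False using qBfs_ball_pos[OF qB that, of "fst z"] by simp
    qed
    \<comment> \<open>The tents decrease in i and no point lies in all of them, so these layers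
      partition the union of the tents.\<close>
    define R where "R i = T i - T (i + 1)" for i
    have Runique: "i = k" if "z \<in> R i" "z \<in> R k" for z i k
    proof -
      have "k \<le> i" if "z \<in> R i" "z \<in> R k" for i k
        using that Tmono[of "i + 1" k] unfolding R_def by force
      then show ?thesis using that by (simp add: order_antisym)
    qed
    have Rex: "\<exists>i. z \<in> R i" if "0 < snd z" "z \<in> T k" for z k
    proof -
      obtain m where m: "z \<notin> T m" using Tbound[OF \<open>0 < snd z\<close>] by blast
      have "\<exists>n. z \<notin> T (k + int n)"
        using m Tmono[of m "k + int (nat (m - k))"] by (intro exI[of _ "nat (m - k)"]) auto
      then obtain n where n: "z \<notin> T (k + int n)" "\<And>l. l < n \<Longrightarrow> z \<in> T (k + int l)"
        using exists_least_iff[of "\<lambda>n. z \<notin> T (k + int n)"] by blast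
      \<comment> \<open>The point still lies in the tent of index k, so the first index at which it
        has left has a predecessor; that one is its layer.\<close>
      then have "n \<noteq> 0" using \<open>z \<in> T k\<close> by (metis add.right_neutral of_nat_0)
      then obtain l where "n = Suc l" by (cases n) auto
      then show ?thesis using n(1) n(2)[of l] by (intro exI[of _ "k + int l"]) (auto simp: R_def algebra_simps)
    qed
    \<comment> \<open>Tents of one level may overlap; each point goes to the first tent of the
      sequence that contains it, padding tents included.\<close>
    define P where "P i j = R i \<inter> (tent (cen i j) (rad i j) - (\<Union>k<j. tent (cen i k) (rad i k)))" for i j
    have [measurable]: "P i j \<in> sets lebesgue" for i j
      unfolding P_def R_def T_def by (intro sets.Int sets.Diff sets.finite_UN tent_lebesgue tent_over_lebesgue) auto
    define a where "a i j z = (if z \<in> P i j then f z / complex_of_real (lam X cen rad i j) else 0)" for i j z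
    have [measurable]: "a i j \<in> borel_measurable lebesgue" for i j unfolding a_def by measurable
    have lam: "\<exists>q>0. X (indicator (ball (cen i j) (rad i j))) = ennreal q \<and> lam X cen rad i j = 2 powr real_of_int i * q" for i j
      using qBfs_ball_finite[OF qB rad, of "cen i j" i j] qBfs_ball_pos[OF qB rad, of "cen i j" i j]
      by (cases "X (indicator (ball (cen i j) (rad i j)))") (auto simp: lam_def)
    have atom: "TX_inf_atom X (a i j) (cen i j) (rad i j)" for i j
    proof -
      obtain q where q: "0 < q" "X (indicator (ball (cen i j) (rad i j))) = ennreal q"
        "lam X cen rad i j = 2 powr real_of_int i * q" using lam by blast
      define l where "l = lam X cen rad i j"
      have l: "0 < l" using q by (simp add: l_def)
      show ?thesis
      proof (rule TX_inf_atomI[where q = q])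
        show "a i j z = 0" if "z \<notin> tent (cen i j) (rad i j)" for z using that by (simp add: a_def P_def)
        fix x
        define g where "g z = (if z \<in> P i j then f z else 0)" for z
        have [measurable]: "g \<in> borel_measurable lebesgue" unfolding g_def by measurable
        have "area g x \<le> ennreal (sqrt (real (card E))) * ennreal (2 powr real_of_int (i + 1) * \<tau>)"
        proof (rule area_off_tent_le[OF _ E(1,3)])
          show "g z = 0" if "z \<in> tent_over (thick {x. ennreal (2 powr real_of_int (i + 1) * \<tau>) < area f x})" for z
          proof -
            have "z \<in> T (i + 1)" using that unfolding T_def U_def V_def .
            then have "z \<notin> P i j" by (simp add: P_def R_def)
            then show ?thesis by (simp add: g_def)
          qed
        qed (auto simp: g_def)
        also have "\<dots> = ennreal (2 powr real_of_int i)"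
          using \<sigma> by (simp add: ennreal_mult[symmetric] \<sigma>_def[symmetric] \<tau>_def powr_add)
        finally have ag: "area g x \<le> ennreal (2 powr real_of_int i)" .
        have "(\<lambda>z. ennreal (cmod (a i j z))) = (\<lambda>z. ennreal (1 / l) * ennreal (cmod (g z)))"
          using l by (auto simp: a_def g_def l_def[symmetric] norm_divide ennreal_mult[symmetric])
        then have "area (a i j) x = ennreal (1 / l) * area g x"
          by (simp add: area_eq_L2n L2n_cmult)
        also have "\<dots> \<le> ennreal (1 / l) * ennreal (2 powr real_of_int i)" by (intro mult_left_mono ag) simp
        also have "\<dots> = ennreal (1 / q)"
          using l q by (simp add: ennreal_mult[symmetric] l_def)
        finally show "area (a i j) x \<le> ennreal (1 / q)" .
      qed (use rad q in auto)
    qed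
    have summand: "complex_of_real (lam X cen rad i j) * a i j z = (if z \<in> P i j then f z else 0)" for i j z
    proof -
      have "lam X cen rad i j \<noteq> 0" using lam[of i j] by auto
      then show ?thesis by (simp add: a_def)
    qed
    \<comment> \<open>At a given point at most one layer, and in it one piece, is nonzero; inner and
      outer series have at most one nonzero term and converge trivially.\<close>
    have sums: "(\<lambda>j. complex_of_real (lam X cen rad i j) * a i j z) sums (if z \<in> R i then f z else 0)" for i z
    proof (cases "z \<in> R i")
      case True
      then have "\<exists>j. z \<in> tent (cen i j) (rad i j)" using cover by (simp add: R_def T_def)
      then obtain j0 where j0: "z \<in> tent (cen i j0) (rad i j0)" "\<And>k. k < j0 \<Longrightarrow> z \<notin> tent (cen i k) (rad i k)"
        using exists_least_iff[of "\<lambda>j. z \<in> tent (cen i j) (rad i j)"] by blast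
      have "z \<in> P i j \<longleftrightarrow> j = j0" for j
        using True j0 unfolding P_def by (cases j j0 rule: linorder_cases) auto
      then have "(\<lambda>j. complex_of_real (lam X cen rad i j) * a i j z) = (\<lambda>j. if j = j0 then f z else 0)"
        by (auto simp: summand)
      then show ?thesis using True sums_single[of j0 "\<lambda>_. f z"] by simp
    next
      case False
      then have "(\<lambda>j. complex_of_real (lam X cen rad i j) * a i j z) = (\<lambda>j. 0)"
        by (auto simp: summand P_def)
      then show ?thesis using False by simp
    qed
    have rep: "AE z in lebesgue. 0 < snd z \<longrightarrow>
        (\<exists>s. (\<forall>i. (\<lambda>j. complex_of_real (lam X cen rad i j) * a i j z) sums s i) \<and> zsums s (f z))"
      using tents_exhaust[OF \<open>f \<in> borel_measurable lebesgue\<close> \<tau>]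
    proof (rule eventually_mono, intro impI)
      fix z :: "(real^'n) \<times> real"
      assume ex: "0 < snd z \<longrightarrow> (\<forall>i::int. z \<notin> tent_over (thick {x. ennreal (2 powr real_of_int i * \<tau>) < area f x})) \<longrightarrow> f z = 0"
        and z: "0 < snd z"
      have "zsums (\<lambda>i. if z \<in> R i then f z else 0) (f z)"
      proof (cases "\<exists>k. z \<in> T k")
        case True
        then obtain i0 where "z \<in> R i0" using Rex[OF z] by blast
        then have "z \<in> R i \<longleftrightarrow> i = i0" for i using Runique by blast
        then have "(\<lambda>i. if z \<in> R i then f z else 0) = (\<lambda>i. if i = i0 then f z else 0)" by simp
        then show ?thesis by (simp add: zsums_single)
      next
        case False
        then have "f z = 0" using ex z by (auto simp: T_def U_def V_def)
        then show ?thesis using zsums_single[of 0 0] by (simp cong: if_cong)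
      qed
      with sums show "\<exists>s. (\<forall>i. (\<lambda>j. complex_of_real (lam X cen rad i j) * a i j z) sums s i) \<and> zsums s (f z)"
        by (intro exI[of _ "\<lambda>i. if z \<in> R i then f z else 0"] conjI allI)
    qed
    have dv: "dval X cen rad \<le> ennreal (L * (K1 / \<tau> + 1)) * (WTnorm X f + ennreal \<epsilon>)"
      unfolding dval_def
    proof (rule SUP_least)
      fix i :: int
      have "Xe X (\<lambda>x. \<Sum>j. indicator (ball (cen i j) (rad i j)) x)
        \<le> ennreal K2 * (ennreal (2 powr (1 / r)) * (ennreal Kq * (X (indicator (U i)) + X (indicator (ball 0 (\<rho> i))))))"
        by (rule whitney_level_le[OF qB K2(2) r(1,3) Kq(2) _ rad _ _ ov]) (use Kq(1) in auto)
      also have "\<dots> \<le> ennreal K2 * (ennreal (2 powr (1 / r)) * (ennreal Kq *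
          (ennreal (K1 * N / \<tau> * 2 powr (- real_of_int i)) + ennreal (2 powr (- real_of_int i) * \<epsilon>))))"
        by (intro mult_left_mono add_mono XU \<rho>(2)) auto
      also have "\<dots> = ennreal (L * (K1 * N / \<tau> * 2 powr (- real_of_int i) + 2 powr (- real_of_int i) * \<epsilon>))"
        using K1 K2 Kq(1) N(1) \<tau> \<epsilon>
        by (simp add: L_def ennreal_mult[symmetric] ennreal_plus[symmetric] mult.assoc del: ennreal_plus)
      finally have "ennreal (2 powr real_of_int i) * Xe X (\<lambda>x. \<Sum>j. indicator (ball (cen i j) (rad i j)) x)
        \<le> ennreal (2 powr real_of_int i) * ennreal (L * (K1 * N / \<tau> * 2 powr (- real_of_int i) + 2 powr (- real_of_int i) * \<epsilon>))"
        by (rule mult_left_mono) simp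
      also have "\<dots> = ennreal (L * (K1 / \<tau> * N + \<epsilon>))"
        using K1 L N(1) \<tau> \<epsilon> by (simp add: ennreal_mult[symmetric] powr_minus_divide field_simps)
      also have "\<dots> \<le> ennreal (L * (K1 / \<tau> + 1) * (N + \<epsilon>))"
      proof (rule ennreal_leI)
        have "0 \<le> K1 / \<tau> * \<epsilon>" using K1 \<tau> \<epsilon> by simp
        then have "K1 / \<tau> * N + \<epsilon> \<le> (K1 / \<tau> + 1) * (N + \<epsilon>)" using N(1)
          by (simp add: algebra_simps add_divide_distrib)
        then show "L * (K1 / \<tau> * N + \<epsilon>) \<le> L * (K1 / \<tau> + 1) * (N + \<epsilon>)" using L by (simp add: mult.assoc)
      qed
      also have "\<dots> = ennreal (L * (K1 / \<tau> + 1)) * (WTnorm X f + ennreal \<epsilon>)"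
        using K1 L N \<tau> \<epsilon> by (simp add: ennreal_mult[symmetric] ennreal_plus[symmetric] add_pos_pos less_imp_le del: ennreal_plus)
      finally show "ennreal (2 powr real_of_int i) * Xe X (\<lambda>x. \<Sum>j. indicator (ball (cen i j) (rad i j)) x)
        \<le> ennreal (L * (K1 / \<tau> + 1)) * (WTnorm X f + ennreal \<epsilon>)" .
    qed
    have "decomp X (1 / 20) 2 f a cen rad"
      unfolding decomp_def
    proof (intro conjI allI)
      show "dval X cen rad < top"
        by (rule le_less_trans[OF dv]) (simp add: N(2) ennreal_mult_less_top)
      show "(\<Sum>j. indicator (ball (cen i j) (1 / 20 * rad i j)) x :: ennreal) \<le> of_nat 2" for i x
        by (rule order_trans[OF ov]) (auto simp: indicator_def)
    qed (fact atom rep)+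
    with dv show "\<exists>a cen rad. decomp X (1 / 20) 2 f a cen rad \<and> dval X cen rad \<le> ennreal (L * (K1 / \<tau> + 1)) * (WTnorm X f + ennreal \<epsilon>)"
      by blast
  qed
qed

section \<open>Both directions with common c and M0, and the infimum\<close>

theorem theorem3p7:
  fixes X :: "(real^'n \<Rightarrow> real) \<Rightarrow> ennreal" and pm :: real
  assumes "ball_qBfs X" and "0 < pm" and "FS X pm"
    and "\<forall>r. 0 < r \<and> r < min pm 1 \<longrightarrow> ball_Bfs (Xpow X (1 / r))"
    and "\<exists>r0 p0 C. 0 < r0 \<and> r0 < min pm 1 \<and> r0 < p0 \<and> 0 < C \<and>
           (\<forall>f\<in>borel_measurable lebesgue.
              assoc (Xpow X (1 / r0)) (\<lambda>x. ennreal \<bar>f x\<bar>) < top \<longrightarrow>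
              assoc (Xpow X (1 / r0)) (Mtheta (conj_exp (p0 / r0)) f)
                \<le> ennreal C * assoc (Xpow X (1 / r0)) (\<lambda>x. ennreal \<bar>f x\<bar>))"
  shows "\<exists>c M0 C1 C2. 0 < c \<and> c \<le> 1 \<and> 0 < C1 \<and> 0 < C2 \<and>
    (\<forall>f :: (real^'n) \<times> real \<Rightarrow> complex. f \<in> borel_measurable lebesgue \<longrightarrow>
       (WTnorm X f < top \<longleftrightarrow> (\<exists>a cen rad. decomp X c M0 f a cen rad)) \<and>
       WTnorm X f \<le> ennreal C1 *
         (INF (a, cen, rad)\<in>{(a, cen, rad). decomp X c M0 f a cen rad}. dval X cen rad) \<and>
       (INF (a, cen, rad)\<in>{(a, cen, rad). decomp X c M0 f a cen rad}. dval X cen rad)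
         \<le> ennreal C2 * WTnorm X f)"
proof -
  \<comment> \<open>Half of the minimum lies strictly below both \<open>pm\<close> and 1, as both
    directions ask.\<close>
  define r where "r = min pm 1 / 2"
  have r: "0 < r" "r < pm" "r < 1" using assms(2) by (auto simp: r_def)
  have Bf: "ball_Bfs (Xpow X (1 / r))" using assms(4) r by simp
  obtain C1 where C1: "0 < C1" "\<And>f a cen rad. f \<in> borel_measurable lebesgue \<Longrightarrow> decomp X (1 / 20) 2 f a cen rad \<Longrightarrow>
    WTnorm X f \<le> ennreal C1 * dval X cen rad"
    by (rule decomp_imp_WTnorm_le[OF assms(1,3) r Bf, of "1 / 20" 2]) auto
  obtain C2 where C2: "0 < C2" "\<And>f \<epsilon>. f \<in> borel_measurable lebesgue \<Longrightarrow> WTnorm X f < top \<Longrightarrow> 0 < \<epsilon> \<Longrightarrow>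
    \<exists>a cen rad. decomp X (1 / 20) 2 f a cen rad \<and> dval X cen rad \<le> ennreal C2 * (WTnorm X f + ennreal \<epsilon>)"
    by (rule WTnorm_imp_decomp[OF assms(1,3) r]) blast
  show ?thesis
  \<comment> \<open>The Whitney covering dictates c = 1/20 and M0 = 2; the other direction admits
    every c in (0, 1] and every M0, so this pair serves both.\<close>
  proof (rule exI[of _ "1 / 20"], rule exI[of _ 2], rule exI[of _ C1], rule exI[of _ C2], intro conjI allI impI)
    fix f :: "(real^'n) \<times> real \<Rightarrow> complex"
    assume f: "f \<in> borel_measurable lebesgue"
    let ?I = "INF (a, cen, rad)\<in>{(a, cen, rad). decomp X (1 / 20) 2 f a cen rad}. dval X cen rad"
    show "WTnorm X f < top \<longleftrightarrow> (\<exists>a cen rad. decomp X (1 / 20) 2 f a cen rad)"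
    proof
      assume "WTnorm X f < top"
      from C2(2)[OF f this, of 1] show "\<exists>a cen rad. decomp X (1 / 20) 2 f a cen rad" by auto
    next
      assume "\<exists>a cen rad. decomp X (1 / 20) 2 f a cen rad"
      then obtain a cen rad where dec: "decomp X (1 / 20) 2 f a cen rad" by blast
      then have "dval X cen rad < top" by (simp add: decomp_def)
      then show "WTnorm X f < top"
        by (intro le_less_trans[OF C1(2)[OF f dec]]) (simp add: ennreal_mult_less_top)
    qed
    show "WTnorm X f \<le> ennreal C1 * ?I"
    proof -
      \<comment> \<open>Dividing by \<open>C1\<close> first makes the claim a lower bound for an
        infimum, which is valid also if there is no decomposition.\<close>
      have "ennreal (1 / C1) * WTnorm X f \<le> ?I"
      proof (rule INF_greatest, clarify)
        fix a cen rad assume dec: "decomp X (1 / 20) 2 f a cen rad"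
        have "ennreal (1 / C1) * WTnorm X f \<le> ennreal (1 / C1) * (ennreal C1 * dval X cen rad)"
          by (intro mult_left_mono C1(2)[OF f dec]) simp
        then show "ennreal (1 / C1) * WTnorm X f \<le> dval X cen rad"
          using C1(1) by (simp add: mult.assoc[symmetric] ennreal_mult[symmetric])
      qed
      then have "ennreal C1 * (ennreal (1 / C1) * WTnorm X f) \<le> ennreal C1 * ?I"
        by (rule mult_left_mono) simp
      then show ?thesis using C1(1) by (simp add: mult.assoc[symmetric] ennreal_mult[symmetric])
    qed
    show "?I \<le> ennreal C2 * WTnorm X f"
    proof (cases "WTnorm X f = top")
      case True
      then show ?thesis using C2(1) by (simp add: ennreal_mult_top)
    next
      case False
      show ?thesis
      proof (rule ennreal_le_epsilon)
        fix e :: real assume e: "0 < e"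
        \<comment> \<open>With \<epsilon> = e / C2 the padding contributes exactly e.\<close>
        obtain a cen rad where dec: "decomp X (1 / 20) 2 f a cen rad"
          and le: "dval X cen rad \<le> ennreal C2 * (WTnorm X f + ennreal (e / C2))"
          using C2(2)[OF f, of "e / C2"] False e C2(1) by (auto simp: less_top)
        have "?I \<le> dval X cen rad"
          using INF_lower[of "(a, cen, rad)" _ "\<lambda>(a, cen, rad). dval X cen rad"] dec by auto
        also note le
        also have "ennreal C2 * (WTnorm X f + ennreal (e / C2)) = ennreal C2 * WTnorm X f + ennreal e"
          using C2(1) e by (simp add: distrib_left ennreal_mult[symmetric])
        finally show "?I \<le> ennreal C2 * WTnorm X f + ennreal e" .
      qed
    qed
  qed (use C1 C2 in auto)
qed

end
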